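(* Let $n\ge2$, $p\in(1,2)\cup(2,\infty)$, $R_2>R_1>0$, and $\Omega=\mathbb{B}(O,R_2)\setminus\mathbb{B}(O,R_1)\subset\mathbb{R}^n$ with boundary $\Gamma$. Assume that $f\in C(\overline\Omega)$ is radially symmetric (about $O$) and satisfies ${\rm Sgn}(f)=1$ or ${\rm Sgn}(f)=-1$ on $\overline\Omega$. Then there exists a unique sequence $\{\bar u_\epsilon\}_\epsilon$ (indexed by $\epsilon>0$) of radially symmetric solutions of the Euler-Lagrange equations $${\rm div}\Big(\big(|\nabla u_\epsilon|^2+\chi(p)\epsilon^2\big)^{(p-2)/2}\nabla u_\epsilon\Big)+f=0\ \text{ in }\Omega,\qquad u_\epsilon=0\ \text{ on }\Gamma ,$$ in the form $$\bar u_\epsilon(x)=\int_{x_0}^{x}\vec\eta_\epsilon\cdot d\vec t,\qquad x\in\overline\Omega,\ x_0\in\Gamma,\qquad \vec\eta_\epsilon=(\eta_\epsilon^{(1)},\dots,\eta_\epsilon^{(n)}):=\vec\theta_\epsilon/\lambda_\epsilon ,$$ where $\vec\eta_\epsilon$ satisfies the path-independence condition $\partial_{x_i}\eta_\epsilon^{(j)}-\partial_{x_j}\eta_\epsilon^{(i)}=0$ for $i,j=1,\dots,n$. This sequence is at the same time a sequence of global minimizers over $\mathscr{N}$ for the approximation problems $\min_{u_\epsilon\in\mathscr{N}}I^{(\epsilon)}[u_\epsilon]$. Moreover, the corresponding $\{\bar\zeta_\epsilon\}_\epsilon$ is a sequence of global minimizers for the dual problems $\min_{\zeta_\epsilon\in\mathscr{V}_\epsilon}I_d^{(\epsilon)}[\zeta_\epsilon]$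 if $p\in(1,2)$, and a sequence of global maximizers for the dual problems $\max_{\zeta_\epsilon\in\mathscr{V}_\epsilon}I_d^{(\epsilon)}[\zeta_\epsilon]$ if $p\in(2,\infty)$, and the following duality identities hold: $$I^{(\epsilon)}[\bar u_\epsilon]=\min_{u_\epsilon\in\mathscr{N}}I^{(\epsilon)}[u_\epsilon]=\Xi(\bar u_\epsilon,\bar\zeta_\epsilon)=\min_{\zeta_\epsilon\in\mathscr{V}_\epsilon}I_d^{(\epsilon)}[\zeta_\epsilon]=I_d^{(\epsilon)}[\bar\zeta_\epsilon]\quad\text{for }p\in(1,2),$$ $$I^{(\epsilon)}[\bar u_\epsilon]=\min_{u_\epsilon\in\mathscr{N}}I^{(\epsilon)}[u_\epsilon]=\Xi(\bar u_\epsilon,\bar\zeta_\epsilon)=\max_{\zeta_\epsilon\in\mathscr{V}_\epsilon}I_d^{(\epsilon)}[\zeta_\epsilon]=I_d^{(\epsilon)}[\bar\zeta_\epsilon]\quad\text{for }p\in(2,\infty).$$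
   Context: $\mathbb{B}(O,R)$ is the open ball of center $O$ and radius $R$ in $\mathbb{R}^n$. ${\rm Sgn}(f)=1$ means $f>0$ on $\overline\Omega$; ${\rm Sgn}(f)=-1$ means $f<0$ on $\overline\Omega$. Set $\chi(p)=1$ for $p\in(1,2)$ and $\chi(p)=0$ for $p\in(2,\infty)$. The primal feasible space is $\mathscr{N}=\{u\in W_0^{1,p}(\Omega)\cap C(\overline\Omega): u\text{ is radially symmetric}\}$, and the primal functional (potential energy) is $$I^{(\epsilon)}[u]=\frac1p\int_\Omega\big(|\nabla u|^2+\chi(p)\epsilon^2\big)^{p/2}dx-\int_\Omega fu\,dx .$$ The dual feasible space is $\mathscr{V}_\epsilon=\{\phi: 0<\phi\le\epsilon^{p-2}/2\}$ (functions $\phi$ on $\Omega$) if $p\in(1,2)$, and $\mathscr{V}_\epsilon=\{\phi:\phi\in L^{p/(p-2)}(\Omega)\}$ if $p\in(2,\infty)$. Total complementary energy: with $\Phi_\epsilon(u)=|\nabla u|^2+\chi(p)\epsilon^2$ and $\Psi_*(\zeta)=\frac{p-2}{2p}(2\zeta)^{p/(p-2)}$ (the Legendre transform of $\Psi(\xi)=\xi^{p/2}/p$ under $\zeta=\xi^{(p-2)/2}/2$), $$\Xi(u,\zeta)=\int_\Omega\{\Phi_\epsilon(u)\zeta-\Psi_*(\zeta)-fu\}\,dx .$$ A pair $(\bar u_\epsilon,\bar\zeta_\epsilon)$ is a critical pair of $\Xi$ if both partial Gâteaux derivatives of $\Xi$ vanish there. In the claim, $\bar\zeta_\epsilon$ is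 the dual component of the critical pair with primal component $\bar u_\epsilon$, that is, $\bar\zeta_\epsilon=\frac12\big(|\nabla\bar u_\epsilon|^2+\chi(p)\epsilon^2\big)^{(p-2)/2}$; $\lambda_\epsilon:=2\bar\zeta_\epsilon$; and $\vec\theta_\epsilon=(|\nabla\bar u_\epsilon|^2+\chi(p)\epsilon^2)^{(p-2)/2}\nabla\bar u_\epsilon$, so that ${\rm div}\,\vec\theta_\epsilon+f=0$ in $\Omega$. These satisfy the dual algebraic equation $|\vec\theta_\epsilon|^2=E_{\epsilon,p}(\lambda_\epsilon)$, where $E_{\epsilon,p}(r)=r^{(2p-2)/(p-2)}-\chi(p)\epsilon^2r^2$, which is strictly decreasing on $(0,\epsilon^{p-2}]$ for $p\in(1,2)$ and strictly increasing on $[0,\infty)$ for $p\in(2,\infty)$. Pure complementary energy (dual functional): $I_d^{(\epsilon)}[\zeta]=\Xi(\bar u_\epsilon,\zeta)$, which is rewritten, with $\vec\theta_\epsilon$ the fixed vector field above, as $$I_d^{(\epsilon)}[\zeta]=-\frac12\int_\Omega\Big\{\frac{|\vec\theta_\epsilon|^2}{2\zeta}-2\chi(p)\epsilon^2\zeta+\frac{p-2}{p}(2\zeta)^{p/(p-2)}\Big\}dx ;$$ this integral formula is the functional used in the dual problems.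
   Formalization: For p>2 the dual feasible space is restricted to functions in L^{p/(p-2)} that are nonnegative a.e., and the path-independence condition is asserted classically only where λ_ε≠0 and in the sense of distributions on all of Ω. *)

theory Defs
  imports "HOL-Analysis.Analysis"
begin

text \<open>
  Functions on subsets of Euclidean space are total functions whose values outside
  the (closed) domain are irrelevant.  Every integral over \<open>S\<close> is taken with respect to
  \<open>lebesgue_on S\<close>.
\<close>

text \<open>
  A domain is open, but the difference of two open balls contains the inner sphere;
  taking the interior removes it and changes neither closure nor boundary.
\<close>

definition annulus :: "real \<Rightarrow> real \<Rightarrow> (real ^ 'n) set" where
  "annulus R1 R2 = interior (ball 0 R2 - ball 0 R1)"

definition radial_on :: "(real ^ 'n) set \<Rightarrow> (real ^ 'n \<Rightarrow> real) \<Rightarrow> bool" where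
  "radial_on S u \<longleftrightarrow> (\<forall>x\<in>S. \<forall>y\<in>S. norm x = norm y \<longrightarrow> u x = u y)"

text \<open>
  The classical gradient relative to \<open>S\<close>.  With \<open>S\<close> the closure of an open set it is the
  usual gradient at interior points; on the boundary of an annulus it is the one-sided
  gradient, which is still uniquely determined.
\<close>

definition grad :: "(real ^ 'n) set \<Rightarrow> (real ^ 'n \<Rightarrow> real) \<Rightarrow> real ^ 'n \<Rightarrow> real ^ 'n" where
  "grad S u x = (THE g. (u has_derivative (\<lambda>h. g \<bullet> h)) (at x within S))"

definition has_divergence :: "(real ^ 'n \<Rightarrow> real ^ 'n) \<Rightarrow> real \<Rightarrow> real ^ 'n \<Rightarrow> bool" where
  "has_divergence F d x \<longleftrightarrow>
     (\<exists>D. (F has_derivative D) (at x) \<and> d = (\<Sum>i\<in>UNIV. D (axis i 1) $ i))"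

definition has_partial :: "(real ^ 'n \<Rightarrow> real) \<Rightarrow> 'n \<Rightarrow> real \<Rightarrow> real ^ 'n \<Rightarrow> bool" where
  "has_partial g i d x \<longleftrightarrow> ((\<lambda>s. g (x + s *\<^sub>R axis i 1)) has_real_derivative d) (at 0)"

definition has_line_integral ::
  "(real ^ 'n \<Rightarrow> real ^ 'n) \<Rightarrow> real \<Rightarrow> (real \<Rightarrow> real ^ 'n) \<Rightarrow> bool" where
  "has_line_integral F I \<gamma> \<longleftrightarrow>
     ((\<lambda>t. F (\<gamma> t) \<bullet> vector_derivative \<gamma> (at t within {0..1})) has_integral I) {0..1}"

section \<open>Sobolev spaces\<close>

primrec C_k :: "nat \<Rightarrow> (real ^ 'n \<Rightarrow> real) \<Rightarrow> bool" where
  "C_k 0 \<phi> = continuous_on UNIV \<phi>"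
| "C_k (Suc k) \<phi> =
     (\<exists>g. (\<forall>x. (\<phi> has_derivative (\<lambda>h. g x \<bullet> h)) (at x)) \<and> (\<forall>i. C_k k (\<lambda>x. g x $ i)))"

definition test_functions :: "(real ^ 'n) set \<Rightarrow> (real ^ 'n \<Rightarrow> real) set" where
  "test_functions S =
     {\<phi>. (\<forall>k. C_k k \<phi>) \<and> compact (closure {x. \<phi> x \<noteq> 0}) \<and> closure {x. \<phi> x \<noteq> 0} \<subseteq> S}"

definition in_Lp ::
  "real \<Rightarrow> (real ^ 'n) set \<Rightarrow> (real ^ 'n \<Rightarrow> 'b::{second_countable_topology,banach}) \<Rightarrow> bool" where
  "in_Lp q S g \<longleftrightarrow> g \<in> borel_measurable (lebesgue_on S) \<and>
     integrable (lebesgue_on S) (\<lambda>x. norm (g x) powr q)"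

definition locally_integrable ::
  "(real ^ 'n) set \<Rightarrow> (real ^ 'n \<Rightarrow> 'b::{second_countable_topology,banach}) \<Rightarrow> bool" where
  "locally_integrable S g \<longleftrightarrow>
     (\<forall>K. compact K \<and> K \<subseteq> S \<longrightarrow> integrable (lebesgue_on K) g)"

definition has_weak_grad ::
  "(real ^ 'n) set \<Rightarrow> (real ^ 'n \<Rightarrow> real) \<Rightarrow> (real ^ 'n \<Rightarrow> real ^ 'n) \<Rightarrow> bool" where
  "has_weak_grad S u g \<longleftrightarrow> locally_integrable S u \<and> locally_integrable S g \<and>
     (\<forall>\<phi>\<in>test_functions S.
        (\<integral>x. u x *\<^sub>R grad UNIV \<phi> x \<partial>lebesgue_on S) = - (\<integral>x. \<phi> x *\<^sub>R g x \<partial>lebesgue_on S))"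

text \<open>Determined up to a null set; only used under integrals.\<close>

definition weak_grad :: "(real ^ 'n) set \<Rightarrow> (real ^ 'n \<Rightarrow> real) \<Rightarrow> real ^ 'n \<Rightarrow> real ^ 'n" where
  "weak_grad S u = (SOME g. has_weak_grad S u g)"

definition W1p :: "real \<Rightarrow> (real ^ 'n) set \<Rightarrow> (real ^ 'n \<Rightarrow> real) set" where
  "W1p p S = {u. in_Lp p S u \<and> (\<exists>g. has_weak_grad S u g \<and> in_Lp p S g)}"

text \<open>The closure of the test functions in \<open>W1p p S\<close>.\<close>

definition W01p :: "real \<Rightarrow> (real ^ 'n) set \<Rightarrow> (real ^ 'n \<Rightarrow> real) set" where
  "W01p p S = {u \<in> W1p p S. \<forall>e>0. \<exists>\<phi>\<in>test_functions S.
     (\<integral>x. \<bar>u x - \<phi> x\<bar> powr p \<partial>lebesgue_on S)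
     + (\<integral>x. norm (weak_grad S u x - grad UNIV \<phi> x) powr p \<partial>lebesgue_on S) < e}"

section \<open>The primal problem\<close>

definition chi :: "real \<Rightarrow> real" where
  "chi p = (if p < 2 then 1 else 0)"

definition primal_space :: "real \<Rightarrow> (real ^ 'n) set \<Rightarrow> (real ^ 'n \<Rightarrow> real) set" where
  "primal_space p S = {u \<in> W01p p S. continuous_on (closure S) u \<and> radial_on (closure S) u}"

definition Phi :: "real \<Rightarrow> real \<Rightarrow> real ^ 'n \<Rightarrow> real" where
  "Phi p \<epsilon> g = (norm g)\<^sup>2 + chi p * \<epsilon>\<^sup>2"

definition primal_energy ::
  "real \<Rightarrow> real \<Rightarrow> (real ^ 'n) set \<Rightarrow> (real ^ 'n \<Rightarrow> real) \<Rightarrow> (real ^ 'n \<Rightarrow> real) \<Rightarrow> real" where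
  "primal_energy p \<epsilon> S f u =
     1 / p * (\<integral>x. Phi p \<epsilon> (weak_grad S u x) powr (p / 2) \<partial>lebesgue_on S)
     - (\<integral>x. f x * u x \<partial>lebesgue_on S)"

text \<open>
  The fields attached to a solution \<open>u\<close>, defined on the whole closure of \<open>S\<close>.  For \<open>p > 2\<close>
  the function \<open>lam\<close> vanishes exactly where the gradient does, and there
  \<open>eta = 0\<close> by the convention for division by zero.
\<close>

definition theta ::
  "real \<Rightarrow> real \<Rightarrow> (real ^ 'n) set \<Rightarrow> (real ^ 'n \<Rightarrow> real) \<Rightarrow> real ^ 'n \<Rightarrow> real ^ 'n" where
  "theta p \<epsilon> S u x =
     (Phi p \<epsilon> (grad (closure S) u x) powr ((p - 2) / 2)) *\<^sub>R grad (closure S) u x"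

definition zeta_bar ::
  "real \<Rightarrow> real \<Rightarrow> (real ^ 'n) set \<Rightarrow> (real ^ 'n \<Rightarrow> real) \<Rightarrow> real ^ 'n \<Rightarrow> real" where
  "zeta_bar p \<epsilon> S u x = 1 / 2 * Phi p \<epsilon> (grad (closure S) u x) powr ((p - 2) / 2)"

definition lam ::
  "real \<Rightarrow> real \<Rightarrow> (real ^ 'n) set \<Rightarrow> (real ^ 'n \<Rightarrow> real) \<Rightarrow> real ^ 'n \<Rightarrow> real" where
  "lam p \<epsilon> S u x = 2 * zeta_bar p \<epsilon> S u x"

definition eta ::
  "real \<Rightarrow> real \<Rightarrow> (real ^ 'n) set \<Rightarrow> (real ^ 'n \<Rightarrow> real) \<Rightarrow> real ^ 'n \<Rightarrow> real ^ 'n" where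
  "eta p \<epsilon> S u x = theta p \<epsilon> S u x /\<^sub>R lam p \<epsilon> S u x"

text \<open>
  The equation holds pointwise, with the flux \<open>theta\<close> differentiable as a whole.  For
  \<open>p > 2\<close> solutions are in general not twice differentiable where the gradient vanishes.
\<close>

definition radial_solution ::
  "real \<Rightarrow> real \<Rightarrow> (real ^ 'n) set \<Rightarrow> (real ^ 'n \<Rightarrow> real) \<Rightarrow> (real ^ 'n \<Rightarrow> real) \<Rightarrow> bool" where
  "radial_solution p \<epsilon> S f u \<longleftrightarrow>
     continuous_on (closure S) u \<and> radial_on (closure S) u \<and>
     (\<forall>x\<in>S. u differentiable (at x)) \<and>
     (\<forall>x\<in>S. \<exists>d. has_divergence (theta p \<epsilon> S u) d x \<and> d + f x = 0) \<and>
     (\<forall>x\<in>frontier S. u x = 0)"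

text \<open>
  The condition \<open>\<partial>\<^sub>i F\<^sub>j - \<partial>\<^sub>j F\<^sub>i = 0\<close> on \<open>S\<close>, in the classical sense on \<open>S \<inter> A\<close> and in the
  sense of distributions on all of \<open>S\<close>.
\<close>

definition path_independence ::
  "(real ^ 'n) set \<Rightarrow> (real ^ 'n) set \<Rightarrow> (real ^ 'n \<Rightarrow> real ^ 'n) \<Rightarrow> bool" where
  "path_independence S A F \<longleftrightarrow>
     (\<forall>x\<in>S \<inter> A. \<forall>i j. \<exists>a b. has_partial (\<lambda>y. F y $ j) i a x \<and>
        has_partial (\<lambda>y. F y $ i) j b x \<and> a - b = 0) \<and>
     locally_integrable S F \<and>
     (\<forall>\<phi>\<in>test_functions S. \<forall>i j.
        (\<integral>x. F x $ j * grad UNIV \<phi> x $ i - F x $ i * grad UNIV \<phi> x $ j \<partial>lebesgue_on S) = 0)"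

section \<open>The dual problem\<close>

text \<open>
  For \<open>p > 2\<close> the constraint \<open>0 \<le> \<phi>\<close> a.e. makes the real power \<open>(2 * \<phi>) powr (p / (p - 2))\<close>
  meaningful.  It cannot be dropped: the dual energy tends to \<open>\<infinity>\<close> as \<open>\<phi>\<close> tends to \<open>0\<close> from below.
\<close>

definition dual_space :: "real \<Rightarrow> real \<Rightarrow> (real ^ 'n) set \<Rightarrow> (real ^ 'n \<Rightarrow> real) set" where
  "dual_space p \<epsilon> S =
     (if p < 2
      then {\<phi> \<in> borel_measurable (lebesgue_on S). \<forall>x\<in>S. 0 < \<phi> x \<and> \<phi> x \<le> \<epsilon> powr (p - 2) / 2}
      else {\<phi>. in_Lp (p / (p - 2)) S \<phi> \<and> (AE x in lebesgue_on S. 0 \<le> \<phi> x)})"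

definition Psi_star :: "real \<Rightarrow> real \<Rightarrow> real" where
  "Psi_star p z = (p - 2) / (2 * p) * (2 * z) powr (p / (p - 2))"

definition Xi ::
  "real \<Rightarrow> real \<Rightarrow> (real ^ 'n) set \<Rightarrow> (real ^ 'n \<Rightarrow> real) \<Rightarrow> (real ^ 'n \<Rightarrow> real) \<Rightarrow>
   (real ^ 'n \<Rightarrow> real) \<Rightarrow> real" where
  "Xi p \<epsilon> S f u z =
     (\<integral>x. Phi p \<epsilon> (weak_grad S u x) * z x - Psi_star p (z x) - f x * u x \<partial>lebesgue_on S)"

text \<open>
  The dual energy can be infinite at admissible points (\<open>\<infinity>\<close> for \<open>p < 2\<close>, \<open>-\<infinity>\<close> for \<open>p > 2\<close>), so
  the Bochner integral, which is \<open>0\<close> for non-integrable functions, is not suitable.  On the dual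
  space at most one of the two parts below is infinite when \<open>t\<close> is bounded.
\<close>

definition ext_integral :: "'a measure \<Rightarrow> ('a \<Rightarrow> ereal) \<Rightarrow> ereal" where
  "ext_integral M g =
     enn2ereal (\<integral>\<^sup>+x. e2ennreal (g x) \<partial>M) - enn2ereal (\<integral>\<^sup>+x. e2ennreal (- g x) \<partial>M)"

text \<open>
  \<open>t\<close> is the fixed vector field.  The quotient is taken in the extended reals: at \<open>z x = 0\<close>
  it is \<open>\<infinity>\<close> if \<open>t x \<noteq> 0\<close>, and \<open>0\<close> if \<open>t x = 0\<close>.
\<close>

definition dual_energy ::
  "real \<Rightarrow> real \<Rightarrow> (real ^ 'n) set \<Rightarrow> (real ^ 'n \<Rightarrow> real ^ 'n) \<Rightarrow> (real ^ 'n \<Rightarrow> real) \<Rightarrow> ereal" where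
  "dual_energy p \<epsilon> S t z =
     ereal (- (1 / 2)) * ext_integral (lebesgue_on S)
       (\<lambda>x. ereal ((norm (t x))\<^sup>2) / ereal (2 * z x)
          + ereal (- (2 * chi p * \<epsilon>\<^sup>2 * z x) + (p - 2) / p * (2 * z x) powr (p / (p - 2))))"

end

theory Submission
  imports Defs
begin

text \<open>
  Write \<open>u x = U \<bar>x\<bar>\<close>, \<open>w = U'\<close> and let \<open>flux s = (s\<^sup>2 + \<chi> \<epsilon>\<^sup>2) powr ((p - 2) / 2) * s\<close>, an increasing
  homeomorphism of the line.  The equation says that \<open>r ^ (n - 1) * flux (w r)\<close> has derivative
  \<open>- r ^ (n - 1) * f r\<close>, so \<open>w\<close> is known up to one constant of integration, and the boundary
  condition \<open>\<integral> w = 0\<close> fixes this constant: existence is the intermediate value theorem, uniqueness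
  is Rolle's theorem.  The flux of \<open>u\<close> satisfies the weak form of the equation against test
  functions, hence by density against every element of \<open>W01p\<close>; convexity of
  \<open>\<xi> \<mapsto> (\<bar>\<xi>\<bar>\<^sup>2 + \<chi> \<epsilon>\<^sup>2) powr (p / 2)\<close> then gives minimality.  The dual problem is solved pointwise: at
  each \<open>x\<close> the integrand, as a function of \<open>\<zeta>\<close>, is optimal at \<open>zeta_bar\<close>.
\<close>

section \<open>Smooth functions\<close>

text \<open>Three obstacles shape the proof. For p > 2 the slope \<open>w\<close> need not be
  differentiable where it vanishes, so the gradient of the solution is merely continuous there; the
  flux is nevertheless C^1 inside, since the equation itself supplies its derivative. The weak form
  is therefore derived from the flux, and the distributional curl condition is proved without second
  derivatives. Next, integration by parts is used only against functions of compact support, where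
  it follows from translation invariance of Lebesgue measure; the boundary condition enters the
  energy argument through membership in \<open>W01p\<close>. This asks for test functions close to
  \<open>u\<close> with supports off both spheres; they come from the radial profile in one
  variable. Finally, \<open>weak_grad\<close> is an arbitrary choice, and the fundamental lemma of
  the calculus of variations identifies it almost everywhere with the classical gradient. The
  constant of integration is bracketed by the minimum and the maximum of an antiderivative of r ^ (n
  - 1) * f r: for either value the slope keeps one sign on the whole interval.\<close>

lemma C_k_Suc_imp: "C_k (Suc k) \<phi> \<Longrightarrow> C_k k \<phi>"
proof (induction k arbitrary: \<phi>)
  case 0
  then obtain g where "\<And>x. (\<phi> has_derivative (\<lambda>h. g x \<bullet> h)) (at x)" by auto
  then show ?case
    by (auto intro!: has_derivative_continuous continuous_at_imp_continuous_on)
next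
  case (Suc k)
  then obtain g where "\<And>x. (\<phi> has_derivative (\<lambda>h. g x \<bullet> h)) (at x)"
      and g: "\<And>i. C_k (Suc k) (\<lambda>x. g x $ i)"
    by (subst (asm) C_k.simps) blast
  with Suc.IH[OF g] show ?case by auto
qed

lemma C_k_const: "C_k k (\<lambda>x. c)"
  by (induction k arbitrary: c) (auto intro!: exI[of _ "\<lambda>x. 0"])

lemma C_k_add: "C_k k a \<Longrightarrow> C_k k b \<Longrightarrow> C_k k (\<lambda>x. a x + b x)"
proof (induction k arbitrary: a b)
  case 0 then show ?case by (auto intro: continuous_on_add)
next
  case (Suc k)
  from Suc.prems obtain g g' where
     "\<And>x. (a has_derivative (\<lambda>h. g x \<bullet> h)) (at x)" "\<And>i. C_k k (\<lambda>x. g x $ i)"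
     "\<And>x. (b has_derivative (\<lambda>h. g' x \<bullet> h)) (at x)" "\<And>i. C_k k (\<lambda>x. g' x $ i)"
    by auto
  then show ?case using Suc.IH
    by (auto intro!: exI[of _ "\<lambda>x. g x + g' x"] derivative_eq_intros simp: inner_add_left)
qed

lemma C_k_mult: "C_k k a \<Longrightarrow> C_k k b \<Longrightarrow> C_k k (\<lambda>x. a x * b x)"
proof (induction k arbitrary: a b)
  case 0 then show ?case by (auto intro: continuous_on_mult)
next
  case (Suc k)
  \<comment> \<open>The product rule pairs each gradient with the other factor undifferentiated,
    which therefore has to be known at order \<open>k\<close> as well.\<close>
  have ab: "C_k k a" "C_k k b" using Suc.prems C_k_Suc_imp by blast+
  from Suc.prems obtain g g' where
     "\<And>x. (a has_derivative (\<lambda>h. g x \<bullet> h)) (at x)" "\<And>i. C_k k (\<lambda>x. g x $ i)"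
     "\<And>x. (b has_derivative (\<lambda>h. g' x \<bullet> h)) (at x)" "\<And>i. C_k k (\<lambda>x. g' x $ i)"
    by auto
  then show ?case using Suc.IH ab
    by (auto intro!: exI[of _ "\<lambda>x. a x *\<^sub>R g' x + b x *\<^sub>R g x"] derivative_eq_intros C_k_add
        simp: inner_add_left)
qed

lemma C_k_sum: "finite I \<Longrightarrow> (\<And>i. i \<in> I \<Longrightarrow> C_k k (a i)) \<Longrightarrow> C_k k (\<lambda>x. \<Sum>i\<in>I. a i x)"
  by (induction rule: finite_induct) (auto intro!: C_k_const C_k_add)

lemma C_k_prod: "finite I \<Longrightarrow> (\<And>i. i \<in> I \<Longrightarrow> C_k k (a i)) \<Longrightarrow> C_k k (\<lambda>x. \<Prod>i\<in>I. a i x)"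
  by (induction rule: finite_induct) (auto intro!: C_k_const C_k_mult)

lemma C_k_component: "C_k k (\<lambda>x :: real^'n. x $ i)"
proof (cases k)
  case 0 then show ?thesis by (auto intro!: continuous_intros)
next
  case (Suc m)
  have "((\<lambda>x. x $ i) has_derivative (\<lambda>h. axis i 1 \<bullet> h)) (at x)" for x
    using bounded_linear_imp_has_derivative[OF bounded_linear_vec_nth] by (simp add: inner_axis')
  then show ?thesis unfolding Suc
    by (auto intro!: C_k_const exI[of _ "\<lambda>_. axis i 1"])
qed

section \<open>Smooth functions of one real variable\<close>

text \<open>The cutoffs are differentiated on the line and reach space through
  \<open>C_k_compose\<close>, which needs a one-variable class built by the same recursion as
  \<open>C_k\<close>.\<close>

primrec C_k_real :: "nat \<Rightarrow> (real \<Rightarrow> real) \<Rightarrow> bool" where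
  "C_k_real 0 g = continuous_on UNIV g"
| "C_k_real (Suc k) g = (\<exists>g'. (\<forall>x. (g has_real_derivative g' x) (at x)) \<and> C_k_real k g')"

lemma C_k_real_Suc_imp: "C_k_real (Suc k) g \<Longrightarrow> C_k_real k g"
proof (induction k arbitrary: g)
  case 0
  then obtain g' where "\<And>x. (g has_real_derivative g' x) (at x)" by auto
  then have "isCont g x" for x by (rule DERIV_isCont)
  then show ?case by (auto intro: continuous_at_imp_continuous_on)
next
  case (Suc k)
  then show ?case by (metis C_k_real.simps(2))
qed

lemma C_k_real_const: "C_k_real k (\<lambda>x. c)"
  by (induction k arbitrary: c) (auto intro!: exI[of _ "\<lambda>x. 0"])

lemma C_k_real_add: "C_k_real k a \<Longrightarrow> C_k_real k b \<Longrightarrow> C_k_real k (\<lambda>x. a x + b x)"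
proof (induction k arbitrary: a b)
  case 0 then show ?case by (auto intro: continuous_on_add)
next
  case (Suc k)
  then obtain g g' where "\<And>x. (a has_real_derivative g x) (at x)" "C_k_real k g"
    "\<And>x. (b has_real_derivative g' x) (at x)" "C_k_real k g'" by auto
  then show ?case using Suc.IH
    by (auto intro!: exI[of _ "\<lambda>x. g x + g' x"] derivative_eq_intros)
qed

lemma C_k_real_mult: "C_k_real k a \<Longrightarrow> C_k_real k b \<Longrightarrow> C_k_real k (\<lambda>x. a x * b x)"
proof (induction k arbitrary: a b)
  case 0 then show ?case by (auto intro: continuous_on_mult)
next
  case (Suc k)
  have ab: "C_k_real k a" "C_k_real k b" using Suc.prems C_k_real_Suc_imp by blast+
  from Suc.prems obtain g g' where "\<And>x. (a has_real_derivative g x) (at x)" "C_k_real k g"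
    "\<And>x. (b has_real_derivative g' x) (at x)" "C_k_real k g'" by auto
  then show ?case using Suc.IH ab
    by (auto intro!: exI[of _ "\<lambda>x. g x * b x + a x * g' x"] derivative_eq_intros C_k_real_add)
qed

lemma C_k_real_affine: "C_k_real k g \<Longrightarrow> C_k_real k (\<lambda>x. g (c * x + d))"
proof (induction k arbitrary: g)
  case 0 then show ?case
    by (auto intro!: continuous_on_compose2[of UNIV g] continuous_intros)
next
  case (Suc k)
  then obtain g' where g': "\<And>x. (g has_real_derivative g' x) (at x)" "C_k_real k g'" by auto
  have "((\<lambda>x. g (c * x + d)) has_real_derivative g' (c * x + d) * c) (at x)" for x
    by (rule DERIV_chain2[OF g'(1)]) (auto intro!: derivative_eq_intros)
  then show ?case using Suc.IH[OF g'(2)]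
    by (auto intro!: exI[of _ "\<lambda>x. g' (c * x + d) * c"] C_k_real_mult C_k_real_const)
qed

lemma C_k_real_polynomial: "real_polynomial_function q \<Longrightarrow> C_k_real k q"
proof (induction k arbitrary: q)
  case 0 then show ?case
    by (auto intro: continuous_on_polymonial_function simp: real_polynomial_function_eq)
next
  case (Suc k)
  then show ?case using has_real_derivative_polynomial_function[OF Suc.prems] by auto
qed

lemma C_k_compose: "C_k_real k g \<Longrightarrow> C_k k \<phi> \<Longrightarrow> C_k k (\<lambda>x. g (\<phi> x))"
proof (induction k arbitrary: g)
  case 0 then show ?case by (auto intro: continuous_on_compose2)
next
  case (Suc k)
  then obtain g' where g': "\<And>x. (g has_real_derivative g' x) (at x)" "C_k_real k g'" by auto
  from Suc.prems obtain d where d: "\<And>x. (\<phi> has_derivative (\<lambda>h. d x \<bullet> h)) (at x)"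
      "\<And>i. C_k k (\<lambda>x. d x $ i)" by auto
  have "((\<lambda>x. g (\<phi> x)) has_derivative (\<lambda>h. (g' (\<phi> x) *\<^sub>R d x) \<bullet> h)) (at x)" for x
    using has_derivative_compose[OF d(1) g'(1)[unfolded has_field_derivative_def]] by simp
  moreover have "C_k k (\<lambda>x. g' (\<phi> x))"
    using Suc.IH[OF g'(2)] Suc.prems(2) C_k_Suc_imp by blast
  ultimately show ?case using d(2)
    by (auto intro!: exI[of _ "\<lambda>x. g' (\<phi> x) *\<^sub>R d x"] C_k_mult)
qed

section \<open>Smooth cutoff functions\<close>

text \<open>\<open>flat 0\<close> is the classical function exp (- 1 / t), all of whose derivatives
  vanish at 0. The factors (1 / t) ^ m are carried along because differentiation then stays in the
  linear span of the family, which makes smoothness a short induction.\<close>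

definition flat :: "nat \<Rightarrow> real \<Rightarrow> real" where
  "flat m t = (if 0 < t then (1 / t) ^ m * exp (- (1 / t)) else 0)"

text \<open>Substituting the inverse of t turns this into x ^ m / exp x at infinity.\<close>

lemma flat_tendsto_0: "(flat m \<longlongrightarrow> 0) (at_right 0)"
proof -
  have "((\<lambda>x. x ^ m / exp x) \<longlongrightarrow> (0::real)) at_top"
    by (rule tendsto_power_div_exp_0)
  then have "((\<lambda>t. (inverse t) ^ m / exp (inverse t)) \<longlongrightarrow> (0::real)) (at_right 0)"
    by (rule filterlim_compose) (rule filterlim_inverse_at_top_right)
  moreover have "eventually (\<lambda>t. (inverse t) ^ m / exp (inverse t) = flat m t) (at_right 0)"
    using eventually_at_right_less[of "0::real"]
    by eventually_elim (simp add: flat_def exp_minus field_simps)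
  ultimately show ?thesis by (rule Lim_transform_eventually)
qed

lemma DERIV_flat: "(flat m has_real_derivative flat (m + 2) t - m * flat (Suc m) t) (at t)"
proof -
  consider "t < 0" | "t = 0" | "t > 0" by linarith
  then show ?thesis
  proof cases
    case 1
    have ev: "\<forall>\<^sub>F s in nhds t. 0 = flat m s"
      using eventually_nhds_in_open[of "{..<0}" t] 1
      by (auto simp: flat_def elim!: eventually_mono)
    have "((\<lambda>_. 0) has_real_derivative 0) (at t)" by simp
    then have "(flat m has_real_derivative 0) (at t)"
      using DERIV_cong_ev[OF refl ev refl] by blast
    then show ?thesis using 1 by (simp add: flat_def)
  next
    case 2
    \<comment> \<open>For \<open>h > 0\<close> dividing by \<open>h\<close> raises \<open>m\<close>
      by one, so the difference quotient at 0 is again a member of the family and tends to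
      0.\<close>
    have r: "((\<lambda>h. flat m h / h) \<longlongrightarrow> 0) (at_right 0)"
    proof (rule Lim_transform_eventually[OF flat_tendsto_0])
      show "\<forall>\<^sub>F h in at_right 0. flat (Suc m) h = flat m h / h"
        using eventually_at_right_less[of "0::real"]
        by eventually_elim (simp add: flat_def)
    qed
    have l: "((\<lambda>h. flat m h / h) \<longlongrightarrow> 0) (at_left 0)"
    proof (rule tendsto_eventually)
      show "\<forall>\<^sub>F h in at_left 0. flat m h / h = 0"
        using eventually_at_left_real[of "-1" 0]
        by (auto simp: flat_def elim!: eventually_mono)
    qed
    have "((\<lambda>h. flat m h / h) \<longlongrightarrow> 0) (at 0)"
      using l r by (simp add: filterlim_split_at)
    then show ?thesis unfolding 2 DERIV_def by (simp add: flat_def)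
  next
    case 3
    have ev: "\<forall>\<^sub>F s in nhds t. (1 / s) ^ m * exp (- (1 / s)) = flat m s"
      using eventually_nhds_in_open[of "{0<..}" t] 3
      by (auto simp: flat_def elim!: eventually_mono)
    define y where "y = 1 / t"
    have inv: "((\<lambda>s. 1 / s) has_real_derivative - y\<^sup>2) (at t)"
      using 3 by (auto intro!: derivative_eq_intros simp: y_def power2_eq_square)
    have "((\<lambda>s. (1 / s) ^ m * exp (- (1 / s))) has_real_derivative
        y ^ m * (exp (- y) * y\<^sup>2) + (m * y ^ (m - 1) * (- y\<^sup>2)) * exp (- y)) (at t)"
      by (rule derivative_eq_intros inv refl)+ (simp add: y_def)
    moreover have "y ^ m * (exp (- y) * y\<^sup>2) + (m * y ^ (m - 1) * (- y\<^sup>2)) * exp (- y)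
         = flat (m + 2) t - m * flat (Suc m) t"
      using 3 by (cases m) (simp_all add: flat_def y_def[symmetric] power2_eq_square algebra_simps)
    ultimately show ?thesis using DERIV_cong_ev[OF refl ev refl] by simp
  qed
qed

lemma C_k_real_flat: "C_k_real k (flat m)"
proof (induction k arbitrary: m)
  case 0 then show ?case
    by (auto intro!: DERIV_continuous[OF DERIV_flat] continuous_at_imp_continuous_on)
next
  case (Suc k)
  have "C_k_real k (\<lambda>t. flat (m + 2) t + (- real m) * flat (Suc m) t)"
    by (intro C_k_real_add C_k_real_mult C_k_real_const Suc)
  then show ?case
    using DERIV_flat by (auto intro!: exI[of _ "\<lambda>t. flat (m + 2) t - m * flat (Suc m) t"])
qed

lemma flat_0_bounds: "0 \<le> flat 0 t" "flat 0 t \<le> 1"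
  by (auto simp: flat_def)

lemma flat_0_eq_0_iff: "flat 0 t = 0 \<longleftrightarrow> t \<le> 0"
  by (auto simp: flat_def)

text \<open>exp (- 1 / s) tends to 1 as s grows, so stretching the argument of \<open>flat 0\<close>
  makes it approach the indicator of the positive half line.\<close>

lemma flat_0_scaled_tendsto:
  assumes "filterlim s at_top F"
  shows "((\<lambda>k. flat 0 (s k)) \<longlongrightarrow> 1) F"
proof -
  have "((\<lambda>k. exp (- (inverse (s k)))) \<longlongrightarrow> exp (- 0)) F"
    by (intro tendsto_intros filterlim_compose[OF tendsto_inverse_0_at_top assms] filterlim_ident)
  moreover have "\<forall>\<^sub>F k in F. exp (- (inverse (s k))) = flat 0 (s k)"
    using filterlim_at_top_dense[THEN iffD1, OF assms, rule_format, of 0]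
    by eventually_elim (simp add: flat_def inverse_eq_divide)
  ultimately show ?thesis using Lim_transform_eventually by fastforce
qed

text \<open>For growing k these converge to the indicator of the open interval while their support
  stays fixed, so products over the coordinates can replace mollification by convolution.\<close>

definition bump :: "real \<Rightarrow> real \<Rightarrow> nat \<Rightarrow> real \<Rightarrow> real" where
  "bump a b k t = flat 0 (k * (t - a)) * flat 0 (k * (b - t))"

lemma C_k_real_bump: "C_k_real j (bump a b k)"
proof -
  have "C_k_real j (\<lambda>t. flat 0 (real k * t + (- (k * a))) * flat 0 ((- real k) * t + k * b))"
    by (rule C_k_real_mult; rule C_k_real_affine[OF C_k_real_flat])
  then show ?thesis by (simp add: bump_def[abs_def] algebra_simps)
qed

lemma bump_bounds: "0 \<le> bump a b k t" "bump a b k t \<le> 1"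
  by (auto simp: bump_def flat_0_bounds intro!: mult_le_one)

lemma bump_eq_0_iff: "k > 0 \<Longrightarrow> bump a b k t = 0 \<longleftrightarrow> t \<notin> {a<..<b}"
  by (auto simp: bump_def flat_0_eq_0_iff mult_le_0_iff)

lemma bump_tendsto: "(\<lambda>k. bump a b (Suc k) t) \<longlonglongrightarrow> indicator {a<..<b} t"
proof (cases "t \<in> {a<..<b}")
  case True
  have "filterlim (\<lambda>k. real (Suc k) * c) at_top sequentially" if "c > 0" for c
    by (rule filterlim_at_top_mult_tendsto_pos[OF tendsto_const that])
       (rule filterlim_compose[OF filterlim_real_sequentially filterlim_Suc])
  then have "(\<lambda>k. bump a b (Suc k) t) \<longlonglongrightarrow> 1 * 1"
    unfolding bump_def using True by (intro tendsto_intros flat_0_scaled_tendsto) auto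
  then show ?thesis using True by simp
next
  case False
  then have "bump a b (Suc k) t = 0" for k by (simp add: bump_eq_0_iff)
  with False show ?thesis by simp
qed

text \<open>The scale is \<open>Suc k\<close> because \<open>bump\<close> with scale 0 vanishes
  identically.\<close>

definition box_bump :: "real^'n \<Rightarrow> real^'n \<Rightarrow> nat \<Rightarrow> real^'n \<Rightarrow> real" where
  "box_bump a b k x = (\<Prod>i\<in>UNIV. bump (a $ i) (b $ i) (Suc k) (x $ i))"

lemma box_bump_nonzero: "box_bump a b k x \<noteq> 0 \<longleftrightarrow> x \<in> box a b"
  by (simp add: box_bump_def bump_eq_0_iff mem_box_cart)

lemma box_bump_bounds: "0 \<le> box_bump a b k x" "box_bump a b k x \<le> 1"
  by (auto simp: box_bump_def bump_bounds intro!: prod_nonneg prod_le_1)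

lemma box_bump_tendsto: "(\<lambda>k. box_bump a b k x) \<longlonglongrightarrow> indicator (box a b) x"
proof -
  have "(\<lambda>k. box_bump a b k x) \<longlonglongrightarrow> (\<Prod>i\<in>UNIV. indicator {a $ i<..<b $ i} (x $ i))"
    unfolding box_bump_def by (intro tendsto_prod bump_tendsto)
  moreover have "(\<Prod>i\<in>UNIV. indicator {a $ i<..<b $ i} (x $ i)) = (indicator (box a b) x :: real)"
    by (auto simp: indicator_def mem_box_cart)
  ultimately show ?thesis by simp
qed

lemma box_bump_test_function:
  assumes "cbox a b \<subseteq> S"
  shows "box_bump a b k \<in> test_functions S"
proof -
  have "C_k j (box_bump a b k)" for j
    unfolding box_bump_def[abs_def]
    by (rule C_k_prod[OF finite]) (rule C_k_compose[OF C_k_real_bump C_k_component])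
  moreover have "{x. box_bump a b k x \<noteq> 0} = box a b"
    by (auto simp: box_bump_nonzero)
  moreover have "closure (box a b) \<subseteq> cbox a b"
    by (rule closure_minimal[OF box_subset_cbox closed_cbox])
  ultimately show ?thesis using assms
    by (auto simp: test_functions_def compact_closure bounded_box)
qed

section \<open>Integrals of gradients\<close>

lemma has_derivative_quotient_tendsto:
  fixes f :: "'a::real_normed_vector \<Rightarrow> real"
  assumes "(f has_derivative D) (at x)" "filterlim \<sigma> (at 0) F"
  shows "((\<lambda>k. (f (x + \<sigma> k *\<^sub>R e) - f x) / \<sigma> k) \<longlongrightarrow> D e) F"
proof -
  interpret D: bounded_linear D using assms(1) by (rule has_derivative_bounded_linear)
  have "((\<lambda>t::real. x + t *\<^sub>R e) has_derivative (\<lambda>t. t *\<^sub>R e)) (at 0)"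
    by (auto intro!: derivative_eq_intros)
  then have "((\<lambda>t. f (x + t *\<^sub>R e)) has_derivative (\<lambda>t. D (t *\<^sub>R e))) (at 0)"
    by (rule has_derivative_compose) (use assms in simp)
  then have "((\<lambda>t. f (x + t *\<^sub>R e)) has_real_derivative D e) (at 0)"
    by (simp add: has_field_derivative_def D.scaleR mult_commute_abs)
  then have "((\<lambda>h. (f (x + h *\<^sub>R e) - f x) / h) \<longlongrightarrow> D e) (at 0)"
    by (simp add: DERIV_def)
  then show ?thesis by (rule filterlim_compose) (rule assms)
qed

lemma integrable_continuous_compact_support:
  fixes h :: "'a::euclidean_space \<Rightarrow> 'b::euclidean_space"
  assumes "continuous_on UNIV h" "compact K" "\<And>x. x \<notin> K \<Longrightarrow> h x = 0"
  shows "integrable lborel h"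
proof -
  have "integrable lborel (\<lambda>x. indicator K x *\<^sub>R h x)"
    using assms by (intro borel_integrable_compact) (auto intro: continuous_on_subset)
  moreover have "(\<lambda>x. indicator K x *\<^sub>R h x) = h"
    using assms(3) by (auto simp: indicator_def)
  ultimately show ?thesis by simp
qed

text \<open>Moves integrals over \<open>S\<close> to the whole space, where translation invariance
  can be used.\<close>

lemma integral_lebesgue_on_support:
  fixes h :: "'a::euclidean_space \<Rightarrow> 'b::euclidean_space"
  assumes S: "S \<in> sets lebesgue" and h: "h \<in> borel_measurable borel" and 0: "\<And>x. x \<notin> S \<Longrightarrow> h x = 0"
  shows "integral\<^sup>L (lebesgue_on S) h = integral\<^sup>L lborel h"
proof -
  have "(\<lambda>x. indicator S x *\<^sub>R h x) = h"
    using 0 by (auto simp: indicator_def)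
  then show ?thesis
    using S h by (simp add: integral_restrict_space integral_completion)
qed

lemma integral_translate:
  fixes h :: "'a::euclidean_space \<Rightarrow> real"
  assumes "h \<in> borel_measurable borel"
  shows "(\<integral>x. h (x + c) \<partial>lborel) = (\<integral>x. h x \<partial>lborel)"
proof -
  have "(\<integral>x. h x \<partial>lborel) = (\<integral>x. h x \<partial>distr lborel borel ((+) c))"
    by (simp add: lborel_distr_plus)
  also have "\<dots> = (\<integral>x. h (c + x) \<partial>lborel)"
    by (rule integral_distr) (use assms in auto)
  finally show ?thesis by (simp add: add.commute)
qed

lemma gradient_zero_outside_support:
  assumes "(\<phi> has_derivative (\<lambda>h. G \<bullet> h)) (at x)" "closed K" "\<And>x. x \<notin> K \<Longrightarrow> \<phi> x = (0::real)" "x \<notin> K"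
  shows "G = 0"
proof -
  have "(\<phi> has_derivative (\<lambda>h. 0)) (at x)"
    by (rule has_derivative_transform_within_open[of "\<lambda>_. 0" _ _ _ "- K"]) (use assms in auto)
  from has_derivative_unique[OF assms(1) this] have "G \<bullet> G = 0" by metis
  then show ?thesis by simp
qed

lemma Lipschitz_of_gradient:
  fixes \<phi> :: "'a::euclidean_space \<Rightarrow> real"
  assumes d: "\<And>x. (\<phi> has_derivative (\<lambda>h. G x \<bullet> h)) (at x)" and G: "continuous_on UNIV G"
    and K: "compact K" "\<And>x. x \<notin> K \<Longrightarrow> \<phi> x = 0"
  obtains M where "M \<ge> 0" "\<And>x. norm (G x) \<le> M" "\<And>x y. \<bar>\<phi> x - \<phi> y\<bar> \<le> M * norm (x - y)"
proof -
  have "bounded (G ` K)"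
    by (intro compact_imp_bounded compact_continuous_image continuous_on_subset[OF G] K) auto
  then obtain M where M: "M > 0" "\<And>x. x \<in> K \<Longrightarrow> norm (G x) \<le> M"
    by (auto simp: bounded_pos)
  have le: "norm (G x) \<le> M" for x
    using M gradient_zero_outside_support[OF d compact_imp_closed[OF K(1)] K(2), of x]
    by (cases "x \<in> K") auto
  have "\<bar>\<phi> x - \<phi> y\<bar> \<le> M * norm (x - y)" for x y
    unfolding real_norm_def[symmetric]
  proof (rule differentiable_bound[of UNIV])
    show "(\<phi> has_derivative (\<lambda>h. G x \<bullet> h)) (at x within UNIV)" for x using d by simp
    show "onorm (\<lambda>h. G x \<bullet> h) \<le> M" for x
      using le[of x] onorm_inner_right[OF bounded_linear_ident, of "G x"] by (simp add: onorm_id order_trans)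
  qed auto
  with le M show ?thesis by (intro that[of M]) auto
qed

lemma continuous_on_Lipschitz_bound:
  fixes u :: "'a::real_normed_vector \<Rightarrow> real"
  assumes "\<And>x y. \<bar>u x - u y\<bar> \<le> L * norm (x - y)"
  shows "continuous_on S u"
proof -
  have "\<bar>u x - u y\<bar> \<le> \<bar>L\<bar> * norm (x - y)" for x y
    using assms[of x y] mult_right_mono[OF abs_ge_self, of "norm (x - y)" L] by simp
  then have "\<bar>L\<bar>-lipschitz_on S u"
    by (intro lipschitz_onI) (auto simp: dist_norm)
  then show ?thesis by (rule lipschitz_on_continuous_on)
qed

lemma integrable_translate_mult:
  fixes u \<phi> :: "'a::euclidean_space \<Rightarrow> real"
  assumes "continuous_on UNIV u" "continuous_on UNIV \<phi>" "compact K" "\<And>x. x \<notin> K \<Longrightarrow> \<phi> x = 0"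
  shows "integrable lborel (\<lambda>x. u (x + y) * \<phi> (x + z))"
proof (rule integrable_continuous_compact_support)
  show "continuous_on UNIV (\<lambda>x. u (x + y) * \<phi> (x + z))"
    by (intro continuous_intros continuous_on_compose2[OF assms(1)] continuous_on_compose2[OF assms(2)]) auto
  show "compact ((\<lambda>x. x - z) ` K)"
    by (intro compact_continuous_image continuous_intros assms)
  show "u (x + y) * \<phi> (x + z) = 0" if "x \<notin> (\<lambda>x. x - z) ` K" for x
  proof -
    have "x + z \<notin> K" using that by (metis add_diff_cancel image_eqI)
    then show ?thesis using assms(4) by simp
  qed
qed

text \<open>Dominated convergence for a product of two difference quotients. That of
  \<open>u\<close> is bounded everywhere by the Lipschitz condition, that of \<phi> is bounded and
  lives near \<open>K\<close>. Differentiability of \<open>u\<close> is available on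
  \<open>K\<close> only, as a radial function may have a kink at the origin; off \<open>K\<close>
  the quotient of \<phi> tends to 0 and the bound on the other factor suffices.\<close>

lemma integral_quotients_tendsto:
  fixes u \<phi> :: "'a::euclidean_space \<Rightarrow> real"
  assumes u: "\<And>x y. \<bar>u x - u y\<bar> \<le> L * norm (x - y)"
    and du: "\<And>x. x \<in> K \<Longrightarrow> (u has_derivative (\<lambda>h. H x \<bullet> h)) (at x)"
    and d: "\<And>x. (\<phi> has_derivative (\<lambda>h. G x \<bullet> h)) (at x)" and G: "continuous_on UNIV G"
    and K: "compact K" "\<And>x. x \<notin> K \<Longrightarrow> \<phi> x = 0"
    and \<sigma>: "filterlim \<sigma> (at 0) sequentially" "\<And>k. \<bar>\<sigma> k\<bar> \<le> 1" "\<And>k. \<sigma> k \<noteq> 0"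
    and m: "(\<lambda>x. (H x \<bullet> a) * (G x \<bullet> e)) \<in> borel_measurable borel"
  shows "(\<lambda>k. \<integral>x. (u (x + \<sigma> k *\<^sub>R a) - u x) / \<sigma> k * ((\<phi> (x + \<sigma> k *\<^sub>R e) - \<phi> x) / \<sigma> k) \<partial>lborel)
           \<longlonglongrightarrow> (\<integral>x. (H x \<bullet> a) * (G x \<bullet> e) \<partial>lborel)"
proof -
  obtain M where M: "M \<ge> 0" "\<And>x. norm (G x) \<le> M" "\<And>x y. \<bar>\<phi> x - \<phi> y\<bar> \<le> M * norm (x - y)"
    using Lipschitz_of_gradient[OF d G K] by blast
  have L0: "0 \<le> L * norm (z::'a)" for z using u[of z 0] by (smt (verit) diff_zero)
  have cu: "continuous_on UNIV u" using u by (rule continuous_on_Lipschitz_bound)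
  have c\<phi>: "continuous_on UNIV \<phi>"
    by (auto intro!: has_derivative_continuous[OF d] continuous_at_imp_continuous_on)
  obtain R where R: "\<And>x. x \<in> K \<Longrightarrow> norm x \<le> R" using compact_imp_bounded[OF K(1)] by (auto simp: bounded_iff)
  \<comment> \<open>\<open>R\<close> bounds the norm on \<open>K\<close>, and the shifts
    \<open>\<sigma> k *\<^sub>R e\<close> have norm at most \<open>norm e\<close>, so every quotient
    of \<phi> vanishes outside this ball.\<close>
  define B :: "'a set" where "B = cball 0 (R + norm e)"
  define s where "s = (\<lambda>k x. (u (x + \<sigma> k *\<^sub>R a) - u x) / \<sigma> k * ((\<phi> (x + \<sigma> k *\<^sub>R e) - \<phi> x) / \<sigma> k))"
  have qu: "\<bar>(u (x + \<sigma> k *\<^sub>R a) - u x) / \<sigma> k\<bar> \<le> L * norm a" for k x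
  proof -
    have "\<bar>u (x + \<sigma> k *\<^sub>R a) - u x\<bar> \<le> L * (\<bar>\<sigma> k\<bar> * norm a)"
      using u[of "x + \<sigma> k *\<^sub>R a" x] by simp
    then show ?thesis using \<sigma>(3)[of k] by (simp add: abs_divide field_simps)
  qed
  have q\<phi>: "\<bar>(\<phi> (x + \<sigma> k *\<^sub>R e) - \<phi> x) / \<sigma> k\<bar> \<le> M * norm e" for k x
  proof -
    have "\<bar>\<phi> (x + \<sigma> k *\<^sub>R e) - \<phi> x\<bar> \<le> M * (\<bar>\<sigma> k\<bar> * norm e)"
      using M(3)[of "x + \<sigma> k *\<^sub>R e" x] by simp
    then show ?thesis using \<sigma>(3)[of k] by (simp add: abs_divide field_simps)
  qed
  have out: "s k x = 0" if "x \<notin> B" for k x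
  proof -
    have "norm (\<sigma> k *\<^sub>R e) \<le> norm e" using \<sigma>(2)[of k] by (simp add: mult_left_le_one_le)
    moreover have "norm x \<le> norm (x + \<sigma> k *\<^sub>R e) + norm (\<sigma> k *\<^sub>R e)"
      by (metis add_diff_cancel norm_triangle_ineq4)
    ultimately have "norm (x + \<sigma> k *\<^sub>R e) > R" "norm x > R" using that norm_ge_zero[of e]
      by (auto simp: B_def simp del: norm_ge_zero)
    then have "x + \<sigma> k *\<^sub>R e \<notin> K" "x \<notin> K" using R by (meson leD)+
    then show ?thesis using K(2) by (simp add: s_def)
  qed
  have "(\<lambda>k. integral\<^sup>L lborel (s k)) \<longlonglongrightarrow> (\<integral>x. (H x \<bullet> a) * (G x \<bullet> e) \<partial>lborel)"
  proof (rule integral_dominated_convergence[where w="\<lambda>x. indicator B x *\<^sub>R (L * norm a * (M * norm e))"])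
    show "(\<lambda>x. (H x \<bullet> a) * (G x \<bullet> e)) \<in> borel_measurable lborel" using m by simp
    show "s k \<in> borel_measurable lborel" for k
    proof -
      have "continuous_on UNIV (s k)" unfolding s_def
        by (intro continuous_intros continuous_on_compose2[OF cu] continuous_on_compose2[OF c\<phi>]) (use \<sigma> in auto)
      then show ?thesis by (simp add: borel_measurable_continuous_onI)
    qed
    show "integrable lborel (\<lambda>x. indicator B x *\<^sub>R (L * norm a * (M * norm e)))"
      unfolding B_def by (intro borel_integrable_compact) auto
    show "AE x in lborel. (\<lambda>k. s k x) \<longlonglongrightarrow> (H x \<bullet> a) * (G x \<bullet> e)"
    proof (rule AE_I2)
      fix x
      have \<phi>': "(\<lambda>k. (\<phi> (x + \<sigma> k *\<^sub>R e) - \<phi> x) / \<sigma> k) \<longlonglongrightarrow> G x \<bullet> e"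
        by (rule has_derivative_quotient_tendsto[OF d \<sigma>(1)])
      show "(\<lambda>k. s k x) \<longlonglongrightarrow> (H x \<bullet> a) * (G x \<bullet> e)"
      proof (cases "x \<in> K")
        case True
        then show ?thesis unfolding s_def
          by (intro tendsto_mult \<phi>' has_derivative_quotient_tendsto[OF du \<sigma>(1)])
      next
        case False
        then have G0: "G x = 0"
          using gradient_zero_outside_support[OF d compact_imp_closed[OF K(1)] K(2)] by blast
        have "(\<lambda>k. s k x) \<longlonglongrightarrow> 0"
        proof (rule Lim_null_comparison)
          show "(\<lambda>k. L * norm a * \<bar>(\<phi> (x + \<sigma> k *\<^sub>R e) - \<phi> x) / \<sigma> k\<bar>) \<longlonglongrightarrow> 0"
            using tendsto_mult_right_zero[OF tendsto_rabs_zero[OF \<phi>'[unfolded G0 inner_zero_left]], of "L * norm a"] .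
          show "\<forall>\<^sub>F k in sequentially. norm (s k x) \<le> L * norm a * \<bar>(\<phi> (x + \<sigma> k *\<^sub>R e) - \<phi> x) / \<sigma> k\<bar>"
            unfolding s_def real_norm_def abs_mult using qu
            by (intro always_eventually allI mult_right_mono) auto
        qed
        then show ?thesis using G0 by simp
      qed
    qed
    show "AE x in lborel. norm (s k x) \<le> indicator B x *\<^sub>R (L * norm a * (M * norm e))" for k
    proof (rule AE_I2)
      fix x
      show "norm (s k x) \<le> indicator B x *\<^sub>R (L * norm a * (M * norm e))"
      proof (cases "x \<in> B")
        case True
        then show ?thesis
          using mult_mono[OF qu[of x k] q\<phi>[of x k] L0 abs_ge_zero]
          by (simp only: s_def real_norm_def abs_mult indicator_simps scaleR_one)
      qed (simp add: out)
    qed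
  qed
  then show ?thesis by (simp add: s_def)
qed

lemma filterlim_at_0_signed_inverse:
  assumes "c \<noteq> 0"
  shows "filterlim (\<lambda>k. c / real (Suc k)) (at 0) sequentially"
proof -
  have "(\<lambda>k. c / real (Suc k)) \<longlonglongrightarrow> 0"
    using tendsto_mult_right_zero[OF LIMSEQ_inverse_real_of_nat, of c]
    by (simp add: divide_inverse)
  then show ?thesis using assms by (simp add: filterlim_at)
qed

text \<open>By translation invariance the difference quotients of \<open>\<psi>\<close> have integral zero.\<close>

lemma integral_gradient_eq_0:
  fixes \<psi> :: "'a::euclidean_space \<Rightarrow> real"
  assumes d: "\<And>x. (\<psi> has_derivative (\<lambda>h. G x \<bullet> h)) (at x)" and G: "continuous_on UNIV G"
    and K: "compact K" "\<And>x. x \<notin> K \<Longrightarrow> \<psi> x = 0"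
  shows "(\<integral>x. G x \<partial>lborel) = 0"
proof -
  have 1: "(\<integral>x. G x \<bullet> e \<partial>lborel) = 0" if e: "e \<bullet> e = 1" for e
  proof -
    have c: "continuous_on UNIV \<psi>"
      by (auto intro!: has_derivative_continuous[OF d] continuous_at_imp_continuous_on)
    have \<psi>: "integrable lborel \<psi>" by (rule integrable_continuous_compact_support[OF c K])
    have \<psi>t: "integrable lborel (\<lambda>x. \<psi> (x + z))" for z
      using integrable_translate_mult[where u="\<lambda>_. 1" and y=0 and z=z, OF continuous_on_const c K] by simp
    \<comment> \<open>The linear function \<open>x \<bullet> e\<close> serves as \<open>u\<close>:
      for a unit vector its quotient along \<open>e\<close> is constantly 1, so the general limit
      lemma yields the limit for \<psi> alone.\<close>
    have "(\<lambda>k. \<integral>x. ((x + (1 / Suc k) *\<^sub>R e) \<bullet> e - x \<bullet> e) / (1 / Suc k)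
              * ((\<psi> (x + (1 / Suc k) *\<^sub>R e) - \<psi> x) / (1 / Suc k)) \<partial>lborel)
           \<longlonglongrightarrow> (\<integral>x. (e \<bullet> e) * (G x \<bullet> e) \<partial>lborel)"
    proof (rule integral_quotients_tendsto[where L="norm e" and K=K])
      show "\<bar>x \<bullet> e - y \<bullet> e\<bar> \<le> norm e * norm (x - y)" for x y
        using Cauchy_Schwarz_ineq2[of "x - y" e] by (simp add: inner_diff_left mult.commute)
      show "((\<lambda>x. x \<bullet> e) has_derivative (\<lambda>h. e \<bullet> h)) (at x)" for x
        by (auto intro!: derivative_eq_intros simp: inner_commute)
      show "filterlim (\<lambda>k. 1 / real (Suc k)) (at 0) sequentially"
        by (rule filterlim_at_0_signed_inverse) simp
      show "(\<lambda>x. e \<bullet> e * (G x \<bullet> e)) \<in> borel_measurable borel"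
        by (intro borel_measurable_continuous_onI continuous_intros G)
    qed (use d G K in auto)
    moreover have "(\<integral>x. ((x + (1 / Suc k) *\<^sub>R e) \<bullet> e - x \<bullet> e) / (1 / Suc k)
              * ((\<psi> (x + (1 / Suc k) *\<^sub>R e) - \<psi> x) / (1 / Suc k)) \<partial>lborel) = 0" for k
    proof -
      have "(\<integral>x. \<psi> (x + (1 / Suc k) *\<^sub>R e) - \<psi> x \<partial>lborel) = 0"
        using \<psi> \<psi>t integral_translate[OF borel_measurable_continuous_onI[OF c]] by simp
      then show ?thesis using e by (simp add: inner_add_left)
    qed
    ultimately show ?thesis using e by (simp add: LIMSEQ_const_iff)
  qed
  have iG: "integrable lborel G"
    by (rule integrable_continuous_compact_support[OF G K(1)])
       (rule gradient_zero_outside_support[OF d compact_imp_closed[OF K(1)] K(2)])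
  show ?thesis
    by (rule euclidean_eqI) (use 1 iG in \<open>auto simp flip: integral_inner_left simp: inner_Basis\<close>)
qed

text \<open>Two discrete integrations by parts: both sides are limits of the same sequence of integrals
  of difference quotients, so no second derivatives of \<open>\<phi>\<close> are needed.\<close>

lemma integral_gradients_commute:
  fixes u \<phi> :: "'a::euclidean_space \<Rightarrow> real"
  assumes u: "\<And>x y. \<bar>u x - u y\<bar> \<le> L * norm (x - y)"
    and du: "\<And>x. x \<in> K \<Longrightarrow> (u has_derivative (\<lambda>h. H x \<bullet> h)) (at x)"
    and d: "\<And>x. (\<phi> has_derivative (\<lambda>h. G x \<bullet> h)) (at x)" and G: "continuous_on UNIV G"
    and K: "compact K" "\<And>x. x \<notin> K \<Longrightarrow> \<phi> x = 0"
    and m: "\<And>a e. (\<lambda>x. (H x \<bullet> a) * (G x \<bullet> e)) \<in> borel_measurable borel"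
  shows "(\<integral>x. (H x \<bullet> a) * (G x \<bullet> e) \<partial>lborel) = (\<integral>x. (H x \<bullet> e) * (G x \<bullet> a) \<partial>lborel)"
proof -
  have c: "continuous_on UNIV \<phi>"
    by (auto intro!: has_derivative_continuous[OF d] continuous_at_imp_continuous_on)
  have int: "integrable lborel (\<lambda>x. u (x + y) * \<phi> (x + z))" for y z
    by (rule integrable_translate_mult[OF continuous_on_Lipschitz_bound[OF u] c K])
  have m': "(\<lambda>x. u (x + y) * \<phi> (x + z)) \<in> borel_measurable borel" for y z
    using borel_measurable_integrable[OF int] by simp
  \<comment> \<open>By translation invariance \<open>T y z\<close> depends on \<open>z - y\<close>
    only; a product of two difference quotients integrates to a combination of four values of
    \<open>T\<close>.\<close>
  define T where "T y z = (\<integral>x. u (x + y) * \<phi> (x + z) \<partial>lborel)" for y z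
  have shift: "T (y + b) (z + b) = T y z" for y z b
    using integral_translate[OF m'[of y z], of b] by (simp add: T_def ac_simps)
  have expand: "(\<integral>x. (u (x + t *\<^sub>R a) - u x) / t * ((\<phi> (x + t *\<^sub>R e) - \<phi> x) / t) \<partial>lborel)
     = (T (t *\<^sub>R a) (t *\<^sub>R e) - T (t *\<^sub>R a) 0 - T 0 (t *\<^sub>R e) + T 0 0) / t\<^sup>2" for t a e
  proof -
    have "(\<lambda>x. (u (x + t *\<^sub>R a) - u x) / t * ((\<phi> (x + t *\<^sub>R e) - \<phi> x) / t))
     = (\<lambda>x. (u (x + t *\<^sub>R a) * \<phi> (x + t *\<^sub>R e) - u (x + t *\<^sub>R a) * \<phi> (x + 0)
         - u (x + 0) * \<phi> (x + t *\<^sub>R e) + u (x + 0) * \<phi> (x + 0)) / t\<^sup>2)"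
      by (auto simp: power2_eq_square algebra_simps)
    then show ?thesis unfolding T_def
      using int[of "t *\<^sub>R a" "t *\<^sub>R e"] int[of "t *\<^sub>R a" 0] int[of 0 "t *\<^sub>R e"] int[of 0 0]
      by simp
  qed
  \<comment> \<open>Exchanging the two directions and reversing the sign of the step leaves
    \<open>z - y\<close> unchanged in every term. The limits along positive and along negative steps
    are then the two sides of the claim.\<close>
  have eq: "(\<integral>x. (u (x + t *\<^sub>R a) - u x) / t * ((\<phi> (x + t *\<^sub>R e) - \<phi> x) / t) \<partial>lborel)
    = (\<integral>x. (u (x + (- t) *\<^sub>R e) - u x) / (- t) * ((\<phi> (x + (- t) *\<^sub>R a) - \<phi> x) / (- t)) \<partial>lborel)" for t
  proof -
    have "T (t *\<^sub>R a) (t *\<^sub>R e) = T ((- t) *\<^sub>R e) ((- t) *\<^sub>R a)"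
      using shift[of "(- t) *\<^sub>R e" "t *\<^sub>R a + t *\<^sub>R e" "(- t) *\<^sub>R a"] by (simp add: algebra_simps)
    moreover have "T (t *\<^sub>R a) 0 = T 0 ((- t) *\<^sub>R a)"
      using shift[of 0 "t *\<^sub>R a" "(- t) *\<^sub>R a"] by simp
    moreover have "T 0 (t *\<^sub>R e) = T ((- t) *\<^sub>R e) 0"
      using shift[of "(- t) *\<^sub>R e" "t *\<^sub>R e" 0] by simp
    ultimately show ?thesis unfolding expand by simp
  qed
  have "(\<lambda>k. \<integral>x. (u (x + (1 / Suc k) *\<^sub>R a) - u x) / (1 / Suc k)
           * ((\<phi> (x + (1 / Suc k) *\<^sub>R e) - \<phi> x) / (1 / Suc k)) \<partial>lborel)
           \<longlonglongrightarrow> (\<integral>x. (H x \<bullet> a) * (G x \<bullet> e) \<partial>lborel)"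
    by (rule integral_quotients_tendsto[OF u du d G K filterlim_at_0_signed_inverse _ _ m]) auto
  moreover have "(\<lambda>k. \<integral>x. (u (x + (- 1 / Suc k) *\<^sub>R e) - u x) / (- 1 / Suc k)
           * ((\<phi> (x + (- 1 / Suc k) *\<^sub>R a) - \<phi> x) / (- 1 / Suc k)) \<partial>lborel)
           \<longlonglongrightarrow> (\<integral>x. (H x \<bullet> e) * (G x \<bullet> a) \<partial>lborel)"
    by (rule integral_quotients_tendsto[OF u du d G K filterlim_at_0_signed_inverse _ _ m]) auto
  ultimately show ?thesis
    unfolding eq by (simp only: minus_divide_left) (rule LIMSEQ_unique)
qed

section \<open>Weak gradients\<close>

text \<open>The positive and the negative part of \<open>h\<close> are densities of two measures
  that agree on boxes. Boxes form an intersection-stable generator, so the measures coincide, and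
  hence the densities do almost everywhere.\<close>

lemma AE_eq_0_of_box_integrals:
  fixes h :: "'a::euclidean_space \<Rightarrow> real"
  assumes h: "integrable lborel h"
    and 0: "\<And>a b. (\<integral>x. indicator (box a b) x * h x \<partial>lborel) = 0"
  shows "AE x in lborel. h x = 0"
proof -
  have [measurable]: "h \<in> borel_measurable borel" using h by auto
  \<comment> \<open>\<open>ennreal\<close> maps negative numbers to 0, so the densities of
    \<open>M1\<close> and \<open>M2\<close> are the positive and the negative part of
    \<open>h\<close>.\<close>
  define M1 where "M1 = density lborel (\<lambda>x. ennreal (h x))"
  define M2 where "M2 = density lborel (\<lambda>x. ennreal (- h x))"
  have em: "emeasure (density lborel (\<lambda>x. ennreal (k x))) (box a b)
     = ennreal (\<integral>x. max 0 (k x) * indicator (box a b) x \<partial>lborel)"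
     if k: "integrable lborel k" for k a b
  proof -
    have [measurable]: "k \<in> borel_measurable borel" using k by auto
    have i: "integrable lborel (\<lambda>x. max 0 (k x) * indicator (box a b) x)"
      by (rule Bochner_Integration.integrable_bound[OF k]) (auto simp: indicator_def)
    have "emeasure (density lborel (\<lambda>x. ennreal (k x))) (box a b)
      = (\<integral>\<^sup>+x. ennreal (k x) * indicator (box a b) x \<partial>lborel)"
      by (rule emeasure_density) auto
    also have "\<dots> = (\<integral>\<^sup>+x. ennreal (max 0 (k x) * indicator (box a b) x) \<partial>lborel)"
      by (intro nn_integral_cong) (auto simp: indicator_def max_def ennreal_neg)
    also have "\<dots> = ennreal (\<integral>x. max 0 (k x) * indicator (box a b) x \<partial>lborel)"
      by (rule nn_integral_eq_integral[OF i]) auto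
    finally show ?thesis .
  qed
  have "M1 = M2"
  proof (rule measure_eqI_generator_eq[where E="range (\<lambda>(a, b). box a b)" and \<Omega>=UNIV
        and A="\<lambda>n. box (- (real n *\<^sub>R One)) (real n *\<^sub>R One)"])
    show "Int_stable (range (\<lambda>(a, b). box a b :: 'a set))"
      by (auto simp: Int_stable_def Int_interval box_Int_box intro!: range_eqI)
    show "sets M1 = sigma_sets UNIV (range (\<lambda>(a, b). box a b))"
      "sets M2 = sigma_sets UNIV (range (\<lambda>(a, b). box a b))"
      by (simp_all add: M1_def M2_def borel_eq_box)
    show "emeasure M1 X = emeasure M2 X" if X: "X \<in> range (\<lambda>(a, b). box a b)" for X
    proof -
      from X obtain a b where X: "X = box a b" by auto
      have i: "integrable lborel (\<lambda>x. max 0 (h x) * indicator (box a b) x)"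
          "integrable lborel (\<lambda>x. max 0 (- h x) * indicator (box a b) x)"
        by (rule Bochner_Integration.integrable_bound[OF h]; auto simp: indicator_def)+
      have "(\<integral>x. max 0 (h x) * indicator (box a b) x \<partial>lborel) - (\<integral>x. max 0 (- h x) * indicator (box a b) x \<partial>lborel)
         = (\<integral>x. max 0 (h x) * indicator (box a b) x - max 0 (- h x) * indicator (box a b) x \<partial>lborel)"
        using i by simp
      also have "\<dots> = (\<integral>x. indicator (box a b) x * h x \<partial>lborel)"
        by (rule Bochner_Integration.integral_cong) (auto simp: indicator_def max_def)
      finally show ?thesis using 0[of a b] em[OF h, of a b] em[of "\<lambda>x. - h x" a b] h
        by (simp add: X M1_def M2_def)
    qed
    show "(\<Union>i. box (- (real i *\<^sub>R One)) (real i *\<^sub>R One)) = (UNIV :: 'a set)"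
      by (rule UN_box_eq_UNIV)
    show "emeasure M1 (box (- (real i *\<^sub>R One)) (real i *\<^sub>R One)) \<noteq> \<infinity>" for i
      using em[OF h] by (simp add: M1_def)
  qed auto
  then have "AE x in lborel. ennreal (h x) = ennreal (- h x)"
    unfolding M1_def M2_def by (intro sigma_finite_measure.density_unique[OF sigma_finite_lborel]) auto
  then show ?thesis
  proof eventually_elim
    case (elim x)
    then show ?case
      by (cases "h x" "0::real" rule: linorder_cases) (auto simp: ennreal_neg ennreal_eq_0_iff dest: sym)
  qed
qed

lemma grad_UNIV_eq:
  assumes "(\<phi> has_derivative (\<lambda>h. g \<bullet> h)) (at x)"
  shows "grad UNIV \<phi> x = g"
  unfolding grad_def
proof (rule the_equality)
  fix k assume "(\<phi> has_derivative (\<bullet>) k) (at x)"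
  from has_derivative_unique[OF this assms] have "k \<bullet> (k - g) = g \<bullet> (k - g)" by metis
  then have "(k - g) \<bullet> (k - g) = 0" by (simp add: inner_diff_left)
  then show "k = g" by simp
qed (use assms in simp)

lemma test_functionsD:
  assumes "\<phi> \<in> test_functions S"
  shows test_function_gradient: "(\<phi> has_derivative (\<lambda>h. grad UNIV \<phi> x \<bullet> h)) (at x)"
    and continuous_on_test_gradient: "continuous_on UNIV (grad UNIV \<phi>)"
    and continuous_on_test_function: "continuous_on UNIV \<phi>"
proof -
  have "C_k (Suc 0) \<phi>" using assms by (auto simp: test_functions_def)
  then obtain g where g: "\<And>x. (\<phi> has_derivative (\<lambda>h. g x \<bullet> h)) (at x)"
      "\<And>i. continuous_on UNIV (\<lambda>x. g x $ i)" by auto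
  have "grad UNIV \<phi> = g"
    using grad_UNIV_eq[OF g(1)] by (rule ext)
  moreover have "continuous_on UNIV g"
    using continuous_on_vec_lambda[of UNIV "\<lambda>i x. g x $ i"] g(2) by (simp add: vec_nth_inverse)
  ultimately show "(\<phi> has_derivative (\<lambda>h. grad UNIV \<phi> x \<bullet> h)) (at x)" "continuous_on UNIV (grad UNIV \<phi>)"
    "continuous_on UNIV \<phi>"
    using g(1) by (auto intro!: has_derivative_continuous[OF g(1)] continuous_at_imp_continuous_on)
qed

lemma test_function_support:
  assumes "\<phi> \<in> test_functions S"
  shows "\<exists>K. compact K \<and> K \<subseteq> S \<and> (\<forall>x. x \<notin> K \<longrightarrow> \<phi> x = 0 \<and> grad UNIV \<phi> x = 0)"
proof (intro exI conjI allI impI)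
  let ?K = "closure {x. \<phi> x \<noteq> 0}"
  show "compact ?K" "?K \<subseteq> S" using assms by (auto simp: test_functions_def)
  have 0: "\<phi> x = 0" if "x \<notin> ?K" for x using that closure_subset[of "{x. \<phi> x \<noteq> 0}"] by auto
  fix x assume x: "x \<notin> ?K"
  then show "\<phi> x = 0" by (rule 0)
  show "grad UNIV \<phi> x = 0"
    by (rule gradient_zero_outside_support[OF test_function_gradient[OF assms] closed_closure 0 x])
qed

lemma integrable_test_scaleR:
  fixes g :: "real^'n \<Rightarrow> 'b::euclidean_space"
  assumes g: "locally_integrable S g" and S: "open S"
    and \<phi>: "continuous_on UNIV \<phi>" and K: "compact K" "K \<subseteq> S" "\<And>x. x \<notin> K \<Longrightarrow> \<phi> x = 0"
  shows "integrable (lebesgue_on S) (\<lambda>x. (\<phi> x :: real) *\<^sub>R g x)"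
proof -
  obtain M where M: "\<And>x. x \<in> K \<Longrightarrow> norm (\<phi> x) \<le> M"
    using compact_imp_bounded[OF compact_continuous_image[OF continuous_on_subset[OF \<phi>] K(1)]]
    by (auto simp: bounded_iff)
  have gK: "integrable (lebesgue_on K) g" using g K by (auto simp: locally_integrable_def)
  have \<phi>m: "\<phi> \<in> borel_measurable (lebesgue_on K)"
    by (metis \<phi> borel_measurable_continuous_onI measurable_completion measurable_lborel2 measurable_restrict_space1)
  have "integrable (lebesgue_on K) (\<lambda>x. \<phi> x *\<^sub>R g x)"
  proof (rule Bochner_Integration.integrable_bound)
    show "integrable (lebesgue_on K) (\<lambda>x. M *\<^sub>R norm (g x))" using gK by auto
    show "(\<lambda>x. \<phi> x *\<^sub>R g x) \<in> borel_measurable (lebesgue_on K)"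
      using \<phi>m borel_measurable_integrable[OF gK] by (rule borel_measurable_scaleR)
    show "AE x in lebesgue_on K. norm (\<phi> x *\<^sub>R g x) \<le> norm (M *\<^sub>R norm (g x))"
    proof (rule AE_I2)
      fix x assume "x \<in> space (lebesgue_on K)"
      then have "\<bar>\<phi> x\<bar> \<le> \<bar>M\<bar>" using M[of x] by auto
      then show "norm (\<phi> x *\<^sub>R g x) \<le> norm (M *\<^sub>R norm (g x))"
        by (simp add: abs_mult mult_right_mono)
    qed
  qed
  moreover have "(\<lambda>x. indicator S x *\<^sub>R \<phi> x *\<^sub>R g x) = (\<lambda>x. indicator K x *\<^sub>R \<phi> x *\<^sub>R g x)"
    using K by (auto simp: fun_eq_iff indicator_def)
  moreover have "K \<in> sets lebesgue" "S \<in> sets lebesgue" using K(1) S by (simp_all add: borel_compact)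
  ultimately show ?thesis by (simp add: integrable_restrict_space)
qed

text \<open>The smooth bumps of the box converge to its indicator and are dominated by the indicator
  of the closed box, on which \<open>g\<close> is integrable; so vanishing passes from test
  integrals to box integrals.\<close>

lemma locally_integrable_on_box:
  assumes g: "locally_integrable S g" and S: "open S" and c: "cbox a b \<subseteq> S"
    and 0: "\<And>\<phi>. \<phi> \<in> test_functions S \<Longrightarrow> (\<integral>x. \<phi> x *\<^sub>R g x \<partial>lebesgue_on S) = 0"
  shows "(\<integral>x. indicator (box a b) x *\<^sub>R g x \<partial>lebesgue_on S) = (0 :: 'b::euclidean_space)"
    and "integrable (lebesgue_on S) (\<lambda>x. indicator (cbox a b) x *\<^sub>R g x)"
proof -
  have gK: "integrable (lebesgue_on (cbox a b)) g" using g c by (auto simp: locally_integrable_def)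
  have eq: "(\<lambda>x. indicator S x *\<^sub>R indicator (cbox a b) x *\<^sub>R g x) = (\<lambda>x. indicator (cbox a b) x *\<^sub>R g x)"
    using c by (auto simp: fun_eq_iff indicator_def)
  show i: "integrable (lebesgue_on S) (\<lambda>x. indicator (cbox a b) x *\<^sub>R g x)"
    using gK S by (simp add: integrable_restrict_space eq del: scaleR_scaleR)
  have m: "indicator (box a b) \<in> borel_measurable (lebesgue_on S)"
    by (intro measurable_restrict_space1 borel_measurable_indicator) auto
  have eqb: "(\<lambda>x. indicator (box a b) x *\<^sub>R indicator (cbox a b) x *\<^sub>R g x) = (\<lambda>x. indicator (box a b) x *\<^sub>R g x)"
    using box_subset_cbox[of a b] by (auto simp: fun_eq_iff indicator_def)
  have "(\<lambda>k. \<integral>x. box_bump a b k x *\<^sub>R g x \<partial>lebesgue_on S)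
          \<longlonglongrightarrow> (\<integral>x. indicator (box a b) x *\<^sub>R g x \<partial>lebesgue_on S)"
  proof (rule integral_dominated_convergence[where w="\<lambda>x. norm (indicator (cbox a b) x *\<^sub>R g x)"])
    show "(\<lambda>x. indicator (box a b) x *\<^sub>R g x) \<in> borel_measurable (lebesgue_on S)"
      using borel_measurable_scaleR[OF m borel_measurable_integrable[OF i]] by (simp add: eqb del: scaleR_scaleR)
    show "(\<lambda>x. box_bump a b k x *\<^sub>R g x) \<in> borel_measurable (lebesgue_on S)" for k
    proof -
      obtain K where K: "compact K" "K \<subseteq> S" "\<And>x. x \<notin> K \<Longrightarrow> box_bump a b k x = 0"
        using test_function_support[OF box_bump_test_function[OF c, of k]] by auto
      show ?thesis
        by (rule borel_measurable_integrable)
           (rule integrable_test_scaleR[OF g S continuous_on_test_function[OF box_bump_test_function[OF c]] K])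
    qed
    show "AE x in lebesgue_on S. (\<lambda>k. box_bump a b k x *\<^sub>R g x) \<longlonglongrightarrow> indicator (box a b) x *\<^sub>R g x"
      by (intro AE_I2 tendsto_scaleR[OF box_bump_tendsto tendsto_const])
    show "AE x in lebesgue_on S. norm (box_bump a b k x *\<^sub>R g x) \<le> norm (indicator (cbox a b) x *\<^sub>R g x)" for k
    proof (rule AE_I2)
      fix x
      show "norm (box_bump a b k x *\<^sub>R g x) \<le> norm (indicator (cbox a b) x *\<^sub>R g x)"
      proof (cases "x \<in> cbox a b")
        case True
        then show ?thesis using box_bump_bounds[of a b k x] by (simp add: mult_left_le_one_le)
      next
        case False
        then have "box_bump a b k x = 0" using box_bump_nonzero[of a b k x] box_subset_cbox[of a b] by blast
        then show ?thesis by simp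
      qed
    qed
    show "integrable (lebesgue_on S) (\<lambda>x. norm (indicator (cbox a b) x *\<^sub>R g x))"
      by (rule integrable_norm[OF i])
  qed
  then show "(\<integral>x. indicator (box a b) x *\<^sub>R g x \<partial>lebesgue_on S) = 0"
    using 0[OF box_bump_test_function[OF c]] by (simp add: LIMSEQ_const_iff)
qed

text \<open>The fundamental lemma of the calculus of variations. Inside one closed box of
  \<open>S\<close> and for one component all box integrals vanish, which settles the open box;
  countably many closed boxes, whose faces are null sets, exhaust \<open>S\<close>.\<close>

lemma AE_eq_0_of_test_integrals:
  fixes g :: "real^'n \<Rightarrow> 'b::euclidean_space"
  assumes g: "locally_integrable S g" and S: "open S"
    and 0: "\<And>\<phi>. \<phi> \<in> test_functions S \<Longrightarrow> (\<integral>x. \<phi> x *\<^sub>R g x \<partial>lebesgue_on S) = 0"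
  shows "AE x in lebesgue_on S. g x = 0"
proof -
  have box: "AE x in lebesgue. x \<in> box c d \<longrightarrow> g x \<bullet> e = 0" if cd: "cbox c d \<subseteq> S" for c d e
  proof -
    define h where "h x = indicator (box c d) x *\<^sub>R g x \<bullet> e" for x
    have i: "integrable lebesgue (\<lambda>x. indicator (cbox c d) x *\<^sub>R g x)"
      using g cd integrable_restrict_space[of "cbox c d" lebesgue g] by (simp add: locally_integrable_def)
    have "integrable lebesgue (\<lambda>x. indicator (box c d) x *\<^sub>R indicator (cbox c d) x *\<^sub>R g x)"
      by (rule integrable_mult_indicator[OF _ i]) auto
    moreover have "(\<lambda>x. indicator (box c d) x *\<^sub>R indicator (cbox c d) x *\<^sub>R g x) = (\<lambda>x. indicator (box c d) x *\<^sub>R g x)"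
      using box_subset_cbox[of c d] by (auto simp: fun_eq_iff indicator_def)
    ultimately have ib: "integrable lebesgue (\<lambda>x. indicator (box c d) x *\<^sub>R g x)" by simp
    then have ih: "integrable lebesgue h" unfolding h_def by (rule integrable_inner_left)
    \<comment> \<open>Box integrals determine a function with respect to \<open>lborel\<close>,
      whereas \<open>h\<close> is only Lebesgue measurable; a Borel version bridges the two.\<close>
    obtain h' where h': "h' \<in> borel_measurable lborel" "AE x in lborel. h x = h' x"
      using completion_ex_borel_measurable_real[OF borel_measurable_integrable[OF ih]] by auto
    have ae: "AE x in lebesgue. h x = h' x" using h'(2) by (rule AE_completion)
    have h'l: "h' \<in> borel_measurable lebesgue" using h'(1) by (rule measurable_completion)
    have ih': "integrable lebesgue h'"
      using ih integrable_cong_AE[OF borel_measurable_integrable[OF ih] h'l ae] by simp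
    have "AE x in lborel. h' x = 0"
    proof (rule AE_eq_0_of_box_integrals)
      show "integrable lborel h'" using ih' h'(1) by (simp add: integrable_completion)
      fix a b :: "real^'n"
      \<comment> \<open>\<open>A\<close> and \<open>B\<close> are the corners of the intersection of
        the two boxes; it lies in the box that \<open>S\<close> is known to contain.\<close>
      define A where "A = (\<chi> i. max (a $ i) (c $ i))"
      define B where "B = (\<chi> i. min (b $ i) (d $ i))"
      have AB: "box a b \<inter> box c d = box A B" "cbox A B \<subseteq> S"
        using cd by (auto simp: A_def B_def mem_box_cart)
      have "(\<integral>x. indicator (box a b) x * h' x \<partial>lborel) = (\<integral>x. indicator (box a b) x * h' x \<partial>lebesgue)"
        by (rule integral_completion[symmetric]) (use h'(1) in measurable)
      also have "\<dots> = (\<integral>x. indicator (box a b) x * h x \<partial>lebesgue)"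
        using ae h'l borel_measurable_integrable[OF ih]
        by (intro integral_cong_AE borel_measurable_times borel_measurable_indicator) auto
      also have "\<dots> = (\<integral>x. (indicator (box A B) x *\<^sub>R g x) \<bullet> e \<partial>lebesgue)"
        unfolding h_def AB(1)[symmetric] by (intro Bochner_Integration.integral_cong) (auto simp: indicator_def)
      also have "\<dots> = (\<integral>x. (indicator S x *\<^sub>R indicator (box A B) x *\<^sub>R g x) \<bullet> e \<partial>lebesgue)"
        using AB(2) box_subset_cbox[of A B]
        by (intro Bochner_Integration.integral_cong) (auto simp: indicator_def)
      also have "\<dots> = (\<integral>x. indicator (box A B) x *\<^sub>R g x \<bullet> e \<partial>lebesgue_on S)"
        using S by (simp add: integral_restrict_space mult.assoc)
      also have "\<dots> = (\<integral>x. indicator (box A B) x *\<^sub>R g x \<partial>lebesgue_on S) \<bullet> e"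
      proof (cases "e = 0")
        case False
        have "integrable (lebesgue_on S) (\<lambda>x. indicator (box A B) x *\<^sub>R indicator (cbox A B) x *\<^sub>R g x)"
        proof (rule integrable_mult_indicator)
          show "box A B \<in> sets (lebesgue_on S)"
            using AB(2) box_subset_cbox[of A B] S by (auto simp: sets_restrict_space_iff)
          show "integrable (lebesgue_on S) (\<lambda>x. indicator (cbox A B) x *\<^sub>R g x)"
            by (rule locally_integrable_on_box(2)[OF g S AB(2) 0])
        qed
        moreover have "(\<lambda>x. indicator (box A B) x *\<^sub>R indicator (cbox A B) x *\<^sub>R g x) = (\<lambda>x. indicator (box A B) x *\<^sub>R g x)"
          using box_subset_cbox[of A B] by (auto simp: fun_eq_iff indicator_def)
        ultimately show ?thesis by (intro integral_inner_left) auto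
      qed simp
      also have "\<dots> = 0" using locally_integrable_on_box(1)[OF g S AB(2) 0] by simp
      finally show "(\<integral>x. indicator (box a b) x * h' x \<partial>lborel) = 0" .
    qed
    then have "AE x in lebesgue. h' x = 0" by (rule AE_completion)
    with ae show ?thesis by eventually_elim (auto simp: h_def)
  qed
  obtain \<D> where \<D>: "countable \<D>" "\<D> \<subseteq> Pow S" "\<And>X. X \<in> \<D> \<Longrightarrow> \<exists>a b. X = cbox a b" "\<Union>\<D> = S"
    using open_countable_Union_open_cbox[OF S] by metis
  have "AE x in lebesgue. \<forall>X\<in>\<D>. x \<in> X \<longrightarrow> g x = 0"
  proof (subst AE_ball_countable[OF \<D>(1)], safe)
    fix X assume "X \<in> \<D>"
    then obtain a b where X: "X = cbox a b" "cbox a b \<subseteq> S" using \<D> by blast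
    \<comment> \<open>The argument above reaches open boxes; the faces of a closed box are
      negligible.\<close>
    have "AE x in lebesgue. x \<notin> cbox a b - box a b"
      by (rule AE_not_in) (use negligible_frontier_interval[of a b] in \<open>simp add: negligible_iff_null_sets\<close>)
    moreover have "AE x in lebesgue. \<forall>e\<in>Basis. x \<in> box a b \<longrightarrow> g x \<bullet> e = 0"
      using box[OF X(2)] by (subst AE_ball_countable) (auto simp: countable_finite)
    ultimately show "AE x in lebesgue. x \<in> X \<longrightarrow> g x = 0"
      by eventually_elim (auto simp: X euclidean_all_zero_iff)
  qed
  then show ?thesis using S \<D>(4)
    by (subst AE_restrict_space_iff) (auto elim!: eventually_mono)
qed

text \<open>Subtract the two defining identities. This makes the choice in \<open>weak_grad\<close>
  harmless: it agrees almost everywhere with any weak gradient that is known explicitly.\<close>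

lemma has_weak_grad_unique:
  assumes S: "open S" and 1: "has_weak_grad S u g" and 2: "has_weak_grad S u k"
  shows "AE x in lebesgue_on S. g x = k x"
proof -
  have l: "locally_integrable S g" "locally_integrable S k"
    using 1 2 by (auto simp: has_weak_grad_def)
  have "AE x in lebesgue_on S. g x - k x = 0"
  proof (rule AE_eq_0_of_test_integrals[OF _ S])
    show "locally_integrable S (\<lambda>x. g x - k x)"
      using l by (auto simp: locally_integrable_def)
    fix \<phi> assume \<phi>: "\<phi> \<in> test_functions S"
    obtain K where K: "compact K" "K \<subseteq> S" "\<And>x. x \<notin> K \<Longrightarrow> \<phi> x = 0"
      using test_function_support[OF \<phi>] by auto
    note i = integrable_test_scaleR[OF _ S continuous_on_test_function[OF \<phi>] K]
    have "(\<integral>x. \<phi> x *\<^sub>R (g x - k x) \<partial>lebesgue_on S)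
        = (\<integral>x. \<phi> x *\<^sub>R g x \<partial>lebesgue_on S) - (\<integral>x. \<phi> x *\<^sub>R k x \<partial>lebesgue_on S)"
      using i[OF l(1)] i[OF l(2)] by (simp add: scaleR_diff_right)
    also have "\<dots> = 0"
    proof -
      have "(\<integral>x. u x *\<^sub>R grad UNIV \<phi> x \<partial>lebesgue_on S) = - (\<integral>x. \<phi> x *\<^sub>R g x \<partial>lebesgue_on S)"
        using 1 \<phi> unfolding has_weak_grad_def by blast
      moreover have "(\<integral>x. u x *\<^sub>R grad UNIV \<phi> x \<partial>lebesgue_on S) = - (\<integral>x. \<phi> x *\<^sub>R k x \<partial>lebesgue_on S)"
        using 2 \<phi> unfolding has_weak_grad_def by blast
      ultimately show ?thesis by simp
    qed
    finally show "(\<integral>x. \<phi> x *\<^sub>R (g x - k x) \<partial>lebesgue_on S) = 0" .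
  qed
  then show ?thesis by simp
qed

text \<open>Rests on the completeness of Lebesgue measure. It carries measurability over to
  \<open>weak_grad\<close>, which is pinned down only up to a null set.\<close>

lemma borel_measurable_lebesgue_on_AE:
  fixes g :: "'a::euclidean_space \<Rightarrow> 'b::euclidean_space"
  assumes S: "S \<in> sets lebesgue" and g: "g \<in> borel_measurable (lebesgue_on S)"
    and ae: "AE x in lebesgue_on S. g x = k x"
  shows "k \<in> borel_measurable (lebesgue_on S)"
proof -
  have "AE x in lebesgue. (if x \<in> S then g x else 0) = (if x \<in> S then k x else 0)"
    using ae S by (auto simp: AE_restrict_space_iff elim!: eventually_mono)
  from borel_measurable_AE[OF borel_measurable_if_I[OF g S] this]
  show ?thesis by (rule borel_measurable_if_D)
qed

lemma in_Lp_cong_AE: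
  fixes g :: "real^'n \<Rightarrow> 'b::euclidean_space"
  assumes S: "S \<in> sets lebesgue" and g: "in_Lp q S g" and ae: "AE x in lebesgue_on S. g x = k x"
  shows "in_Lp q S k"
proof -
  have k: "k \<in> borel_measurable (lebesgue_on S)"
    using borel_measurable_lebesgue_on_AE[OF S _ ae] g by (simp add: in_Lp_def)
  have "integrable (lebesgue_on S) (\<lambda>x. norm (k x) powr q)"
    by (rule integrable_cong_AE_imp[of _ "\<lambda>x. norm (g x) powr q"])
       (use g k ae in \<open>auto simp: in_Lp_def elim!: eventually_mono\<close>)
  with k show ?thesis by (simp add: in_Lp_def)
qed

lemma W1p_weak_grad:
  assumes S: "open S" and u: "u \<in> W1p p S"
  shows "has_weak_grad S u (weak_grad S u)" "in_Lp p S (weak_grad S u)"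
proof -
  obtain g where g: "has_weak_grad S u g" "in_Lp p S g" using u by (auto simp: W1p_def)
  show w: "has_weak_grad S u (weak_grad S u)" unfolding weak_grad_def by (rule someI[of "has_weak_grad S u", OF g(1)])
  show "in_Lp p S (weak_grad S u)"
    by (rule in_Lp_cong_AE[OF _ g(2) has_weak_grad_unique[OF S g(1) w]]) (use S in auto)
qed

section \<open>Density of test functions\<close>

text \<open>If t exceeds \<delta>, then (t / \<delta>) powr (p - 1) is at least 1; multiply by
  t.\<close>

lemma le_add_powr:
  assumes "t \<ge> 0" "\<delta> > 0" "p \<ge> (1::real)"
  shows "t \<le> \<delta> + \<delta> powr (1 - p) * t powr p"
proof (cases "t \<le> \<delta>")
  case False
  then have t: "t > \<delta>" "t > 0" using assms by auto
  have "1 = \<delta> powr (1 - p) * \<delta> powr (p - 1)" using assms by (simp flip: powr_add)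
  also have "\<dots> \<le> \<delta> powr (1 - p) * t powr (p - 1)"
    using t assms by (intro mult_left_mono powr_mono2) auto
  finally have "1 * t \<le> \<delta> powr (1 - p) * t powr (p - 1) * t"
    using t by (intro mult_right_mono) auto
  also have "t powr (p - 1) * t = t powr p"
    using t powr_add[of t "p - 1" 1] by simp
  then have "\<delta> powr (1 - p) * t powr (p - 1) * t = \<delta> powr (1 - p) * t powr p" by simp
  finally show ?thesis using assms by simp
qed (use assms in \<open>auto intro: order_trans[of _ \<delta>]\<close>)

text \<open>The sum is at most twice the larger summand. Convexity of the power is avoided because
  exponents below 1 occur, namely p / 2 for p < 2.\<close>

lemma powr_add_le:
  assumes "0 \<le> a" "0 \<le> b" "0 \<le> (p::real)"
  shows "(a + b) powr p \<le> 2 powr p * (a powr p + b powr p)"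
proof -
  have "(a + b) powr p \<le> (2 * max a b) powr p" using assms by (intro powr_mono2) auto
  also have "\<dots> = 2 powr p * max a b powr p" using assms by (simp add: powr_mult)
  also have "max a b powr p \<le> a powr p + b powr p" using assms by (auto simp: max_def)
  finally show ?thesis by simp
qed

lemma in_Lp_bounded:
  fixes b :: "real^'n \<Rightarrow> 'b::euclidean_space"
  assumes S: "S \<in> lmeasurable" and b: "b \<in> borel_measurable (lebesgue_on S)"
    and M: "\<And>x. x \<in> S \<Longrightarrow> norm (b x) \<le> M" and p: "p \<ge> 0"
  shows "in_Lp p S b"
proof -
  interpret finite_measure "lebesgue_on S" using S by (rule finite_measure_lebesgue_on)
  have "integrable (lebesgue_on S) (\<lambda>x. norm (b x) powr p)"
  proof (rule integrable_const_bound[where B="M powr p"])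
    show "(\<lambda>x. norm (b x) powr p) \<in> borel_measurable (lebesgue_on S)" using b by measurable
    show "AE x in lebesgue_on S. norm (norm (b x) powr p) \<le> M powr p"
      using M p by (intro AE_I2) (auto intro!: powr_mono2)
  qed
  with b show ?thesis by (simp add: in_Lp_def)
qed

lemma in_Lp_diff:
  fixes a b :: "real^'n \<Rightarrow> 'b::euclidean_space"
  assumes a: "in_Lp p S a" and b: "in_Lp p S b" and p: "p \<ge> 0"
  shows "in_Lp p S (\<lambda>x. a x - b x)"
proof -
  have m: "a \<in> borel_measurable (lebesgue_on S)" "b \<in> borel_measurable (lebesgue_on S)"
    and i: "integrable (lebesgue_on S) (\<lambda>x. norm (a x) powr p)"
      "integrable (lebesgue_on S) (\<lambda>x. norm (b x) powr p)"
    using a b by (auto simp: in_Lp_def)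
  have "integrable (lebesgue_on S) (\<lambda>x. norm (a x - b x) powr p)"
  proof (rule Bochner_Integration.integrable_bound)
    show "integrable (lebesgue_on S) (\<lambda>x. 2 powr p * (norm (a x) powr p + norm (b x) powr p))"
      using i by auto
    show "(\<lambda>x. norm (a x - b x) powr p) \<in> borel_measurable (lebesgue_on S)" using m by measurable
    show "AE x in lebesgue_on S. norm (norm (a x - b x) powr p) \<le> norm (2 powr p * (norm (a x) powr p + norm (b x) powr p))"
    proof (rule AE_I2)
      fix x
      have "norm (a x - b x) powr p \<le> (norm (a x) + norm (b x)) powr p"
        using p by (intro powr_mono2 norm_triangle_ineq4) auto
      also have "\<dots> \<le> 2 powr p * (norm (a x) powr p + norm (b x) powr p)"
        using p by (intro powr_add_le) auto
      finally show "norm (norm (a x - b x) powr p) \<le> norm (2 powr p * (norm (a x) powr p + norm (b x) powr p))"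
        by simp
    qed
  qed
  with m show ?thesis by (simp add: in_Lp_def)
qed

text \<open>\<delta> stays free: the first term is made small by \<delta>, and afterwards the second
  by the choice of an approximating function.\<close>

lemma in_Lp_integral_norm:
  fixes a :: "real^'n \<Rightarrow> 'b::euclidean_space"
  assumes S: "S \<in> lmeasurable" and a: "in_Lp p S a" and p: "p \<ge> 1"
  shows "integrable (lebesgue_on S) a"
    and "\<delta> > 0 \<Longrightarrow> (\<integral>x. norm (a x) \<partial>lebesgue_on S)
      \<le> \<delta> * measure lebesgue S + \<delta> powr (1 - p) * (\<integral>x. norm (a x) powr p \<partial>lebesgue_on S)"
proof -
  interpret finite_measure "lebesgue_on S" using S by (rule finite_measure_lebesgue_on)
  have m: "a \<in> borel_measurable (lebesgue_on S)"
    and i: "integrable (lebesgue_on S) (\<lambda>x. norm (a x) powr p)"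
    using a by (auto simp: in_Lp_def)
  show ia: "integrable (lebesgue_on S) a"
    by (rule Bochner_Integration.integrable_bound[of _ "\<lambda>x. 1 + 1 powr (1 - p) * norm (a x) powr p"])
       (use m i p le_add_powr[OF norm_ge_zero zero_less_one p] in auto)
  assume \<delta>: "\<delta> > 0"
  have "(\<integral>x. norm (a x) \<partial>lebesgue_on S) \<le> (\<integral>x. \<delta> + \<delta> powr (1 - p) * norm (a x) powr p \<partial>lebesgue_on S)"
    using ia i p \<delta> by (intro integral_mono) (auto intro!: le_add_powr)
  also have "\<dots> = \<delta> * measure lebesgue S + \<delta> powr (1 - p) * (\<integral>x. norm (a x) powr p \<partial>lebesgue_on S)"
    using i S by (simp add: measure_restrict_space)
  finally show "(\<integral>x. norm (a x) \<partial>lebesgue_on S)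
      \<le> \<delta> * measure lebesgue S + \<delta> powr (1 - p) * (\<integral>x. norm (a x) powr p \<partial>lebesgue_on S)" .
qed

lemma bounded_test_function:
  assumes "\<phi> \<in> test_functions S"
  obtains B where "\<And>x. norm (\<phi> x) \<le> B" "\<And>x. norm (grad UNIV \<phi> x) \<le> B"
proof -
  obtain K where K: "compact K" "\<And>x. x \<notin> K \<Longrightarrow> \<phi> x = 0" "\<And>x. x \<notin> K \<Longrightarrow> grad UNIV \<phi> x = 0"
    using test_function_support[OF assms] by auto
  have "bounded (\<phi> ` K)" "bounded (grad UNIV \<phi> ` K)"
    by (intro compact_imp_bounded compact_continuous_image K
        continuous_on_subset[OF continuous_on_test_function[OF assms] subset_UNIV]
        continuous_on_subset[OF continuous_on_test_gradient[OF assms] subset_UNIV])+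
  then obtain B1 B2 where B: "\<And>x. x \<in> K \<Longrightarrow> norm (\<phi> x) \<le> B1" "\<And>x. x \<in> K \<Longrightarrow> norm (grad UNIV \<phi> x) \<le> B2"
    by (fastforce simp: bounded_iff)
  show ?thesis
  proof (rule that[of "max 0 (max B1 B2)"])
    show "norm (\<phi> x) \<le> max 0 (max B1 B2)" "norm (grad UNIV \<phi> x) \<le> max 0 (max B1 B2)" for x
      using B[of x] K(2,3)[of x] by (cases "x \<in> K"; auto simp: le_max_iff_disj)+
  qed
qed

lemma continuous_borel_measurable_lebesgue_on:
  fixes h :: "'a::euclidean_space \<Rightarrow> 'b::euclidean_space"
  assumes "continuous_on UNIV h"
  shows "h \<in> borel_measurable (lebesgue_on S)"
proof -
  have "h \<in> borel_measurable borel" using assms by (rule borel_measurable_continuous_onI)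
  then have "h \<in> borel_measurable lborel" by simp
  then have "h \<in> borel_measurable lebesgue" by (rule measurable_completion)
  then show ?thesis by (rule measurable_restrict_space1)
qed

text \<open>The bound \<open>t \<le> \<delta> + \<delta> powr (1 - p) * t powr p\<close> replaces Hoelder's inequality here.\<close>

lemma weak_equation_W01p:
  fixes T :: "real^'n \<Rightarrow> real^'n"
  assumes S: "open S" "S \<in> lmeasurable" and p: "p > 1"
    and T: "T \<in> borel_measurable (lebesgue_on S)" "\<And>x. x \<in> S \<Longrightarrow> norm (T x) \<le> M"
    and f: "f \<in> borel_measurable (lebesgue_on S)" "\<And>x. x \<in> S \<Longrightarrow> \<bar>f x\<bar> \<le> M"
    and eq: "\<And>\<phi>. \<phi> \<in> test_functions S \<Longrightarrow>
       (\<integral>x. T x \<bullet> grad UNIV \<phi> x \<partial>lebesgue_on S) = (\<integral>x. f x * \<phi> x \<partial>lebesgue_on S)"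
    and v: "v \<in> W01p p S"
  shows "(\<integral>x. T x \<bullet> weak_grad S v x \<partial>lebesgue_on S) = (\<integral>x. f x * v x \<partial>lebesgue_on S)"
    and "integrable (lebesgue_on S) (\<lambda>x. T x \<bullet> weak_grad S v x)"
    and "integrable (lebesgue_on S) (\<lambda>x. f x * v x)"
proof -
  \<comment> \<open>\<open>M\<close> may be negative when \<open>S\<close> is empty.\<close>
  define M' where "M' = max M 0"
  have M': "M' \<ge> 0" "\<And>x. x \<in> S \<Longrightarrow> norm (T x) \<le> M'" "\<And>x. x \<in> S \<Longrightarrow> \<bar>f x\<bar> \<le> M'"
    using T(2) f(2) by (force simp: M'_def)+
  have vW: "v \<in> W1p p S" using v by (simp add: W01p_def)
  have Lv: "in_Lp p S v" using vW by (simp add: W1p_def)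
  have Lg: "in_Lp p S (weak_grad S v)" by (rule W1p_weak_grad(2)[OF S(1) vW])
  have iT: "integrable (lebesgue_on S) (\<lambda>x. T x \<bullet> g x)"
    and bT: "\<bar>\<integral>x. T x \<bullet> g x \<partial>lebesgue_on S\<bar> \<le> M' * (\<integral>x. norm (g x) \<partial>lebesgue_on S)"
    if g: "integrable (lebesgue_on S) g" for g
  proof -
    have ae: "\<bar>T x \<bullet> g x\<bar> \<le> M' * norm (g x)" if "x \<in> S" for x
      using Cauchy_Schwarz_ineq2[of "T x" "g x"] mult_right_mono[OF M'(2)[OF that] norm_ge_zero, of "g x"] by linarith
    have mm: "(\<lambda>x. T x \<bullet> g x) \<in> borel_measurable (lebesgue_on S)"
      using T(1) borel_measurable_integrable[OF g] by (rule borel_measurable_inner)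
    show i: "integrable (lebesgue_on S) (\<lambda>x. T x \<bullet> g x)"
      by (rule Bochner_Integration.integrable_bound[of _ "\<lambda>x. M' * norm (g x)"])
         (use g ae mm M'(1) in \<open>auto simp: abs_mult\<close>)
    have "\<bar>\<integral>x. T x \<bullet> g x \<partial>lebesgue_on S\<bar> \<le> (\<integral>x. \<bar>T x \<bullet> g x\<bar> \<partial>lebesgue_on S)"
      using integral_norm_bound[of "lebesgue_on S" "\<lambda>x. T x \<bullet> g x"] by simp
    also have "\<dots> \<le> (\<integral>x. M' * norm (g x) \<partial>lebesgue_on S)"
      using i g ae by (intro integral_mono) auto
    finally show "\<bar>\<integral>x. T x \<bullet> g x \<partial>lebesgue_on S\<bar> \<le> M' * (\<integral>x. norm (g x) \<partial>lebesgue_on S)" by simp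
  qed
  have if': "integrable (lebesgue_on S) (\<lambda>x. f x * g x)"
    and bf: "\<bar>\<integral>x. f x * g x \<partial>lebesgue_on S\<bar> \<le> M' * (\<integral>x. norm (g x) \<partial>lebesgue_on S)"
    if g: "integrable (lebesgue_on S) g" for g :: "real^'n \<Rightarrow> real"
  proof -
    have ae: "\<bar>f x * g x\<bar> \<le> M' * norm (g x)" if "x \<in> S" for x
      using mult_right_mono[OF M'(3)[OF that] norm_ge_zero, of "g x"] by (simp add: abs_mult)
    have mm: "(\<lambda>x. f x * g x) \<in> borel_measurable (lebesgue_on S)"
      using f(1) borel_measurable_integrable[OF g] by (rule borel_measurable_times)
    show i: "integrable (lebesgue_on S) (\<lambda>x. f x * g x)"
      by (rule Bochner_Integration.integrable_bound[of _ "\<lambda>x. M' * norm (g x)"])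
         (use g ae mm M'(1) in \<open>auto simp: abs_mult\<close>)
    have "\<bar>\<integral>x. f x * g x \<partial>lebesgue_on S\<bar> \<le> (\<integral>x. \<bar>f x * g x\<bar> \<partial>lebesgue_on S)"
      using integral_norm_bound[of "lebesgue_on S" "\<lambda>x. f x * g x"] by simp
    also have "\<dots> \<le> (\<integral>x. M' * norm (g x) \<partial>lebesgue_on S)"
      using i g ae by (intro integral_mono) auto
    finally show "\<bar>\<integral>x. f x * g x \<partial>lebesgue_on S\<bar> \<le> M' * (\<integral>x. norm (g x) \<partial>lebesgue_on S)" by simp
  qed
  have iv: "integrable (lebesgue_on S) v" "integrable (lebesgue_on S) (weak_grad S v)"
    using in_Lp_integral_norm(1)[OF S(2) Lv] in_Lp_integral_norm(1)[OF S(2) Lg] p by auto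
  show "integrable (lebesgue_on S) (\<lambda>x. T x \<bullet> weak_grad S v x)"
    "integrable (lebesgue_on S) (\<lambda>x. f x * v x)" by (rule iT[OF iv(2)], rule if'[OF iv(1)])
  define \<Delta> where "\<Delta> = (\<integral>x. T x \<bullet> weak_grad S v x \<partial>lebesgue_on S) - (\<integral>x. f x * v x \<partial>lebesgue_on S)"
  define c where "c = measure lebesgue S"
  have c: "c \<ge> 0" by (simp add: c_def)
  have est: "\<bar>\<Delta>\<bar> \<le> M' * ((2 * c + 1) * \<delta>)" if \<delta>: "\<delta> > 0" for \<delta>
  proof -
    \<comment> \<open>Chosen such that \<open>\<delta> powr (1 - p) * e = \<delta>\<close>, which
      makes every error term a multiple of \<delta>.\<close>
    define e where "e = \<delta> / \<delta> powr (1 - p)"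
    have e: "e > 0" using \<delta> by (simp add: e_def)
    with v obtain \<phi> where \<phi>: "\<phi> \<in> test_functions S"
      and l: "(\<integral>x. \<bar>v x - \<phi> x\<bar> powr p \<partial>lebesgue_on S)
        + (\<integral>x. norm (weak_grad S v x - grad UNIV \<phi> x) powr p \<partial>lebesgue_on S) < e"
      by (auto simp: W01p_def)
    obtain B where B: "\<And>x. norm (\<phi> x) \<le> B" "\<And>x. norm (grad UNIV \<phi> x) \<le> B"
      using bounded_test_function[OF \<phi>] by blast
    have L: "in_Lp p S \<phi>" "in_Lp p S (grad UNIV \<phi>)"
      using in_Lp_bounded[OF S(2) continuous_borel_measurable_lebesgue_on[OF continuous_on_test_function[OF \<phi>]] B(1)]
        in_Lp_bounded[OF S(2) continuous_borel_measurable_lebesgue_on[OF continuous_on_test_gradient[OF \<phi>]] B(2)] p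
      by auto
    have i\<phi>: "integrable (lebesgue_on S) \<phi>" "integrable (lebesgue_on S) (grad UNIV \<phi>)"
      using in_Lp_integral_norm(1)[OF S(2) L(1)] in_Lp_integral_norm(1)[OF S(2) L(2)] p by auto
    have Ld: "in_Lp p S (\<lambda>x. v x - \<phi> x)" "in_Lp p S (\<lambda>x. weak_grad S v x - grad UNIV \<phi> x)"
      using in_Lp_diff[OF Lv L(1)] in_Lp_diff[OF Lg L(2)] p by auto
    have d1: "(\<integral>x. T x \<bullet> (weak_grad S v x - grad UNIV \<phi> x) \<partial>lebesgue_on S)
        = (\<integral>x. T x \<bullet> weak_grad S v x \<partial>lebesgue_on S) - (\<integral>x. T x \<bullet> grad UNIV \<phi> x \<partial>lebesgue_on S)"
      using iT[OF iv(2)] iT[OF i\<phi>(2)] by (simp add: inner_diff_right)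
    have d2: "(\<integral>x. f x * (v x - \<phi> x) \<partial>lebesgue_on S)
        = (\<integral>x. f x * v x \<partial>lebesgue_on S) - (\<integral>x. f x * \<phi> x \<partial>lebesgue_on S)"
      using if'[OF iv(1)] if'[OF i\<phi>(1)] by (simp add: right_diff_distrib)
    have "\<bar>\<Delta>\<bar> \<le> \<bar>\<integral>x. T x \<bullet> (weak_grad S v x - grad UNIV \<phi> x) \<partial>lebesgue_on S\<bar>
        + \<bar>\<integral>x. f x * (v x - \<phi> x) \<partial>lebesgue_on S\<bar>"
      unfolding \<Delta>_def d1 d2 eq[OF \<phi>] by linarith
    also have "\<dots> \<le> M' * (\<integral>x. norm (weak_grad S v x - grad UNIV \<phi> x) \<partial>lebesgue_on S)
        + M' * (\<integral>x. norm (v x - \<phi> x) \<partial>lebesgue_on S)"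
      using iv i\<phi> by (intro add_mono bT bf) auto
    also have "\<dots> \<le> M' * (\<delta> * c + \<delta> powr (1 - p) * (\<integral>x. norm (weak_grad S v x - grad UNIV \<phi> x) powr p \<partial>lebesgue_on S))
        + M' * (\<delta> * c + \<delta> powr (1 - p) * (\<integral>x. norm (v x - \<phi> x) powr p \<partial>lebesgue_on S))"
      unfolding c_def using Ld p \<delta> M'(1) S(2) by (intro add_mono mult_left_mono in_Lp_integral_norm) auto
    also have "\<dots> = M' * (2 * \<delta> * c + \<delta> powr (1 - p) * ((\<integral>x. \<bar>v x - \<phi> x\<bar> powr p \<partial>lebesgue_on S)
        + (\<integral>x. norm (weak_grad S v x - grad UNIV \<phi> x) powr p \<partial>lebesgue_on S)))"
      by (simp add: algebra_simps)
    also have "\<dots> \<le> M' * (2 * \<delta> * c + \<delta> powr (1 - p) * e)"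
      using l M'(1) by (intro mult_left_mono add_left_mono) auto
    also have "\<dots> = M' * ((2 * c + 1) * \<delta>)" using \<delta> by (simp add: e_def algebra_simps)
    finally show ?thesis .
  qed
  have "\<bar>\<Delta>\<bar> \<le> 0 + \<epsilon>" if \<epsilon>: "\<epsilon> > 0" for \<epsilon>
  proof -
    \<comment> \<open>The summand 1 keeps \<open>K\<close> positive when \<open>M'\<close> is
      0.\<close>
    define K where "K = M' * (2 * c + 1) + 1"
    have K: "K > 0" using M'(1) c by (simp add: K_def add_nonneg_pos)
    have "\<bar>\<Delta>\<bar> \<le> M' * ((2 * c + 1) * (\<epsilon> / K))" using est[of "\<epsilon> / K"] \<epsilon> K by simp
    also have "\<dots> = (K - 1) * (\<epsilon> / K)" by (simp add: K_def)
    also have "\<dots> \<le> K * (\<epsilon> / K)" using \<epsilon> K by (intro mult_right_mono) auto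
    also have "\<dots> = \<epsilon>" using K by simp
    finally show ?thesis by simp
  qed
  then have "\<bar>\<Delta>\<bar> \<le> 0" by (rule field_le_epsilon)
  then show "(\<integral>x. T x \<bullet> weak_grad S v x \<partial>lebesgue_on S) = (\<integral>x. f x * v x \<partial>lebesgue_on S)"
    by (simp add: \<Delta>_def)
qed

section \<open>Radial functions on an annulus\<close>

lemma annulus_eq:
  assumes "0 < R1"
  shows "annulus R1 R2 = {x. R1 < norm x \<and> norm x < R2}"
proof -
  have eq: "ball 0 R2 - ball 0 R1 = ball 0 R2 \<inter> - ball (0 :: real^'n) R1" by auto
  have "annulus R1 R2 = ball (0 :: real^'n) R2 \<inter> - cball 0 R1"
    unfolding annulus_def eq interior_Int interior_complement using assms by (simp add: interior_open)
  then show ?thesis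
    unfolding set_eq_iff Int_iff Compl_iff mem_ball_0 mem_cball_0 mem_Collect_eq not_le by blast
qed

lemma open_annulus: "open (annulus R1 R2)"
  by (simp add: annulus_def)

lemma closure_annulus:
  assumes R: "0 < R1" "R1 < R2"
  shows "closure (annulus R1 R2) = {x :: real^'n. R1 \<le> norm x \<and> norm x \<le> R2}" (is "_ = ?A")
proof
  have "?A = cball 0 R2 \<inter> - ball 0 R1" by auto
  then have "closed ?A" by (auto intro: closed_Int)
  then show "closure (annulus R1 R2) \<subseteq> ?A"
    by (intro closure_minimal) (auto simp: annulus_eq R)
  show "?A \<subseteq> closure (annulus R1 R2)"
  proof
    fix x :: "real^'n" assume x: "x \<in> ?A"
    define m where "m = (R1 + R2) / 2"
    have m: "R1 < m" "m < R2" using R by (auto simp: m_def)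
    have x0: "norm x > 0" using x R by auto
    show "x \<in> closure (annulus R1 R2)"
      unfolding closure_approachable
    proof safe
      fix e :: real assume e: "0 < e"
      define t where "t = min 1 (e / (\<bar>m - norm x\<bar> + 1))"
      have t: "0 < t" "t \<le> 1" using e by (auto simp: t_def)
      have "t \<le> e / (\<bar>m - norm x\<bar> + 1)" by (simp add: t_def)
      then have te: "t * (\<bar>m - norm x\<bar> + 1) \<le> e" by (simp add: pos_le_divide_eq add_nonneg_pos)
      \<comment> \<open>The point on the ray of \<open>x\<close> with norm
        \<open>(1 - t) * norm x + t * m\<close>: mixing in the middle radius \<open>m\<close> moves
        points of either sphere inside, and the choice of \<open>t\<close> keeps the move below
        \<open>e\<close>.\<close>
      define y where "y = ((1 - t) + t * m / norm x) *\<^sub>R x"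
      have "norm y = \<bar>(1 - t) + t * m / norm x\<bar> * norm x" by (simp add: y_def)
      also have "\<bar>(1 - t) + t * m / norm x\<bar> = (1 - t) + t * m / norm x"
        using t m R x0 by (intro abs_of_nonneg add_nonneg_nonneg) auto
      finally have ny: "norm y = (1 - t) * norm x + t * m" using x0 by (simp add: distrib_right)
      have "(1 - t) * R1 + t * R1 < norm y" "norm y < (1 - t) * R2 + t * R2"
        unfolding ny using x t m
        by (intro add_le_less_mono mult_left_mono mult_strict_left_mono; simp)+
      then have "y \<in> annulus R1 R2" using R by (simp add: annulus_eq algebra_simps)
      moreover have "dist y x < e"
      proof -
        have "y - x = (t * (m - norm x) / norm x) *\<^sub>R x"
          using x0 by (simp add: y_def algebra_simps diff_divide_distrib)
        then have "dist y x = t * \<bar>m - norm x\<bar>"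
          using t x0 by (simp add: dist_norm abs_mult)
        also have "\<dots> < t * (\<bar>m - norm x\<bar> + 1)" using t by simp
        finally show ?thesis using te by simp
      qed
      ultimately show "\<exists>y\<in>annulus R1 R2. dist y x < e" by blast
    qed
  qed
qed

lemma frontier_annulus:
  assumes R: "0 < R1" "R1 < R2"
  shows "frontier (annulus R1 R2) = {x :: real^'n. norm x = R1 \<or> norm x = R2}"
proof -
  have "frontier (annulus R1 R2) = {x :: real^'n. R1 \<le> norm x \<and> norm x \<le> R2} - annulus R1 R2"
    by (simp add: frontier_def interior_open[OF open_annulus] closure_annulus[OF R])
  then show ?thesis using R
    unfolding annulus_eq[OF R(1)] set_eq_iff Diff_iff mem_Collect_eq by (smt (verit))
qed

lemma compact_closed_annulus: "0 < R1 \<Longrightarrow> R1 < R2 \<Longrightarrow> compact (closure (annulus R1 R2))"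
  by (intro compact_closure[THEN iffD2] bounded_subset[OF bounded_ball[of 0 R2]])
     (auto simp: annulus_eq)

lemma annulus_lmeasurable: "0 < R1 \<Longrightarrow> annulus R1 R2 \<in> lmeasurable"
  by (intro lmeasurable_open bounded_subset[OF bounded_ball[of 0 R2]] open_annulus)
     (auto simp: annulus_eq)

text \<open>Every point of the closed annulus, boundary included, sees an open half space of directions
  that enter it.\<close>

lemma gradient_unique_closed_annulus:
  assumes R: "0 < R1" "R1 < R2" and x: "x \<in> closure (annulus R1 R2 :: (real^'n) set)"
    and g: "(u has_derivative (\<lambda>h. g \<bullet> h)) (at x within closure (annulus R1 R2))"
    and k: "(u has_derivative (\<lambda>h. k \<bullet> h)) (at x within closure (annulus R1 R2))"
  shows "g = k"
proof -
  let ?A = "closure (annulus R1 R2) :: (real^'n) set"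
  \<comment> \<open>\<open>\<sigma> *\<^sub>R x\<close> points into the closed annulus: outwards,
    unless \<open>x\<close> lies on the outer sphere.\<close>
  define \<sigma> where "\<sigma> = (if norm x < R2 then 1 else -1 :: real)"
  have xn: "R1 \<le> norm x" "norm x \<le> R2" using x R by (auto simp: closure_annulus)
  have dir: "g \<bullet> h = k \<bullet> h" if h: "\<sigma> * (x \<bullet> h) > 0" for h
  proof -
    have lim: "((\<lambda>t. norm (x + t *\<^sub>R h)) \<longlongrightarrow> norm (x + 0 *\<^sub>R h)) (at_right 0)"
      by (intro tendsto_intros)
    have lim2: "((\<lambda>t. 2 * (x \<bullet> h) + t * (norm h)\<^sup>2) \<longlongrightarrow> 2 * (x \<bullet> h) + 0 * (norm h)\<^sup>2) (at_right 0)"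
      by (intro tendsto_intros)
    have sq: "(norm (x + t *\<^sub>R h))\<^sup>2 = (norm x)\<^sup>2 + t * (2 * (x \<bullet> h) + t * (norm h)\<^sup>2)" for t
      by (simp add: power2_norm_eq_inner inner_add_left inner_add_right inner_commute algebra_simps)
    have "eventually (\<lambda>t. x + t *\<^sub>R h \<in> ?A) (at_right 0)"
    proof (cases "norm x < R2")
      case True
      then have "x \<bullet> h > 0" using h by (simp add: \<sigma>_def)
      then have "eventually (\<lambda>t. 0 < 2 * (x \<bullet> h) + t * (norm h)\<^sup>2) (at_right 0)"
        using order_tendstoD(1)[OF lim2, of 0] by simp
      moreover have "eventually (\<lambda>t. norm (x + t *\<^sub>R h) < R2) (at_right 0)"
        using order_tendstoD(2)[OF lim, of R2] True by simp
      ultimately show ?thesis using eventually_at_right_less[of 0]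
      proof eventually_elim
        case (elim t)
        then have "(norm x)\<^sup>2 \<le> (norm (x + t *\<^sub>R h))\<^sup>2" unfolding sq by simp
        then have "norm x \<le> norm (x + t *\<^sub>R h)" by (rule power2_le_imp_le) simp
        then show ?case using elim xn R by (simp add: closure_annulus)
      qed
    next
      case False
      then have "x \<bullet> h < 0" using h by (simp add: \<sigma>_def)
      then have "eventually (\<lambda>t. 2 * (x \<bullet> h) + t * (norm h)\<^sup>2 < 0) (at_right 0)"
        using order_tendstoD(2)[OF lim2, of 0] by simp
      moreover have "eventually (\<lambda>t. R1 < norm (x + t *\<^sub>R h)) (at_right 0)"
        using order_tendstoD(1)[OF lim, of R1] False R by simp
      ultimately show ?thesis using eventually_at_right_less[of 0]
      proof eventually_elim
        case (elim t)
        then have "(norm (x + t *\<^sub>R h))\<^sup>2 \<le> (norm x)\<^sup>2" unfolding sq by (simp add: mult_le_0_iff)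
        then have "norm (x + t *\<^sub>R h) \<le> norm x" by (rule power2_le_imp_le) simp
        then show ?case using elim xn R by (simp add: closure_annulus)
      qed
    qed
    then obtain d where d: "d > 0" "\<And>t. 0 < t \<Longrightarrow> t < d \<Longrightarrow> x + t *\<^sub>R h \<in> ?A"
      by (auto simp: eventually_at_right_field)
    let ?I = "cbox 0 (d / 2)"
    have img: "(\<lambda>t. x + t *\<^sub>R h) ` ?I \<subseteq> ?A"
    proof safe
      fix t assume "t \<in> ?I"
      then show "x + t *\<^sub>R h \<in> ?A" using d x by (cases "t = 0") auto
    qed
    have "((\<lambda>t. u (x + t *\<^sub>R h)) has_vector_derivative (w \<bullet> h)) (at 0 within ?I)"
      if w: "(u has_derivative (\<lambda>h. w \<bullet> h)) (at x within ?A)" for w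
    proof -
      have "((\<lambda>t::real. x + t *\<^sub>R h) has_derivative (\<lambda>t. t *\<^sub>R h)) (at 0 within ?I)"
        by (auto intro!: derivative_eq_intros)
      moreover have "(u has_derivative (\<lambda>h. w \<bullet> h)) (at (x + 0 *\<^sub>R h) within (\<lambda>t. x + t *\<^sub>R h) ` ?I)"
        using has_derivative_subset[OF w img] by simp
      ultimately have "((\<lambda>t. u (x + t *\<^sub>R h)) has_derivative (\<lambda>t. w \<bullet> (t *\<^sub>R h))) (at 0 within ?I)"
        by (rule has_derivative_in_compose)
      then show ?thesis by (simp add: has_vector_derivative_def)
    qed
    from this[OF g] this[OF k] show ?thesis
      by (rule vector_derivative_unique_within_closed_interval[rotated 2]) (use d in auto)
  qed
  define e where "e = g - k"
  have xx: "x \<bullet> x > 0" using xn R by (auto simp flip: norm_eq_sqrt_inner simp: dot_square_norm)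
  have \<sigma>: "\<sigma> * \<sigma> = 1" by (simp add: \<sigma>_def)
  have ex: "e \<bullet> (\<sigma> *\<^sub>R x) = 0"
  proof -
    have "\<sigma> * (x \<bullet> (\<sigma> *\<^sub>R x)) = x \<bullet> x" by (simp add: \<sigma>_def)
    with xx have "\<sigma> * (x \<bullet> (\<sigma> *\<^sub>R x)) > 0" by (simp only:)
    from dir[OF this] show ?thesis by (simp only: e_def inner_diff_left)
  qed
  \<comment> \<open>So small that tilting \<open>\<sigma> *\<^sub>R x\<close> by
    \<open>s *\<^sub>R e\<close> leaves an entering direction. As \<open>e\<close> is orthogonal to
    both vectors, it is orthogonal to itself.\<close>
  define s where "s = (x \<bullet> x) / (2 * (\<bar>x \<bullet> e\<bar> + 1))"
  have s: "s > 0" using xx by (simp add: s_def)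
  have "s * \<bar>x \<bullet> e\<bar> < x \<bullet> x"
  proof -
    have "s * \<bar>x \<bullet> e\<bar> \<le> s * (\<bar>x \<bullet> e\<bar> + 1)" using s by simp
    also have "\<dots> = (x \<bullet> x) / 2" by (simp add: s_def field_simps)
    finally show ?thesis using xx by linarith
  qed
  moreover have "\<bar>\<sigma> * s * (x \<bullet> e)\<bar> = s * \<bar>x \<bullet> e\<bar>" using s by (simp add: abs_mult \<sigma>_def)
  moreover have "\<sigma> * (x \<bullet> (\<sigma> *\<^sub>R x + s *\<^sub>R e)) = x \<bullet> x + \<sigma> * s * (x \<bullet> e)"
    by (simp add: inner_add_right \<sigma>_def algebra_simps)
  ultimately have "\<sigma> * (x \<bullet> (\<sigma> *\<^sub>R x + s *\<^sub>R e)) > 0" by linarith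
  from dir[OF this] have "e \<bullet> (\<sigma> *\<^sub>R x + s *\<^sub>R e) = 0" by (simp add: e_def inner_diff_left)
  then have "s * (e \<bullet> e) = 0" unfolding inner_add_right ex by simp
  then show ?thesis using s by (simp add: e_def)
qed

lemma grad_closed_annulus:
  assumes R: "0 < R1" "R1 < R2" and x: "x \<in> closure (annulus R1 R2 :: (real^'n) set)"
    and g: "(u has_derivative (\<lambda>h. g \<bullet> h)) (at x within closure (annulus R1 R2))"
  shows "grad (closure (annulus R1 R2)) u x = g"
  unfolding grad_def
  by (rule the_equality[where P="\<lambda>g. (u has_derivative (\<lambda>h. g \<bullet> h)) (at x within closure (annulus R1 R2))", OF g])
     (rule gradient_unique_closed_annulus[OF R x _ g])

lemma has_derivative_radial:
  fixes x :: "real^'n"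
  assumes U: "(U has_real_derivative w) (at (norm x))" and x: "x \<noteq> 0"
  shows "((\<lambda>y. U (norm y)) has_derivative (\<lambda>h. ((w / norm x) *\<^sub>R x) \<bullet> h)) (at x)"
proof -
  have "((\<lambda>y. U (norm y)) has_derivative (\<lambda>h. w * (h \<bullet> sgn x))) (at x)"
    by (rule has_derivative_compose[OF has_derivative_norm[OF x] U[unfolded has_field_derivative_def]])
  moreover have "(\<lambda>h. w * (h \<bullet> sgn x)) = (\<lambda>h. ((w / norm x) *\<^sub>R x) \<bullet> h)"
    by (auto simp: sgn_div_norm inner_commute divide_inverse)
  ultimately show ?thesis by simp
qed

section \<open>Radial vector fields\<close>

text \<open>The field with radial component \<open>m\<close>; gradients of radial functions and
  their fluxes all have this form.\<close>

definition radial_field :: "(real \<Rightarrow> real) \<Rightarrow> real^'n \<Rightarrow> real^'n" where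
  "radial_field m y = (m (norm y) / norm y) *\<^sub>R y"

lemma norm_radial_field: "x \<noteq> 0 \<Longrightarrow> norm (radial_field m x) = \<bar>m (norm x)\<bar>"
  by (simp add: radial_field_def)

lemma continuous_on_radial_field:
  assumes "continuous_on (norm ` S) m" "0 \<notin> S"
  shows "continuous_on S (radial_field m)"
  unfolding radial_field_def[abs_def] using assms
  by (intro continuous_intros continuous_on_compose2[OF assms(1)]) auto

text \<open>The derivative is a multiple of the identity plus a multiple of the rank-one map along
  \<open>x\<close>. Its symmetry means vanishing curl, and its trace is the divergence.\<close>

lemma has_derivative_radial_field:
  fixes x :: "real^'n"
  assumes m: "(m has_real_derivative m') (at (norm x))" and x: "x \<noteq> 0"
  shows "(radial_field m has_derivative
    (\<lambda>h. ((m' - m (norm x) / norm x) / (norm x)\<^sup>2 * (x \<bullet> h)) *\<^sub>R x + (m (norm x) / norm x) *\<^sub>R h)) (at x)"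
proof -
  have "((\<lambda>r. m r / r) has_real_derivative (m' - m (norm x) / norm x) / norm x) (at (norm x))"
    using x by (auto intro!: derivative_eq_intros m simp: field_simps power2_eq_square)
  from has_derivative_radial[OF this x]
  have "((\<lambda>y. (m (norm y) / norm y) *\<^sub>R y) has_derivative
     (\<lambda>h. (m (norm x) / norm x) *\<^sub>R h + (((m' - m (norm x) / norm x) / norm x / norm x) *\<^sub>R x \<bullet> h) *\<^sub>R x)) (at x)"
    by (rule has_derivative_scaleR) (rule has_derivative_ident)
  then show ?thesis
    unfolding radial_field_def[abs_def] by (simp add: power2_eq_square add.commute)
qed

lemma trace_radial_derivative:
  fixes x :: "real^'n"
  assumes "x \<noteq> 0"
  shows "(\<Sum>i\<in>UNIV. (((m' - m / norm x) / (norm x)\<^sup>2 * (x \<bullet> axis i 1)) *\<^sub>R x + (m / norm x) *\<^sub>R axis i 1) $ i)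
     = m' + (real CARD('n) - 1) * (m / norm x)"
proof -
  have n: "(\<Sum>i\<in>UNIV. x $ i * x $ i) = (norm x)\<^sup>2"
    by (simp add: power2_norm_eq_inner inner_vec_def)
  have "(\<Sum>i\<in>UNIV. (((m' - m / norm x) / (norm x)\<^sup>2 * (x \<bullet> axis i 1)) *\<^sub>R x + (m / norm x) *\<^sub>R axis i 1) $ i)
    = (m' - m / norm x) / (norm x)\<^sup>2 * (\<Sum>i\<in>UNIV. x $ i * x $ i) + real CARD('n) * (m / norm x)"
    by (simp add: inner_axis sum.distrib sum_distrib_left mult.assoc)
  also have "\<dots> = m' + (real CARD('n) - 1) * (m / norm x)"
  proof -
    have "(m' - m / norm x) / (norm x)\<^sup>2 * (norm x)\<^sup>2 = m' - m / norm x" using assms by simp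
    then show ?thesis unfolding n by (simp add: algebra_simps)
  qed
  finally show ?thesis .
qed

lemma has_divergence_radial_field:
  fixes x :: "real^'n"
  assumes m: "(m has_real_derivative m') (at (norm x))" and x: "x \<noteq> 0"
  shows "has_divergence (radial_field m) d x \<longleftrightarrow> d = m' + (real CARD('n) - 1) * (m (norm x) / norm x)"
proof
  note D = has_derivative_radial_field[OF m x]
  show "d = m' + (real CARD('n) - 1) * (m (norm x) / norm x)" if "has_divergence (radial_field m) d x"
  proof -
    obtain D' where D': "(radial_field m has_derivative D') (at x)" "d = (\<Sum>i\<in>UNIV. D' (axis i 1) $ i)"
      using \<open>has_divergence (radial_field m) d x\<close> by (auto simp: has_divergence_def)
    show ?thesis unfolding D'(2) has_derivative_unique[OF D'(1) D] by (rule trace_radial_derivative[OF x])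
  qed
  show "has_divergence (radial_field m) d x" if "d = m' + (real CARD('n) - 1) * (m (norm x) / norm x)"
    unfolding has_divergence_def that
    by (intro exI conjI, rule D, rule trace_radial_derivative[OF x, symmetric])
qed

section \<open>The radial equation\<close>

definition flux :: "real \<Rightarrow> real \<Rightarrow> real \<Rightarrow> real" where
  "flux p k s = (s\<^sup>2 + k) powr ((p - 2) / 2) * s"

lemma flux_0 [simp]: "flux p k 0 = 0"
  by (simp add: flux_def)

lemma flux_minus: "flux p k (- s) = - flux p k s"
  by (simp add: flux_def)

text \<open>At base 0 a real power is continuous only for a positive exponent, so either the base
  has to stay positive or p > 2.\<close>

lemma continuous_on_flux:
  assumes "k \<ge> 0" "p > 2 \<or> k > 0"
  shows "continuous_on S (flux p k)"
  unfolding flux_def[abs_def] using assms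
  by (intro continuous_intros continuous_on_powr') (auto simp: add_nonneg_eq_0_iff)

lemma DERIV_flux:
  assumes "s\<^sup>2 + k > 0"
  shows "(flux p k has_real_derivative (s\<^sup>2 + k) powr ((p - 2) / 2 - 1) * ((p - 1) * s\<^sup>2 + k)) (at s)"
proof -
  have "(flux p k has_real_derivative
      (s\<^sup>2 + k) powr ((p - 2) / 2) + (p - 2) / 2 * (s\<^sup>2 + k) powr ((p - 2) / 2 - 1) * (2 * s) * s) (at s)"
    unfolding flux_def[abs_def] using assms
    by (auto intro!: derivative_eq_intros DERIV_fun_powr simp: algebra_simps)
  moreover have "(s\<^sup>2 + k) powr ((p - 2) / 2) = (s\<^sup>2 + k) powr ((p - 2) / 2 - 1) * (s\<^sup>2 + k)"
    using assms powr_add[of "s\<^sup>2 + k" "(p - 2) / 2 - 1" 1] by simp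
  then have "(s\<^sup>2 + k) powr ((p - 2) / 2) + (p - 2) / 2 * (s\<^sup>2 + k) powr ((p - 2) / 2 - 1) * (2 * s) * s
     = (s\<^sup>2 + k) powr ((p - 2) / 2 - 1) * ((p - 1) * s\<^sup>2 + k)"
    by (simp only:) (simp add: field_simps power2_eq_square)
  ultimately show ?thesis by simp
qed

lemma DERIV_flux_pos:
  fixes s k p :: real
  assumes "s\<^sup>2 + k > 0" "p > 1" "k \<ge> 0"
  shows "(s\<^sup>2 + k) powr ((p - 2) / 2 - 1) * ((p - 1) * s\<^sup>2 + k) > 0"
proof -
  have "(p - 1) * s\<^sup>2 + k > 0"
  proof (cases "s = 0")
    case False
    then have "0 < (p - 1) * s\<^sup>2" using assms(2) by simp
    then show ?thesis using assms(3) by linarith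
  qed (use assms in simp)
  then show ?thesis using assms by simp
qed

lemma flux_strict_mono:
  assumes "p > 1" "k \<ge> 0" "p > 2 \<or> k > 0"
  shows "strict_mono (flux p k)"
proof (rule strict_monoI)
  have pos: "flux p k a < flux p k b" if ab: "0 \<le> a" "a < b" for a b
  proof (rule DERIV_pos_imp_increasing_open[OF ab(2)])
    show "\<exists>y. (flux p k has_real_derivative y) (at x) \<and> 0 < y" if "a < x" "x < b" for x
    proof -
      have "x\<^sup>2 + k > 0" using that ab assms by (auto intro!: add_pos_nonneg)
      then show ?thesis using DERIV_flux DERIV_flux_pos assms by blast
    qed
    show "continuous_on {a..b} (flux p k)" by (rule continuous_on_flux) (use assms in auto)
  qed
  fix a b :: real assume ab: "a < b"
  consider "0 \<le> a" | "b \<le> 0" | "a < 0" "0 < b" by linarith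
  then show "flux p k a < flux p k b"
  proof cases
    case 1 then show ?thesis using pos ab by blast
  next
    case 2 then show ?thesis using pos[of "- b" "- a"] ab by (simp add: flux_minus)
  next
    case 3 then show ?thesis using pos[of 0 "- a"] pos[of 0 b] by (simp add: flux_minus)
  qed
qed

text \<open>For s \<ge> sqrt k the base lies between \<open>s\<^sup>2\<close> and
  \<open>2 * s\<^sup>2\<close>, so the flux is at least a positive multiple of s powr (p - 1), which
  is unbounded. The intermediate value theorem and oddness do the rest.\<close>

lemma flux_surj:
  assumes p: "p > 1" and k: "k \<ge> 0" "p > 2 \<or> k > 0"
  shows "surj (flux p k)"
proof -
  have nonneg: "\<exists>s. flux p k s = y" if y: "y \<ge> 0" for y
  proof -
    define c where "c = (p - 2) / 2"
    \<comment> \<open>The exponent \<open>c\<close> may have either sign: the base is compared with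
      \<open>s\<^sup>2\<close> for \<open>c \<ge> 0\<close> and with \<open>2 * s\<^sup>2\<close>
      for \<open>c < 0\<close>.\<close>
    define K where "K = min 1 (2 powr c)"
    have K: "K > 0" by (simp add: K_def)
    \<comment> \<open>The three summands provide positivity, \<open>k \<le> s\<^sup>2\<close> and
      \<open>y \<le> K * s powr (p - 1)\<close> respectively.\<close>
    define s where "s = 1 + sqrt k + (y / K) powr (1 / (p - 1))"
    have s: "s > 0" "s \<ge> sqrt k" "s \<ge> (y / K) powr (1 / (p - 1))"
      using k by (auto simp: s_def intro!: add_pos_nonneg)
    have ks: "k \<le> s\<^sup>2" using s(2) k by (metis real_sqrt_le_iff real_sqrt_abs abs_of_pos s(1))
    have "y / K = ((y / K) powr (1 / (p - 1))) powr (p - 1)"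
      using y K p by (simp add: powr_powr)
    also have "\<dots> \<le> s powr (p - 1)" using s p by (intro powr_mono2) auto
    finally have 1: "y \<le> K * s powr (p - 1)" using K by (simp add: field_simps)
    have s2: "(s\<^sup>2) powr c * s = s powr (p - 1)"
    proof -
      have "(s\<^sup>2) powr c * s = s powr (2 * c) * s powr 1" using s powr_powr[of s 2 c] by simp
      also have "2 * c = p - 2" by (simp add: c_def)
      then have "s powr (2 * c) * s powr 1 = s powr (p - 1)" by (simp only: powr_add[symmetric]) simp
      finally show ?thesis .
    qed
    have "K * (s\<^sup>2) powr c \<le> (s\<^sup>2 + k) powr c"
    proof (cases "c \<ge> 0")
      case True
      have "K * (s\<^sup>2) powr c \<le> 1 * (s\<^sup>2) powr c" by (intro mult_right_mono) (auto simp: K_def)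
      also have "\<dots> \<le> (s\<^sup>2 + k) powr c" using True k by (auto intro!: powr_mono2)
      finally show ?thesis .
    next
      case False
      have "K * (s\<^sup>2) powr c \<le> 2 powr c * (s\<^sup>2) powr c" by (intro mult_right_mono) (auto simp: K_def)
      also have "\<dots> = (2 * s\<^sup>2) powr c" using s by (simp add: powr_mult)
      also have "\<dots> \<le> (s\<^sup>2 + k) powr c"
        using False k ks s by (intro powr_mono2') (auto intro!: add_pos_nonneg)
      finally show ?thesis .
    qed
    then have "K * (s\<^sup>2) powr c * s \<le> flux p k s"
      unfolding flux_def c_def[symmetric] using s by (intro mult_right_mono) auto
    then have "y \<le> flux p k s" using 1 by (simp add: mult.assoc s2)
    moreover have "continuous_on {0..s} (flux p k)" by (rule continuous_on_flux) (use k in auto)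
    ultimately have "\<exists>x. 0 \<le> x \<and> x \<le> s \<and> flux p k x = y" using s y by (intro IVT') auto
    then show ?thesis by blast
  qed
  have "\<exists>s. flux p k s = y" for y
    using nonneg[of y] nonneg[of "- y"] flux_minus[of p k]
    by (cases "y \<ge> 0") (auto, metis minus_minus)
  then show ?thesis by (metis surj_def)
qed

definition flux_inv :: "real \<Rightarrow> real \<Rightarrow> real \<Rightarrow> real" where
  "flux_inv p k = inv (flux p k)"

context
  fixes p k :: real
  assumes pk: "p > 1" "k \<ge> 0" "p > 2 \<or> k > 0"
begin

lemma flux_flux_inv: "flux p k (flux_inv p k y) = y"
  unfolding flux_inv_def by (rule surj_f_inv_f[OF flux_surj[OF pk]])

lemma flux_inv_flux: "flux_inv p k (flux p k s) = s"
  unfolding flux_inv_def by (rule inv_f_f[OF strict_mono_imp_inj_on[OF flux_strict_mono[OF pk]]])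

lemma flux_inv_nonneg: "y \<ge> 0 \<Longrightarrow> flux_inv p k y \<ge> 0"
  using strict_mono_less_eq[OF flux_strict_mono[OF pk], of 0 "flux_inv p k y"] flux_flux_inv by simp

lemma flux_inv_nonpos: "y \<le> 0 \<Longrightarrow> flux_inv p k y \<le> 0"
  using strict_mono_less_eq[OF flux_strict_mono[OF pk], of "flux_inv p k y" 0] flux_flux_inv by simp

lemma isCont_flux_inv: "isCont (flux_inv p k) y"
proof -
  have "isCont (flux_inv p k) (flux p k (flux_inv p k y))"
  proof (rule isCont_inverse_function[OF zero_less_one, where f="flux p k" and g="flux_inv p k"])
    show "isCont (flux p k) z" for z
      using continuous_on_flux[OF pk(2,3), of UNIV] by (simp add: continuous_on_eq_continuous_at)
  qed (rule flux_inv_flux)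
  then show ?thesis by (simp add: flux_flux_inv)
qed

lemma continuous_on_flux_inv: "continuous_on S (flux_inv p k)"
  by (intro continuous_at_imp_continuous_on ballI isCont_flux_inv)

text \<open>The hypothesis excludes slope 0 with k = 0, where the derivative of the flux vanishes
  and its inverse is infinitely steep.\<close>

lemma DERIV_flux_inv:
  assumes "(flux_inv p k y)\<^sup>2 + k > 0"
  shows "\<exists>d. (flux_inv p k has_real_derivative d) (at y)"
proof -
  have "(flux_inv p k has_real_derivative inverse
     (((flux_inv p k y)\<^sup>2 + k) powr ((p - 2) / 2 - 1) * ((p - 1) * (flux_inv p k y)\<^sup>2 + k))) (at y)"
    by (rule DERIV_inverse_function[where f="flux p k" and g="flux_inv p k" and x=y and a="y - 1" and b="y + 1"])
       (use DERIV_flux[OF assms] DERIV_flux_pos[OF assms pk(1,2)] flux_flux_inv isCont_flux_inv in auto)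
  then show ?thesis by blast
qed

end

section \<open>The boundary value problem for the radial profile\<close>

lemma antiderivative_on_UNIV:
  fixes f :: "real \<Rightarrow> real"
  assumes "continuous_on UNIV f"
  obtains F where "\<And>x. (F has_real_derivative f x) (at x)"
proof -
  have "\<exists>F. \<forall>x::real. - \<infinity> < ereal x \<longrightarrow> ereal x < \<infinity> \<longrightarrow> (F has_vector_derivative f x) (at x)"
    by (rule einterval_antiderivative) (use assms in \<open>auto simp: continuous_on_eq_continuous_at\<close>)
  then show ?thesis using that by (auto simp: has_real_derivative_iff_has_vector_derivative)
qed

text \<open>Clamping the radius turns profiles on \<open>{R1..R2}\<close> into continuous functions on the whole line, so
  that the solution is \<open>C\<^sup>1\<close> across the boundary of the annulus.\<close>

definition clamp_to :: "real \<Rightarrow> real \<Rightarrow> real \<Rightarrow> real" where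
  "clamp_to a b r = max a (min b r)"

lemma clamp_to_eq [simp]: "a \<le> r \<Longrightarrow> r \<le> b \<Longrightarrow> clamp_to a b r = r"
  by (simp add: clamp_to_def)

lemma clamp_to_in: "a \<le> b \<Longrightarrow> clamp_to a b r \<in> {a..b}"
  by (auto simp: clamp_to_def)

lemma continuous_on_clamp_to: "continuous_on S (clamp_to a b)"
  unfolding clamp_to_def[abs_def] by (intro continuous_intros)

text \<open>The flux \<open>m\<close> is found first, because it obeys a linear equation with one
  free constant \<open>C\<close>; \<open>w\<close> is its image under the inverse flux.
  \<open>J C\<close>, the integral of \<open>w\<close>, has to vanish for \<open>U\<close> to meet
  both boundary values. \<open>N\<close> stands for n - 1.\<close>

lemma radial_ode_exists:
  assumes pk: "p > 1" "k \<ge> 0" "p > 2 \<or> k > 0" and R: "0 < R1" "R1 < R2"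
    and h: "continuous_on {R1..R2} h"
  obtains U w m B where "continuous_on UNIV w" "continuous_on UNIV m"
    "\<And>r. (U has_real_derivative w r) (at r)" "U R1 = 0" "U R2 = 0"
    "\<And>r. flux p k (w r) = m r" "\<And>r. \<bar>w r\<bar> \<le> B"
    "\<And>r. R1 < r \<Longrightarrow> r < R2 \<Longrightarrow> (m has_real_derivative - h r - real N * (m r / r)) (at r)"
    "\<And>r. R1 < r \<Longrightarrow> r < R2 \<Longrightarrow> (w r)\<^sup>2 + k > 0 \<Longrightarrow> \<exists>d. (w has_real_derivative d) (at r)"
proof -
  define cl where "cl = clamp_to R1 R2"
  have cl: "cl r \<in> {R1..R2}" "cl r > 0" for r
    using clamp_to_in[of R1 R2 r] R by (auto simp: cl_def)
  have cl_id: "cl r = r" if "r \<in> {R1..R2}" for r using that by (simp add: cl_def)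
  have ccl: "continuous_on S cl" for S unfolding cl_def by (rule continuous_on_clamp_to)
  have "continuous_on UNIV (\<lambda>r. h (cl r) * cl r ^ N)"
    by (intro continuous_intros ccl continuous_on_compose2[OF h ccl]) (use cl in auto)
  then obtain F where F: "\<And>r. (F has_real_derivative h (cl r) * cl r ^ N) (at r)"
    using antiderivative_on_UNIV by blast
  have cF: "continuous_on S F" for S
    by (intro continuous_at_imp_continuous_on ballI DERIV_isCont[OF F])
  \<comment> \<open>The equation says that \<open>r ^ N * m r + F r\<close> is constant between the
    radii; \<open>C\<close> is this constant.\<close>
  define m where "m C r = (C - F (cl r)) / cl r ^ N" for C r
  have cm: "continuous_on S (\<lambda>(C, r). flux_inv p k (m C r))" for S
    unfolding m_def split_def
    by (intro continuous_on_compose2[OF continuous_on_flux_inv[OF pk, of UNIV]] continuous_intros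
        continuous_on_compose2[OF cF[of UNIV]] continuous_on_compose2[OF ccl[of UNIV]])
       (use cl in \<open>auto simp: less_imp_neq[symmetric]\<close>)
  define J where "J C = integral (cbox R1 R2) (\<lambda>r. flux_inv p k (m C r))" for C
  have cJ: "continuous_on UNIV J"
    unfolding J_def by (rule integral_continuous_on_param) (use cm in simp)
  have cmC: "continuous_on S (\<lambda>r. flux_inv p k (m C r))" for S C
    using continuous_on_compose2[OF cm[of UNIV] continuous_on_Pair[OF continuous_on_const[of S C] continuous_on_id]]
    by simp
  have int: "(\<lambda>r. flux_inv p k (m C r)) integrable_on cbox R1 R2" for C
    by (rule integrable_continuous[OF cmC])
  \<comment> \<open>With \<open>C\<close> the minimum of \<open>F\<close> the flux, hence the slope,
    is nowhere positive, and with the maximum nowhere negative; so \<open>J\<close> changes sign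
    between the two.\<close>
  obtain r1 where r1: "r1 \<in> {R1..R2}" "\<And>r. r \<in> {R1..R2} \<Longrightarrow> F r1 \<le> F r"
    using continuous_attains_inf[of "{R1..R2}" F] cF R by auto
  obtain r2 where r2: "r2 \<in> {R1..R2}" "\<And>r. r \<in> {R1..R2} \<Longrightarrow> F r \<le> F r2"
    using continuous_attains_sup[of "{R1..R2}" F] cF R by auto
  have J1: "J (F r1) \<le> 0"
  proof -
    have "J (F r1) \<le> integral (cbox R1 R2) (\<lambda>r. 0)"
      unfolding J_def m_def using r1(2)[OF cl(1)] cl(2)
      by (intro integral_le int[unfolded m_def] flux_inv_nonpos[OF pk] divide_nonpos_nonneg)
         (auto simp: less_imp_le)
    then show ?thesis by simp
  qed
  have J2: "J (F r2) \<ge> 0"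
    unfolding J_def m_def using r2(2)[OF cl(1)] cl(2)
    by (intro integral_nonneg int[unfolded m_def] flux_inv_nonneg[OF pk] divide_nonneg_nonneg)
       (auto simp: less_imp_le)
  have "\<exists>C. F r1 \<le> C \<and> C \<le> F r2 \<and> J C = 0"
    by (rule IVT') (use J1 J2 r1 r2 cJ in \<open>auto intro: continuous_on_subset\<close>)
  then obtain C where C: "J C = 0" by blast
  define w where "w r = flux_inv p k (m C r)" for r
  have cw: "continuous_on S w" for S unfolding w_def[abs_def] by (rule cmC)
  obtain U0 where U0: "\<And>r. (U0 has_real_derivative w r) (at r)"
    using antiderivative_on_UNIV[OF cw] by blast
  have "(w has_integral (U0 R2 - U0 R1)) {R1..R2}"
    using R U0 by (intro fundamental_theorem_of_calculus)
      (auto simp: has_real_derivative_iff_has_vector_derivative[symmetric] intro: has_field_derivative_at_within)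
  then have U0e: "U0 R2 = U0 R1" using C by (simp add: J_def w_def[abs_def] integral_unique)
  have fm: "flux p k (w r) = m C r" for r by (simp add: w_def flux_flux_inv[OF pk])
  have "bounded (w ` {R1..R2})"
    by (intro compact_imp_bounded compact_continuous_image cw) auto
  then obtain B where "\<forall>r\<in>{R1..R2}. \<bar>w r\<bar> \<le> B" by (auto simp: bounded_iff)
  then have B: "\<bar>w r\<bar> \<le> B" if "r \<in> {R1..R2}" for r using that by blast
  \<comment> \<open>\<open>w\<close> sees \<open>r\<close> only through the clamp, so the bound on
    the compact interval is global.\<close>
  have w_cl: "w r = w (cl r)" for r
    using cl[of r] by (simp add: w_def m_def cl_id)
  have dm: "(m C has_real_derivative - h r - real N * (m C r / r)) (at r)" if r: "R1 < r" "r < R2" for r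
  proof -
    have "((\<lambda>r. (C - F r) / r ^ N) has_real_derivative - h r - real N * (m C r / r)) (at r)"
    proof -
      have r0: "r > 0" using r R by simp
      have "((\<lambda>r. (C - F r) / r ^ N) has_real_derivative
         ((0 - h (cl r) * cl r ^ N) * r ^ N - (C - F r) * (real N * r ^ (N - 1))) / (r ^ N * r ^ N)) (at r)"
        using r0 by (auto intro!: derivative_eq_intros F)
      moreover have "((0 - h (cl r) * cl r ^ N) * r ^ N - (C - F r) * (real N * r ^ (N - 1))) / (r ^ N * r ^ N)
          = - h r - real N * (m C r / r)"
        using r r0 by (cases N) (auto simp: m_def cl_id field_simps)
      ultimately show ?thesis by simp
    qed
    then show ?thesis
      by (rule has_field_derivative_transform_within_open[of _ _ _ "{R1<..<R2}"])
         (use r in \<open>auto simp: m_def cl_id\<close>)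
  qed
  show ?thesis
  proof (rule that[of w "m C" "\<lambda>r. U0 r - U0 R1" B])
    show "continuous_on UNIV (m C)"
      unfolding m_def using cl
      by (intro continuous_intros continuous_on_compose2[OF cF[of UNIV]] ccl) (auto simp: less_imp_neq[symmetric])
    show "((\<lambda>r. U0 r - U0 R1) has_real_derivative w r) (at r)" for r
      by (auto intro!: derivative_eq_intros U0)
    show "\<bar>w r\<bar> \<le> B" for r using B[OF cl(1)] w_cl[of r] by simp
    show "\<exists>d. (w has_real_derivative d) (at r)" if r: "R1 < r" "r < R2" and p: "(w r)\<^sup>2 + k > 0" for r
    proof -
      obtain d where "(flux_inv p k has_real_derivative d) (at (m C r))"
        using DERIV_flux_inv[OF pk, of "m C r"] p by (auto simp: w_def)
      from DERIV_chain2[OF this dm[OF r]] show ?thesis unfolding w_def[abs_def] by blast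
    qed
  qed (use cw U0e fm dm in auto)
qed

text \<open>\<open>g\<close> is the difference of the two constants of integration. Equal boundary
  values force the slopes to agree at some interior radius, where \<open>g\<close> is 0; being
  constant it is 0 throughout, and injectivity of the flux gives equal slopes everywhere
  inside.\<close>

lemma radial_ode_unique:
  assumes pk: "p > 1" "k \<ge> 0" "p > 2 \<or> k > 0" and R: "0 < R1" "R1 < R2"
    and c: "continuous_on {R1..R2} V1" "continuous_on {R1..R2} V2"
    and 0: "V1 R1 = 0" "V1 R2 = 0" "V2 R1 = 0" "V2 R2 = 0"
    and d: "\<And>r. R1 < r \<Longrightarrow> r < R2 \<Longrightarrow> (V1 has_real_derivative v1 r) (at r)"
      "\<And>r. R1 < r \<Longrightarrow> r < R2 \<Longrightarrow> (V2 has_real_derivative v2 r) (at r)"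
    and m: "\<And>r. R1 < r \<Longrightarrow> r < R2 \<Longrightarrow>
        ((\<lambda>r. flux p k (v1 r)) has_real_derivative - h r - real N * (flux p k (v1 r) / r)) (at r)"
      "\<And>r. R1 < r \<Longrightarrow> r < R2 \<Longrightarrow>
        ((\<lambda>r. flux p k (v2 r)) has_real_derivative - h r - real N * (flux p k (v2 r) / r)) (at r)"
    and r: "R1 \<le> r" "r \<le> R2"
  shows "V1 r = V2 r"
proof -
  define g where "g r = r ^ N * (flux p k (v1 r) - flux p k (v2 r))" for r
  have "(g has_real_derivative 0) (at r)" if r: "R1 < r" "r < R2" for r
  proof -
    let ?a = "flux p k (v1 r)" and ?b = "flux p k (v2 r)"
    have r0: "r > 0" using r R by simp
    have "(g has_real_derivative real N * r ^ (N - 1) * (?a - ?b)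
      + r ^ N * ((- h r - real N * (?a / r)) - (- h r - real N * (?b / r)))) (at r)"
      unfolding g_def[abs_def] by (auto intro!: derivative_eq_intros m r)
    moreover have "real N * r ^ (N - 1) * (?a - ?b)
      + r ^ N * ((- h r - real N * (?a / r)) - (- h r - real N * (?b / r))) = 0"
      using r0 by (cases N) (auto simp: field_simps)
    ultimately show ?thesis by simp
  qed
  then have "\<exists>D. \<forall>r\<in>{R1<..<R2}. g r = D"
    by (intro has_field_derivative_zero_constant) (auto intro: has_field_derivative_at_within)
  then obtain D where D: "\<And>r. R1 < r \<Longrightarrow> r < R2 \<Longrightarrow> g r = D" by auto
  have cd: "continuous_on {R1..R2} (\<lambda>r. V1 r - V2 r)" by (intro continuous_intros c)
  have dd: "((\<lambda>r. V1 r - V2 r) has_real_derivative v1 r - v2 r) (at r)" if "R1 < r" "r < R2" for r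
    using that by (auto intro!: derivative_eq_intros d)
  obtain l z where z: "R1 < z" "z < R2" "((\<lambda>r. V1 r - V2 r) has_real_derivative l) (at z)"
    "(V1 R2 - V2 R2) - (V1 R1 - V2 R1) = (R2 - R1) * l"
    using MVT[OF R(2) cd] dd by (auto simp: real_differentiable_def)
  have "l = 0" using z(4) 0 R by simp
  with DERIV_unique[OF z(3) dd[OF z(1,2)]] have "v1 z = v2 z" by simp
  then have D0: "D = 0" using D[OF z(1,2)] by (simp add: g_def)
  have "v1 r = v2 r" if r: "R1 < r" "r < R2" for r
  proof -
    have "flux p k (v1 r) = flux p k (v2 r)" using D[OF r] D0 r R by (simp add: g_def)
    then show ?thesis
      using strict_mono_eq[OF flux_strict_mono[OF pk]] by blast
  qed
  then have "((\<lambda>r. V1 r - V2 r) has_real_derivative 0) (at r)" if "R1 < r" "r < R2" for r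
    using dd[OF that] that by simp
  from DERIV_isconst2[OF R(2) cd this r] show ?thesis using 0 by simp
qed

section \<open>The radial solution\<close>

lemma mem_annulus: "0 < R1 \<Longrightarrow> x \<in> annulus R1 R2 \<longleftrightarrow> R1 < norm x \<and> norm x < R2"
  by (simp add: annulus_eq)

lemma mem_closure_annulus:
  "0 < R1 \<Longrightarrow> R1 < R2 \<Longrightarrow> x \<in> closure (annulus R1 R2) \<longleftrightarrow> R1 \<le> norm x \<and> norm x \<le> R2"
  by (simp add: closure_annulus)

lemma annulus_sets_lebesgue: "annulus R1 R2 \<in> sets lebesgue"
  by (rule sets_completionI_sets) (simp add: borel_open open_annulus)

lemma closure_annulus_nonzero: "0 < R1 \<Longrightarrow> R1 < R2 \<Longrightarrow> x \<in> closure (annulus R1 R2) \<Longrightarrow> x \<noteq> 0"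
  by (auto simp: mem_closure_annulus)

lemma annulus_nonzero: "0 < R1 \<Longrightarrow> x \<in> annulus R1 R2 \<Longrightarrow> x \<noteq> 0"
  by (auto simp: mem_annulus)

lemma grad_annulus_interior:
  fixes x :: "real^'n"
  assumes R: "0 < R1" "R1 < R2" and x: "x \<in> annulus R1 R2"
    and g: "(u has_derivative (\<lambda>h. g \<bullet> h)) (at x)"
  shows "grad (closure (annulus R1 R2)) u x = g"
  by (rule grad_closed_annulus[OF R])
     (use x closure_subset in \<open>auto intro: has_derivative_at_withinI[OF g]\<close>)

lemma flux_radial_field:
  "x \<noteq> 0 \<Longrightarrow> (Phi p \<epsilon> (radial_field w x) powr ((p - 2) / 2)) *\<^sub>R radial_field w x
    = radial_field (\<lambda>r. flux p (chi p * \<epsilon>\<^sup>2) (w r)) x"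
  by (simp add: Phi_def norm_radial_field flux_def radial_field_def)

section \<open>Profiles of arbitrary radial solutions\<close>

locale annulus_problem =
  fixes p \<epsilon> R1 R2 :: real and f :: "real^'n \<Rightarrow> real" and h :: "real \<Rightarrow> real"
  assumes p: "p > 1" "p \<noteq> 2" and \<epsilon>: "\<epsilon> > 0" and R: "0 < R1" "R1 < R2"
    and f_cont: "continuous_on (closure (annulus R1 R2)) f"
    and f_h: "\<And>x. x \<in> closure (annulus R1 R2) \<Longrightarrow> f x = h (norm x)"
begin

abbreviation "\<Omega> \<equiv> annulus R1 R2 :: (real^'n) set"
abbreviation "k \<equiv> chi p * \<epsilon>\<^sup>2"

lemma k: "k \<ge> 0" "p > 2 \<or> k > 0"
  using p \<epsilon> by (auto simp: chi_def)

lemmas pk = p(1) k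

lemma N: "real (CARD('n) - 1) = real CARD('n) - 1"
  by (simp add: of_nat_diff Suc_leI)

text \<open>An arbitrary unit vector: radial functions are read off along the ray through
  it.\<close>

definition e0 :: "real^'n" where "e0 = axis (SOME i. True) 1"

lemma norm_e0 [simp]: "norm e0 = 1"
  by (simp add: e0_def)

lemma e0_e0 [simp]: "e0 \<bullet> e0 = 1"
  by (simp add: dot_square_norm)

lemma ray_in: "r \<in> {R1..R2} \<Longrightarrow> r *\<^sub>R e0 \<in> closure \<Omega>" "R1 < r \<Longrightarrow> r < R2 \<Longrightarrow> r *\<^sub>R e0 \<in> \<Omega>"
  using R by (auto simp: mem_closure_annulus mem_annulus)

lemma continuous_on_h: "continuous_on {R1..R2} h"
proof -
  have "continuous_on {R1..R2} (\<lambda>r. f (r *\<^sub>R e0))"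
    by (intro continuous_on_compose2[OF f_cont] continuous_intros) (use ray_in in auto)
  then show ?thesis
    by (rule continuous_on_cong[THEN iffD1, rotated -1]) (use R f_h[OF ray_in(1)] in auto)
qed

text \<open>Serves uniqueness, where a competitor is only differentiable with differentiable flux.
  That \<open>flux p k (deriv V r)\<close> is differentiable is recovered from the radial component
  of \<open>theta\<close> along a ray, without a second derivative of \<open>V\<close>; the
  divergence formula for radial fields then gives the ordinary differential equation.\<close>

lemma radial_solution_profile:
  assumes v: "radial_solution p \<epsilon> \<Omega> f v"
  defines "V \<equiv> \<lambda>r. v (r *\<^sub>R e0)"
  shows "continuous_on {R1..R2} V" "V R1 = 0" "V R2 = 0"
    and "x \<in> closure \<Omega> \<Longrightarrow> v x = V (norm x)"
    and "R1 < r \<Longrightarrow> r < R2 \<Longrightarrow> (V has_real_derivative deriv V r) (at r)"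
    and "R1 < r \<Longrightarrow> r < R2 \<Longrightarrow> ((\<lambda>r. flux p k (deriv V r)) has_real_derivative
          - h r - real (CARD('n) - 1) * (flux p k (deriv V r) / r)) (at r)"
proof -
  have vc: "continuous_on (closure \<Omega>) v" and vr: "radial_on (closure \<Omega>) v"
    and vd: "\<And>x. x \<in> \<Omega> \<Longrightarrow> v differentiable (at x)"
    and vdiv: "\<And>x. x \<in> \<Omega> \<Longrightarrow> \<exists>d. has_divergence (theta p \<epsilon> \<Omega> v) d x \<and> d + f x = 0"
    and v0: "\<And>x. x \<in> frontier \<Omega> \<Longrightarrow> v x = 0"
    using v by (auto simp: radial_solution_def)
  show "continuous_on {R1..R2} V" unfolding V_def
    by (intro continuous_on_compose2[OF vc] continuous_intros) (use ray_in in auto)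
  show "V R1 = 0" "V R2 = 0" unfolding V_def using R by (auto intro!: v0 simp: frontier_annulus)
  show vV: "v x = V (norm x)" if "x \<in> closure \<Omega>" for x
  proof -
    have "norm x *\<^sub>R e0 \<in> closure \<Omega>" by (rule ray_in(1)) (use that R in \<open>simp add: mem_closure_annulus\<close>)
    moreover have "norm x = norm (norm x *\<^sub>R e0)" by simp
    ultimately show ?thesis using vr[unfolded radial_on_def, rule_format, OF that] by (simp add: V_def)
  qed
  show dV: "(V has_real_derivative deriv V r) (at r)" if r: "R1 < r" "r < R2" for r
  proof -
    obtain D where D: "(v has_derivative D) (at (r *\<^sub>R e0))"
      using vd[OF ray_in(2)[OF r]] by (auto simp: differentiable_def)
    interpret D: bounded_linear D using D by (rule has_derivative_bounded_linear)
    have "((\<lambda>r. r *\<^sub>R e0) has_derivative (\<lambda>r. r *\<^sub>R e0)) (at r)"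
      by (auto intro!: derivative_eq_intros)
    from has_derivative_compose[OF this D] have V': "(V has_real_derivative D e0) (at r)"
      unfolding V_def by (simp add: has_field_derivative_def D.scaleR mult_commute_abs)
    then show ?thesis using DERIV_imp_deriv[OF V'] by simp
  qed
  define M where "M r = flux p k (deriv V r)" for r
  have th: "theta p \<epsilon> \<Omega> v x = radial_field M x" if x: "x \<in> \<Omega>" for x
  proof -
    have x0: "x \<noteq> 0" and xn: "R1 < norm x" "norm x < R2" using x R by (auto simp: mem_annulus)
    have "((\<lambda>y. V (norm y)) has_derivative (\<lambda>h. radial_field (deriv V) x \<bullet> h)) (at x)"
      using has_derivative_radial[OF dV[OF xn] x0] by (simp add: radial_field_def)
    then have "(v has_derivative (\<lambda>h. radial_field (deriv V) x \<bullet> h)) (at x)"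
      by (rule has_derivative_transform_within_open[OF _ open_annulus x])
         (rule vV[symmetric], rule subsetD[OF closure_subset])
    from grad_annulus_interior[OF R x this] show ?thesis
      unfolding theta_def M_def[abs_def] by (simp only: flux_radial_field[OF x0])
  qed
  show "((\<lambda>r. flux p k (deriv V r)) has_real_derivative - h r - real (CARD('n) - 1) * (flux p k (deriv V r) / r)) (at r)"
    if r: "R1 < r" "r < R2" for r
  proof -
    define x where "x = r *\<^sub>R e0"
    have x: "x \<in> \<Omega>" "norm x = r" using ray_in(2)[OF r] r R by (auto simp: x_def)
    have x0: "x \<noteq> 0" using annulus_nonzero[OF R(1) x(1)] .
    obtain d where d: "has_divergence (theta p \<epsilon> \<Omega> v) d x" "d + f x = 0" using vdiv[OF x(1)] by blast
    then obtain D where D: "(theta p \<epsilon> \<Omega> v has_derivative D) (at x)" "d = (\<Sum>i\<in>UNIV. D (axis i 1) $ i)"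
      by (auto simp: has_divergence_def)
    have D': "(radial_field M has_derivative D) (at x)"
      by (rule has_derivative_transform_within_open[OF D(1) open_annulus x(1)]) (rule th)
    interpret D: bounded_linear D using D' by (rule has_derivative_bounded_linear)
    have "((\<lambda>r. r *\<^sub>R e0) has_derivative (\<lambda>r. r *\<^sub>R e0)) (at r)"
      by (auto intro!: derivative_eq_intros)
    from has_derivative_compose[OF this D'[unfolded x_def]]
    have "((\<lambda>r. radial_field M (r *\<^sub>R e0) \<bullet> e0) has_derivative (\<lambda>r. D (r *\<^sub>R e0) \<bullet> e0)) (at r)"
      by (rule has_derivative_inner_left)
    then have "((\<lambda>r. radial_field M (r *\<^sub>R e0) \<bullet> e0) has_real_derivative D e0 \<bullet> e0) (at r)"
      by (simp add: has_field_derivative_def D.scaleR mult_commute_abs)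
    \<comment> \<open>For \<open>r > 0\<close> the component of
      \<open>radial_field M (r *\<^sub>R e0)\<close> along \<open>e0\<close> is
      \<open>M r\<close>.\<close>
    then have M': "(M has_real_derivative D e0 \<bullet> e0) (at r)"
      by (rule has_field_derivative_transform_within_open[of _ _ _ "{0<..}"])
         (use r R in \<open>auto simp: radial_field_def\<close>)
    have "has_divergence (radial_field M) d x" using D' D(2) by (auto simp: has_divergence_def)
    then have "d = D e0 \<bullet> e0 + (real CARD('n) - 1) * (M r / r)"
      using has_divergence_radial_field[of M "D e0 \<bullet> e0" x d] M' x x0 by simp
    moreover have "f x = h r" using f_h[of x] closure_subset x by auto
    ultimately have "D e0 \<bullet> e0 = - h r - real (CARD('n) - 1) * (M r / r)" using d(2) by (simp only: N)
    with M' show ?thesis by (simp add: M_def[abs_def])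
  qed
qed

end

section \<open>The solution built from a profile\<close>

text \<open>Continuity, slope and bound refer to the whole line so that the solution has an ordinary
  derivative at boundary points too and is globally Lipschitz, as the discrete integration by parts
  requires.\<close>

locale annulus_solution = annulus_problem p \<epsilon> R1 R2 f h
  for p \<epsilon> R1 R2 and f :: "real^'n \<Rightarrow> real" and h +
  fixes U w m :: "real \<Rightarrow> real" and B :: real
  assumes w_cont: "continuous_on UNIV w" and m_cont: "continuous_on UNIV m"
    and U: "\<And>r. (U has_real_derivative w r) (at r)" and U0: "U R1 = 0" "U R2 = 0"
    and flux_w: "\<And>r. flux p (chi p * \<epsilon>\<^sup>2) (w r) = m r"
    and w_bound: "\<And>r. \<bar>w r\<bar> \<le> B"
    and m: "\<And>r. R1 < r \<Longrightarrow> r < R2 \<Longrightarrow> (m has_real_derivative - h r - real (CARD('n) - 1) * (m r / r)) (at r)"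
    and w_deriv: "\<And>r. R1 < r \<Longrightarrow> r < R2 \<Longrightarrow> (w r)\<^sup>2 + chi p * \<epsilon>\<^sup>2 > 0 \<Longrightarrow> \<exists>d. (w has_real_derivative d) (at r)"

lemma (in annulus_problem) solution_exists: "\<exists>U w m B. annulus_solution p \<epsilon> R1 R2 f h U w m B"
proof (rule radial_ode_exists[OF pk R continuous_on_h, of "CARD('n) - 1"])
  fix U w m B
  assume A: "continuous_on UNIV w" "continuous_on UNIV m"
    "\<And>r. (U has_real_derivative w r) (at r)" "U R1 = 0" "U R2 = 0"
    "\<And>r. flux p k (w r) = m r" "\<And>r. \<bar>w r\<bar> \<le> B"
    "\<And>r. R1 < r \<Longrightarrow> r < R2 \<Longrightarrow> (m has_real_derivative - h r - real (CARD('n) - 1) * (m r / r)) (at r)"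
    "\<And>r. R1 < r \<Longrightarrow> r < R2 \<Longrightarrow> (w r)\<^sup>2 + k > 0 \<Longrightarrow> \<exists>d. (w has_real_derivative d) (at r)"
  have "annulus_solution p \<epsilon> R1 R2 f h U w m B" by unfold_locales (fact A)+
  then show ?thesis by blast
qed

context annulus_solution
begin

definition u :: "real^'n \<Rightarrow> real" where "u x = U (norm x)"

abbreviation "H \<equiv> radial_field w :: real^'n \<Rightarrow> real^'n"
abbreviation "T \<equiv> radial_field m :: real^'n \<Rightarrow> real^'n"

lemma U_Lipschitz: "\<bar>U a - U b\<bar> \<le> B * \<bar>a - b\<bar>"
proof -
  have "norm (U a - U b) \<le> B * norm (a - b)"
    by (rule field_differentiable_bound[of UNIV U w]) (use U w_bound in auto)
  then show ?thesis by simp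
qed

lemma u_Lipschitz: "\<bar>u x - u y\<bar> \<le> B * norm (x - y)"
proof -
  have B: "B \<ge> 0" using w_bound[of 0] by simp
  have "\<bar>u x - u y\<bar> \<le> B * \<bar>norm x - norm y\<bar>" unfolding u_def by (rule U_Lipschitz)
  also have "\<dots> \<le> B * norm (x - y)" using B by (intro mult_left_mono norm_triangle_ineq3)
  finally show ?thesis .
qed

lemma continuous_on_u: "continuous_on S u"
  using u_Lipschitz by (rule continuous_on_Lipschitz_bound)

lemma u_deriv: "x \<noteq> 0 \<Longrightarrow> (u has_derivative (\<lambda>h. H x \<bullet> h)) (at x)"
  unfolding u_def[abs_def] using has_derivative_radial[OF U] by (simp add: radial_field_def)

lemma continuous_on_H: "0 \<notin> S \<Longrightarrow> continuous_on S H"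
  by (rule continuous_on_radial_field) (auto intro: continuous_on_subset[OF w_cont])

lemma continuous_on_T: "0 \<notin> S \<Longrightarrow> continuous_on S T"
  by (rule continuous_on_radial_field) (auto intro: continuous_on_subset[OF m_cont])

lemma H_measurable: "H \<in> borel_measurable borel" and T_measurable: "T \<in> borel_measurable borel"
proof -
  have [measurable]: "w \<in> borel_measurable borel" "m \<in> borel_measurable borel"
    using w_cont m_cont by (auto intro: borel_measurable_continuous_onI)
  show "H \<in> borel_measurable borel" "T \<in> borel_measurable borel"
    unfolding radial_field_def[abs_def] by measurable
qed

lemma norm_H_le: "norm (H x) \<le> B"
  using w_bound[of "norm x"] w_bound[of 0] by (cases "x = 0") (auto simp: norm_radial_field, simp add: radial_field_def)

lemma grad_u: "x \<in> closure \<Omega> \<Longrightarrow> grad (closure \<Omega>) u x = H x"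
  by (rule grad_closed_annulus[OF R])
     (auto intro: has_derivative_at_withinI u_deriv dest: closure_annulus_nonzero[OF R])

lemma theta_u: "x \<in> closure \<Omega> \<Longrightarrow> theta p \<epsilon> \<Omega> u x = T x"
  using closure_annulus_nonzero[OF R, of x]
  by (simp add: theta_def grad_u flux_radial_field flux_w)

lemma Phi_H: "x \<noteq> 0 \<Longrightarrow> Phi p \<epsilon> (H x) = (w (norm x))\<^sup>2 + k"
  by (simp add: Phi_def norm_radial_field)

lemma lam_u: "x \<in> closure \<Omega> \<Longrightarrow> lam p \<epsilon> \<Omega> u x = Phi p \<epsilon> (H x) powr ((p - 2) / 2)"
  by (simp add: lam_def zeta_bar_def grad_u)

lemma eta_u:
  assumes x: "x \<in> closure \<Omega>"
  shows "eta p \<epsilon> \<Omega> u x = H x"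
proof (cases "Phi p \<epsilon> (H x) = 0")
  \<comment> \<open>Here \<open>lam\<close> vanishes and division by it yields 0, but
    \<open>Phi p \<epsilon> (H x) = 0\<close> forces \<open>H x = 0\<close> as well.\<close>
  case True
  then have "norm (H x) = 0"
    using k by (auto simp: Phi_def add_nonneg_eq_0_iff)
  then show ?thesis using x by (simp add: eta_def theta_def grad_u)
next
  case False
  then show ?thesis using x by (simp add: eta_def theta_def lam_u grad_u)
qed

lemma T_has_divergence:
  assumes x: "x \<in> \<Omega>"
  shows "has_divergence T (- f x) x"
proof -
  have x0: "x \<noteq> 0" and xn: "R1 < norm x" "norm x < R2" using x R by (auto simp: mem_annulus)
  have "f x = h (norm x)" using f_h x closure_subset by blast
  then show ?thesis using has_divergence_radial_field[OF m[OF xn] x0] by (simp add: N)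
qed

lemma radial_solution_u: "radial_solution p \<epsilon> \<Omega> f u"
  unfolding radial_solution_def
proof (intro conjI ballI)
  show "continuous_on (closure \<Omega>) u" by (rule continuous_on_u)
  show "radial_on (closure \<Omega>) u" by (simp add: radial_on_def u_def)
  show "u x = 0" if "x \<in> frontier \<Omega>" for x
    using that U0 by (auto simp: frontier_annulus[OF R] u_def)
  fix x :: "real^'n" assume x: "x \<in> \<Omega>"
  have x0: "x \<noteq> 0" using x R(1) by (rule annulus_nonzero[rotated])
  show "u differentiable at x" using u_deriv[OF x0] by (rule differentiableI)
  obtain D where D: "(T has_derivative D) (at x)" "- f x = (\<Sum>i\<in>UNIV. D (axis i 1) $ i)"
    using T_has_divergence[OF x] by (auto simp: has_divergence_def)
  have "(theta p \<epsilon> \<Omega> u has_derivative D) (at x)"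
    by (rule has_derivative_transform_within_open[OF D(1) open_annulus x])
       (rule theta_u[symmetric], rule subsetD[OF closure_subset])
  then show "\<exists>d. has_divergence (theta p \<epsilon> \<Omega> u) d x \<and> d + f x = 0"
    using D(2) by (intro exI[of _ "- f x"]) (auto simp: has_divergence_def)
qed

lemma radial_solution_unique:
  assumes v: "radial_solution p \<epsilon> \<Omega> f v" and x: "x \<in> closure \<Omega>"
  shows "v x = u x"
proof -
  have n: "R1 \<le> norm x" "norm x \<le> R2" using x by (auto simp: mem_closure_annulus[OF R])
  have "(\<lambda>r. v (r *\<^sub>R e0)) (norm x) = (\<lambda>r. u (r *\<^sub>R e0)) (norm x)"
    by (rule radial_ode_unique[OF pk R radial_solution_profile(1)[OF v] radial_solution_profile(1)[OF radial_solution_u]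
        radial_solution_profile(2,3)[OF v] radial_solution_profile(2,3)[OF radial_solution_u]
        radial_solution_profile(5)[OF v] radial_solution_profile(5)[OF radial_solution_u]
        radial_solution_profile(6)[OF v] radial_solution_profile(6)[OF radial_solution_u] n])
  then show ?thesis
    using radial_solution_profile(4)[OF v x] radial_solution_profile(4)[OF radial_solution_u x] by simp
qed

lemma differentiable_on_u: "u differentiable_on closure \<Omega>"
  unfolding differentiable_on_def
  by (auto intro!: differentiable_at_withinI differentiableI[OF u_deriv] dest: closure_annulus_nonzero[OF R])

text \<open>The fundamental theorem of calculus along the path, off its finitely many break points.
  Since \<open>u\<close> has an ordinary derivative at boundary points, the path may touch or follow
  the boundary.\<close>

lemma line_integral_u:
  assumes \<gamma>: "valid_path \<gamma>" "path_image \<gamma> \<subseteq> closure \<Omega>" and x0: "pathstart \<gamma> \<in> frontier \<Omega>"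
  shows "has_line_integral (eta p \<epsilon> \<Omega> u) (u (pathfinish \<gamma>)) \<gamma>"
proof -
  have c: "continuous_on {0..1} \<gamma>"
    and "\<exists>S D. finite S \<and> (\<forall>t\<in>{0..1} - S. (\<gamma> has_vector_derivative D t) (at t))"
    using \<gamma>(1) unfolding valid_path_def piecewise_C1_differentiable_on_def C1_differentiable_on_def by blast+
  then obtain S D where S: "finite S" and D: "\<And>t. t \<in> {0..1} - S \<Longrightarrow> (\<gamma> has_vector_derivative D t) (at t)"
    by blast
  have in_cl: "\<gamma> t \<in> closure \<Omega>" if "t \<in> {0..1}" for t
    using that \<gamma>(2) by (auto simp: path_image_def)
  have "((\<lambda>t. eta p \<epsilon> \<Omega> u (\<gamma> t) \<bullet> vector_derivative \<gamma> (at t within {0..1})) has_integral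
     ((\<lambda>t. u (\<gamma> t)) 1 - (\<lambda>t. u (\<gamma> t)) 0)) {0..1}"
  proof (rule fundamental_theorem_of_calculus_interior_strong[OF S])
    show "continuous_on {0..1} (\<lambda>t. u (\<gamma> t))"
      by (rule continuous_on_compose2[OF continuous_on_u[of UNIV] c]) auto
    fix t assume t: "t \<in> {0<..<1} - S"
    then have Dt: "(\<gamma> has_vector_derivative D t) (at t)" using D by auto
    have cl: "\<gamma> t \<in> closure \<Omega>" using t in_cl by auto
    have "((\<lambda>t. u (\<gamma> t)) has_derivative (\<lambda>s. H (\<gamma> t) \<bullet> (s *\<^sub>R D t))) (at t)"
      by (rule has_derivative_compose[OF Dt[unfolded has_vector_derivative_def] u_deriv])
         (rule closure_annulus_nonzero[OF R cl])
    then have "((\<lambda>t. u (\<gamma> t)) has_vector_derivative (H (\<gamma> t) \<bullet> D t)) (at t)"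
      by (simp add: has_vector_derivative_def)
    moreover have "vector_derivative \<gamma> (at t within {0..1}) = D t"
      using t by (intro vector_derivative_at_within_ivl[OF Dt]) auto
    ultimately show "((\<lambda>t. u (\<gamma> t)) has_vector_derivative
        eta p \<epsilon> \<Omega> u (\<gamma> t) \<bullet> vector_derivative \<gamma> (at t within {0..1})) (at t)"
      by (simp add: eta_u[OF cl])
  qed simp
  moreover have "u (\<gamma> 0) = 0" using radial_solution_u x0 by (simp add: radial_solution_def pathstart_def)
  ultimately show ?thesis by (simp add: has_line_integral_def pathfinish_def)
qed

lemma locally_integrable_bounded:
  fixes g :: "real^'n \<Rightarrow> 'b::euclidean_space"
  assumes g: "g \<in> borel_measurable (lebesgue_on \<Omega>)" and M: "\<And>x. x \<in> \<Omega> \<Longrightarrow> norm (g x) \<le> M"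
  shows "locally_integrable \<Omega> g"
  unfolding locally_integrable_def
proof (intro allI impI)
  fix K :: "(real^'n) set" assume K: "compact K \<and> K \<subseteq> \<Omega>"
  then have "K \<in> lmeasurable" by (simp add: lmeasurable_compact)
  then interpret finite_measure "lebesgue_on K" by (rule finite_measure_lebesgue_on)
  show "integrable (lebesgue_on K) g"
  proof (rule integrable_const_bound[where B=M])
    show "AE x in lebesgue_on K. norm (g x) \<le> M" using K M by (intro AE_I2) auto
    show "g \<in> borel_measurable (lebesgue_on K)"
      by (rule measurable_restrict_mono[OF g]) (use K in auto)
  qed
qed

lemma lebesgue_on_measurable: "g \<in> borel_measurable borel \<Longrightarrow> g \<in> borel_measurable (lebesgue_on S)"
  by (metis measurable_completion measurable_lborel2 measurable_restrict_space1)

text \<open>Where \<open>lam\<close> is nonzero the slope is differentiable and the derivative of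
  \<open>H\<close> is symmetric. The distributional form, on the whole annulus, is
  \<open>integral_gradients_commute\<close> for the Lipschitz function \<open>u\<close> and two
  coordinate directions.\<close>

lemma path_independence_eta: "path_independence \<Omega> {x. lam p \<epsilon> \<Omega> u x \<noteq> 0} (eta p \<epsilon> \<Omega> u)"
  unfolding path_independence_def
proof (intro conjI ballI allI)
  have cl: "x \<in> closure \<Omega>" if "x \<in> \<Omega>" for x using that closure_subset by blast
  fix x i j assume "x \<in> \<Omega> \<inter> {x. lam p \<epsilon> \<Omega> u x \<noteq> 0}"
  then have x: "x \<in> \<Omega>" and l: "lam p \<epsilon> \<Omega> u x \<noteq> 0" by auto
  have x0: "x \<noteq> 0" and xn: "R1 < norm x" "norm x < R2" using x R by (auto simp: mem_annulus)
  have "(w (norm x))\<^sup>2 + k \<noteq> 0" using l lam_u[OF cl[OF x]] Phi_H[OF x0] by auto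
  then have "(w (norm x))\<^sup>2 + k > 0" using k by (metis add_nonneg_nonneg order_le_less zero_le_power2)
  then obtain d where d: "(w has_real_derivative d) (at (norm x))" using w_deriv[OF xn] by blast
  define a where "a = (d - w (norm x) / norm x) / (norm x)\<^sup>2"
  define b where "b = w (norm x) / norm x"
  have "(H has_derivative (\<lambda>h. (a * (x \<bullet> h)) *\<^sub>R x + b *\<^sub>R h)) (at x)"
    using has_derivative_radial_field[OF d x0] by (simp add: a_def b_def)
  then have D: "(eta p \<epsilon> \<Omega> u has_derivative (\<lambda>h. (a * (x \<bullet> h)) *\<^sub>R x + b *\<^sub>R h)) (at x)"
    by (rule has_derivative_transform_within_open[OF _ open_annulus x]) (simp add: eta_u cl)
  have part: "has_partial (\<lambda>y. eta p \<epsilon> \<Omega> u y $ j) i (a * x $ i * x $ j + b * (if i = j then 1 else 0)) x" for i j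
  proof -
    have "((\<lambda>s::real. x + s *\<^sub>R axis i 1) has_derivative (\<lambda>s. s *\<^sub>R axis i 1)) (at 0)"
      by (auto intro!: derivative_eq_intros)
    moreover have "((\<lambda>y. eta p \<epsilon> \<Omega> u y $ j) has_derivative (\<lambda>h. ((a * (x \<bullet> h)) *\<^sub>R x + b *\<^sub>R h) $ j)) (at (x + 0 *\<^sub>R axis i 1))"
      using bounded_linear.has_derivative[OF bounded_linear_vec_nth D] by simp
    ultimately have "((\<lambda>s. eta p \<epsilon> \<Omega> u (x + s *\<^sub>R axis i 1) $ j) has_derivative
        (\<lambda>s. ((a * (x \<bullet> (s *\<^sub>R axis i 1))) *\<^sub>R x + b *\<^sub>R (s *\<^sub>R axis i 1)) $ j)) (at 0)"
      by (rule has_derivative_compose)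
    moreover have "(\<lambda>s. ((a * (x \<bullet> (s *\<^sub>R axis i 1))) *\<^sub>R x + b *\<^sub>R (s *\<^sub>R axis i 1)) $ j)
        = (*) (a * x $ i * x $ j + b * (if i = j then 1 else 0))"
    proof -
      have "axis i (1::real) $ j = (if i = j then 1 else 0)" by (simp add: axis_def)
      moreover have "x \<bullet> axis i 1 = x $ i" by (simp add: inner_axis)
      ultimately show ?thesis by (simp add: fun_eq_iff algebra_simps)
    qed
    ultimately show ?thesis by (simp add: has_partial_def has_field_derivative_def)
  qed
  show "\<exists>a b. has_partial (\<lambda>y. eta p \<epsilon> \<Omega> u y $ j) i a x \<and> has_partial (\<lambda>y. eta p \<epsilon> \<Omega> u y $ i) j b x \<and> a - b = 0"
    using part[of j i] part[of i j] by (intro exI conjI) (auto simp: mult.commute mult.left_commute)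
next
  have cl: "x \<in> closure \<Omega>" if "x \<in> \<Omega>" for x using that closure_subset by blast
  show "locally_integrable \<Omega> (eta p \<epsilon> \<Omega> u)"
  proof (rule locally_integrable_bounded[where M=B])
    have "H \<in> borel_measurable (lebesgue_on \<Omega>)" using H_measurable by (rule lebesgue_on_measurable)
    then show "eta p \<epsilon> \<Omega> u \<in> borel_measurable (lebesgue_on \<Omega>)"
      by (subst measurable_lebesgue_cong[where g=H]) (auto simp: eta_u cl)
  qed (simp add: eta_u cl norm_H_le)
  fix \<phi> i j assume \<phi>: "\<phi> \<in> test_functions \<Omega>"
  obtain K where K: "compact K" "K \<subseteq> \<Omega>" "\<And>x. x \<notin> K \<Longrightarrow> \<phi> x = 0" "\<And>x. x \<notin> K \<Longrightarrow> grad UNIV \<phi> x = 0"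
    using test_function_support[OF \<phi>] by auto
  note G = test_function_gradient[OF \<phi>] continuous_on_test_gradient[OF \<phi>]
  have Gm [measurable]: "grad UNIV \<phi> \<in> borel_measurable borel" using G(2) by (rule borel_measurable_continuous_onI)
  note [measurable] = H_measurable
  have m: "(\<lambda>x. (H x \<bullet> a) * (grad UNIV \<phi> x \<bullet> e)) \<in> borel_measurable borel" for a e
    by measurable
  have int: "integrable lborel (\<lambda>x. (H x \<bullet> a) * (grad UNIV \<phi> x \<bullet> e))" for a e
  proof (rule Bochner_Integration.integrable_bound)
    show "integrable lborel (\<lambda>x. (B * norm a * norm e) *\<^sub>R norm (grad UNIV \<phi> x))"
      by (intro integrable_scaleR_right integrable_norm integrable_continuous_compact_support[OF G(2) K(1)]) (rule K(4))
    show "AE x in lborel. norm ((H x \<bullet> a) * (grad UNIV \<phi> x \<bullet> e)) \<le> norm ((B * norm a * norm e) *\<^sub>R norm (grad UNIV \<phi> x))"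
    proof (rule AE_I2)
      fix x
      have B: "B \<ge> 0" using w_bound[of 0] by simp
      have "\<bar>H x \<bullet> a\<bar> \<le> B * norm a"
        using Cauchy_Schwarz_ineq2[of "H x" a] mult_right_mono[OF norm_H_le[of x] norm_ge_zero[of a]] by linarith
      then have "\<bar>H x \<bullet> a\<bar> * \<bar>grad UNIV \<phi> x \<bullet> e\<bar> \<le> (B * norm a) * (norm (grad UNIV \<phi> x) * norm e)"
        using B by (intro mult_mono Cauchy_Schwarz_ineq2) auto
      then show "norm ((H x \<bullet> a) * (grad UNIV \<phi> x \<bullet> e)) \<le> norm ((B * norm a * norm e) *\<^sub>R norm (grad UNIV \<phi> x))"
        using B by (simp add: abs_mult ac_simps)
    qed
  qed (use m in simp)
  have "(\<integral>x. eta p \<epsilon> \<Omega> u x $ j * grad UNIV \<phi> x $ i - eta p \<epsilon> \<Omega> u x $ i * grad UNIV \<phi> x $ j \<partial>lebesgue_on \<Omega>)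
     = (\<integral>x. (H x \<bullet> axis j 1) * (grad UNIV \<phi> x \<bullet> axis i 1) - (H x \<bullet> axis i 1) * (grad UNIV \<phi> x \<bullet> axis j 1) \<partial>lebesgue_on \<Omega>)"
    by (intro Bochner_Integration.integral_cong) (auto simp: eta_u cl inner_axis)
  also have "\<dots> = (\<integral>x. (H x \<bullet> axis j 1) * (grad UNIV \<phi> x \<bullet> axis i 1) - (H x \<bullet> axis i 1) * (grad UNIV \<phi> x \<bullet> axis j 1) \<partial>lborel)"
  proof (rule integral_lebesgue_on_support)
    show "(H x \<bullet> axis j 1) * (grad UNIV \<phi> x \<bullet> axis i 1) - (H x \<bullet> axis i 1) * (grad UNIV \<phi> x \<bullet> axis j 1) = 0"
      if "x \<notin> \<Omega>" for x using K(2,4) that by (metis diff_self inner_zero_left mult_zero_right subsetD)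
  qed (use m annulus_sets_lebesgue in \<open>auto intro!: borel_measurable_diff\<close>)
  also have "\<dots> = 0"
  proof -
    have "(\<integral>x. (H x \<bullet> axis j 1) * (grad UNIV \<phi> x \<bullet> axis i 1) \<partial>lborel) = (\<integral>x. (H x \<bullet> axis i 1) * (grad UNIV \<phi> x \<bullet> axis j 1) \<partial>lborel)"
      by (rule integral_gradients_commute[OF u_Lipschitz u_deriv G K(1) K(3) m])
         (use K(2) annulus_nonzero[OF R(1)] in blast)+
    then show ?thesis using int by simp
  qed
  finally show "(\<integral>x. eta p \<epsilon> \<Omega> u x $ j * grad UNIV \<phi> x $ i - eta p \<epsilon> \<Omega> u x $ i * grad UNIV \<phi> x $ j \<partial>lebesgue_on \<Omega>) = 0" .
qed

end

section \<open>Approximation by test functions\<close>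

text \<open>Polynomials supply the approximation of \<open>g\<close> and bumps the compact support.
  Each product is corrected by a constant so as to have integral zero; its antiderivative then
  vanishes on both sides of the support and is itself compactly supported.\<close>

lemma smooth_approximation_1d:
  assumes AB: "A < B" and g: "continuous_on {A..B} g" and g0: "integral {A..B} g = 0"
  obtains V v :: "nat \<Rightarrow> real \<Rightarrow> real" and M :: real
  where "\<And>k j. C_k_real j (V k)" "\<And>k s. (V k has_real_derivative v k s) (at s)"
    "\<And>k. \<exists>a b. A < a \<and> b < B \<and> (\<forall>s. s \<notin> {a..b} \<longrightarrow> V k s = 0)"
    "\<And>k s. s \<in> {A..B} \<Longrightarrow> \<bar>v k s\<bar> \<le> M" "\<And>k s. s \<in> {A..B} \<Longrightarrow> \<bar>V k s\<bar> \<le> M"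
    "\<And>s. A < s \<Longrightarrow> s < B \<Longrightarrow> (\<lambda>k. v k s) \<longlonglongrightarrow> g s"
    "\<And>s. s \<in> {A..B} \<Longrightarrow> (\<lambda>k. V k s) \<longlonglongrightarrow> integral {A..s} g"
proof -
  have "bounded (g ` {A..B})" by (intro compact_imp_bounded compact_continuous_image g) auto
  then obtain G where "\<forall>s\<in>{A..B}. \<bar>g s\<bar> \<le> G" by (auto simp: bounded_iff)
  then have G: "\<bar>g s\<bar> \<le> G" if "s \<in> {A..B}" for s using that by blast
  have G0: "G \<ge> 0" using G[of A] AB by simp
  have "\<exists>P. real_polynomial_function P \<and> (\<forall>s\<in>{A..B}. \<bar>g s - P s\<bar> < 1 / real (Suc k))" for k
    using Stone_Weierstrass_real_polynomial_function[OF compact_Icc g, of "1 / real (Suc k)"]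
    by (metis zero_less_divide_1_iff of_nat_0_less_iff zero_less_Suc)
  then obtain P where P: "\<And>k. real_polynomial_function (P k)"
    "\<And>k s. s \<in> {A..B} \<Longrightarrow> \<bar>g s - P k s\<bar> < 1 / real (Suc k)" by metis
  have Pb: "\<bar>P k s\<bar> \<le> G + 1" if "s \<in> {A..B}" for k s
  proof -
    have "1 / real (Suc k) \<le> 1" by simp
    then show ?thesis using P(2)[OF that, of k] G[OF that] by linarith
  qed
  have Plim: "(\<lambda>k. P k s) \<longlonglongrightarrow> g s" if "s \<in> {A..B}" for s
  proof -
    have "(\<lambda>k. P k s - g s) \<longlonglongrightarrow> 0"
    proof (rule Lim_null_comparison[OF _ LIMSEQ_inverse_real_of_nat])
      show "\<forall>\<^sub>F k in sequentially. norm (P k s - g s) \<le> inverse (real (Suc k))"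
        using P(2)[OF that] by (intro always_eventually allI)
          (metis abs_minus_commute inverse_eq_divide less_imp_le real_norm_def)
    qed
    then show ?thesis by (simp add: LIM_zero_iff)
  qed
  define a where "a k = A + 1 / real (Suc k)" for k
  define b where "b k = B - 1 / real (Suc k)" for k
  define \<beta> where "\<beta> k = bump (a k) (b k) (Suc k * Suc k)" for k
  have \<beta>0: "\<beta> k s = 0" if "s \<notin> {a k<..<b k}" for k s
    unfolding \<beta>_def using that by (subst bump_eq_0_iff) auto
  have \<beta>b: "0 \<le> \<beta> k s" "\<beta> k s \<le> 1" for k s by (simp_all add: \<beta>_def bump_bounds)
  have \<beta>lim: "(\<lambda>k. \<beta> k s) \<longlonglongrightarrow> 1" if s: "A < s" "s < B" for s
  proof -
    have sq: "filterlim (\<lambda>k. real (Suc k * Suc k)) at_top sequentially"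
      by (rule filterlim_at_top_mono[OF filterlim_compose[OF filterlim_real_sequentially filterlim_Suc]])
         (auto intro!: always_eventually)
    have z: "(\<lambda>k. 1 / real (Suc k)) \<longlonglongrightarrow> 0"
      using LIMSEQ_inverse_real_of_nat by (simp add: inverse_eq_divide)
    have l: "(\<lambda>k. s - (A + 1 / real (Suc k))) \<longlonglongrightarrow> s - (A + 0)" "(\<lambda>k. (B - 1 / real (Suc k)) - s) \<longlonglongrightarrow> (B - 0) - s"
      by (intro tendsto_intros z)+
    have "filterlim (\<lambda>k. real (Suc k * Suc k) * (s - a k)) at_top sequentially"
      unfolding a_def by (rule filterlim_at_top_mult_tendsto_pos[OF l(1) _ sq]) (use s in simp)
    moreover have "filterlim (\<lambda>k. real (Suc k * Suc k) * (b k - s)) at_top sequentially"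
      unfolding b_def by (rule filterlim_at_top_mult_tendsto_pos[OF l(2) _ sq]) (use s in simp)
    ultimately have "(\<lambda>k. \<beta> k s) \<longlonglongrightarrow> 1 * 1"
      unfolding \<beta>_def bump_def by (intro tendsto_mult flat_0_scaled_tendsto)
    then show ?thesis by simp
  qed
  have c\<beta>: "continuous_on S (\<beta> k)" for S k
    using C_k_real_bump[of 0] by (auto simp: \<beta>_def intro: continuous_on_subset)
  have cP: "continuous_on S (P k)" for S k
    using C_k_real_polynomial[OF P(1), of 0] by (auto intro: continuous_on_subset)
  \<comment> \<open>The cutoffs vanish at the endpoints, so pointwise convergence is available in
    the open interval only.\<close>
  have lim_int: "(\<lambda>k. integral {A..s} (F k)) \<longlonglongrightarrow> integral {A..s} F0"
    if s: "s \<in> {A..B}" and F: "\<And>k. continuous_on {A..B} (F k)" "\<And>k x. x \<in> {A..B} \<Longrightarrow> \<bar>F k x\<bar> \<le> C"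
      and lim: "\<And>x. A < x \<Longrightarrow> x < B \<Longrightarrow> (\<lambda>k. F k x) \<longlonglongrightarrow> F0 x" for s F C and F0 :: "real \<Rightarrow> real"
  proof -
    have "(\<lambda>k. integral {A<..<s} (F k)) \<longlonglongrightarrow> integral {A<..<s} F0"
    proof (rule dominated_convergence(2)[where h="\<lambda>_. C"])
      show "F k integrable_on {A<..<s}" for k
        using s by (auto simp: integrable_on_open_interval_real intro!: integrable_continuous_real continuous_on_subset[OF F(1)])
      show "(\<lambda>_. C) integrable_on {A<..<s}"
        unfolding integrable_on_open_interval_real by (rule integrable_continuous_real) (rule continuous_on_const)
    qed (use s F(2) lim in auto)
    then show ?thesis by (simp add: integral_open_interval_real)
  qed
  \<comment> \<open>This constant makes \<open>\<beta> k s * (P k s - c k)\<close> integrate to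
    zero; it tends to 0 because \<open>g\<close> has integral zero.\<close>
  define c where "c k = integral {A..B} (\<lambda>s. \<beta> k s * P k s) / integral {A..B} (\<beta> k)" for k
  have IB: "(\<lambda>k. integral {A..B} (\<beta> k)) \<longlonglongrightarrow> B - A"
    using lim_int[of B \<beta> 1 "\<lambda>_. 1"] c\<beta> \<beta>b \<beta>lim AB by auto
  have IP: "(\<lambda>k. integral {A..B} (\<lambda>s. \<beta> k s * P k s)) \<longlonglongrightarrow> 0"
  proof -
    have "(\<lambda>k. integral {A..B} (\<lambda>s. \<beta> k s * P k s)) \<longlonglongrightarrow> integral {A..B} g"
    proof (rule lim_int[where C="1 * (G + 1)"])
      show "\<bar>\<beta> k s * P k s\<bar> \<le> 1 * (G + 1)" if "s \<in> {A..B}" for k s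
        unfolding abs_mult using \<beta>b Pb[OF that] by (intro mult_mono) auto
      show "(\<lambda>k. \<beta> k s * P k s) \<longlonglongrightarrow> g s" if "A < s" "s < B" for s
        using tendsto_mult[OF \<beta>lim[OF that] Plim[of s]] that by simp
    qed (use AB c\<beta> cP in \<open>auto intro!: continuous_intros\<close>)
    then show ?thesis by (simp add: g0)
  qed
  have clim: "c \<longlonglongrightarrow> 0"
    using tendsto_divide[OF IP IB] AB by (simp add: c_def[abs_def])
  then obtain C where C: "\<And>k. \<bar>c k\<bar> \<le> C"
    using convergent_imp_Bseq[OF convergentI[OF clim]] by (auto simp: Bseq_def)
  obtain k1 where k1: "\<And>k. k \<ge> k1 \<Longrightarrow> integral {A..B} (\<beta> k) > 0"
    using order_tendstoD(1)[OF IB, of 0] AB by (auto simp: eventually_sequentially)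
  \<comment> \<open>The shift by \<open>k1\<close> discards the indices for which the cutoff may
    have integral 0, so that \<open>c\<close> is a genuine quotient.\<close>
  define v where "v k s = \<beta> (k + k1) s * (P (k + k1) s - c (k + k1))" for k s
  have CRv: "C_k_real j (v k)" for j k
  proof -
    have "C_k_real j (\<lambda>s. \<beta> (k + k1) s * (P (k + k1) s + (- c (k + k1))))"
      unfolding \<beta>_def by (rule C_k_real_mult[OF C_k_real_bump C_k_real_add[OF C_k_real_polynomial[OF P(1)] C_k_real_const]])
    then show ?thesis by (simp add: v_def[abs_def])
  qed
  have cv: "continuous_on S (v k)" for S k
    using CRv[of 0 k] by (auto intro: continuous_on_subset)
  have vb: "\<bar>v k s\<bar> \<le> G + 1 + C" if "s \<in> {A..B}" for k s
  proof -
    have "\<bar>v k s\<bar> \<le> 1 * (G + 1 + C)"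
      unfolding v_def abs_mult using \<beta>b Pb[OF that, of "k + k1"] C[of "k + k1"]
      by (intro mult_mono) auto
    then show ?thesis by simp
  qed
  have vlim: "(\<lambda>k. v k s) \<longlonglongrightarrow> g s" if "A < s" "s < B" for s
  proof -
    have "(\<lambda>k. \<beta> k s * (P k s - c k)) \<longlonglongrightarrow> 1 * (g s - 0)"
      using that by (intro tendsto_intros \<beta>lim Plim clim) auto
    from LIMSEQ_ignore_initial_segment[OF this, of k1] show ?thesis by (simp add: v_def)
  qed
  have "\<exists>W. \<forall>s. (W has_real_derivative v k s) (at s)" for k
    using antiderivative_on_UNIV[OF cv] by blast
  then obtain W where W: "\<And>k s. (W k has_real_derivative v k s) (at s)" by metis
  define V where "V k s = W k s - W k A" for k s
  have dV: "(V k has_real_derivative v k s) (at s)" for k s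
    unfolding V_def[abs_def] by (auto intro!: derivative_eq_intros W)
  have V_int: "V k s = integral {A..s} (v k)" if "s \<ge> A" for k s
  proof -
    have "(v k has_integral (V k s - V k A)) {A..s}"
      using that dV by (intro fundamental_theorem_of_calculus)
       (auto simp: has_real_derivative_iff_has_vector_derivative[symmetric] intro: has_field_derivative_at_within)
    then show ?thesis by (simp add: V_def integral_unique)
  qed
  have VB: "V k B = 0" for k
  proof -
    let ?k = "k + k1"
    have i: "(\<lambda>s. \<beta> ?k s * P ?k s) integrable_on {A..B}" "\<beta> ?k integrable_on {A..B}"
      by (intro integrable_continuous_real continuous_intros c\<beta> cP)+
    have "integral {A..B} (v k) = integral {A..B} (\<lambda>s. \<beta> ?k s * P ?k s - \<beta> ?k s * c ?k)"
      by (simp add: v_def[abs_def] right_diff_distrib)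
    also have "\<dots> = integral {A..B} (\<lambda>s. \<beta> ?k s * P ?k s) - integral {A..B} (\<beta> ?k) * c ?k"
      using i by (subst integral_diff) (auto intro: integrable_on_mult_left)
    also have "\<dots> = 0" using k1[of ?k] by (simp add: c_def)
    finally show ?thesis using V_int[of B k] AB by simp
  qed
  have Vsupp: "V k s = 0" if s: "s \<notin> {a (k + k1)..b (k + k1)}" for k s
  proof -
    let ?a = "a (k + k1)" and ?b = "b (k + k1)"
    have z: "(V k has_real_derivative 0) (at x)" if "x \<le> ?a \<or> ?b \<le> x" for x
      using dV[of k x] \<beta>0[of x "k + k1"] that by (auto simp: v_def)
    have aA: "A \<le> ?a" "?b \<le> B" by (auto simp: a_def b_def)
    consider "s \<le> ?a" | "?b \<le> s" using s by force
    then show ?thesis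
    proof cases
      case 1
      have "\<exists>d. \<forall>x\<in>{..?a}. V k x = d"
        by (rule has_field_derivative_zero_constant) (auto intro: has_field_derivative_at_within z)
      then have "V k s = V k A" using 1 aA by auto
      then show ?thesis by (simp add: V_def)
    next
      case 2
      have "\<exists>d. \<forall>x\<in>{?b..}. V k x = d"
        by (rule has_field_derivative_zero_constant) (auto intro: has_field_derivative_at_within z)
      then have "V k s = V k B" using 2 aA by auto
      then show ?thesis by (simp add: VB)
    qed
  qed
  have Vb: "\<bar>V k s\<bar> \<le> (G + 1 + C) * (B - A)" if s: "s \<in> {A..B}" for k s
  proof -
    have "norm (V k s - V k A) \<le> (G + 1 + C) * norm (s - A)"
      using s vb by (intro field_differentiable_bound[of "{A..B}" "V k" "v k"]) (auto intro: has_field_derivative_at_within dV)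
    also have "\<dots> \<le> (G + 1 + C) * (B - A)"
      using s G0 C[of 0] by (intro mult_left_mono) auto
    finally show ?thesis by (simp add: V_def)
  qed
  show ?thesis
  proof (rule that[of V v "max (G + 1 + C) ((G + 1 + C) * (B - A))"])
    show "C_k_real j (V k)" for j k
    proof (rule C_k_real_Suc_imp)
      show "C_k_real (Suc j) (V k)" unfolding C_k_real.simps using dV CRv by blast
    qed
    show "\<exists>a b. A < a \<and> b < B \<and> (\<forall>s. s \<notin> {a..b} \<longrightarrow> V k s = 0)" for k
      using Vsupp[of _ k] by (intro exI[of _ "a (k + k1)"] exI[of _ "b (k + k1)"]) (auto simp: a_def b_def)
    show "(\<lambda>k. V k s) \<longlonglongrightarrow> integral {A..s} g" if s: "s \<in> {A..B}" for s
      using lim_int[OF s, of v "G + 1 + C" g] cv vb vlim s by (simp add: V_int)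
  qed (use dV vb Vb vlim in \<open>auto simp: le_max_iff_disj\<close>)
qed

text \<open>\<open>H\<close> and \<open>T\<close> need not be continuous at the origin;
  multiplication by a test function restores continuity on the whole space.\<close>

lemma continuous_on_extend_support:
  fixes G :: "'a::topological_space \<Rightarrow> 'b::real_normed_vector"
  assumes "continuous_on S G" "open S" "closed K" "K \<subseteq> S" "\<And>x. x \<notin> K \<Longrightarrow> G x = 0"
  shows "continuous_on UNIV G"
proof -
  have "continuous_on (- K) G"
    by (rule continuous_on_cong[THEN iffD2, OF refl _ continuous_on_const[of _ 0]]) (use assms(5) in auto)
  then have "continuous_on (S \<union> - K) G"
    using assms by (intro continuous_on_open_Un) auto
  moreover have "S \<union> - K = UNIV" using assms(4) by auto
  ultimately show ?thesis by simp
qed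

lemma integral_powr_tendsto_0:
  fixes F :: "nat \<Rightarrow> real^'n \<Rightarrow> 'b::euclidean_space"
  assumes S: "S \<in> lmeasurable" and p: "p > 0" and m: "\<And>k. F k \<in> borel_measurable (lebesgue_on S)"
    and b: "\<And>k. AE x in lebesgue_on S. norm (F k x) \<le> M"
    and lim: "AE x in lebesgue_on S. (\<lambda>k. F k x) \<longlonglongrightarrow> 0"
  shows "(\<lambda>k. \<integral>x. norm (F k x) powr p \<partial>lebesgue_on S) \<longlonglongrightarrow> 0"
proof -
  interpret finite_measure "lebesgue_on S" using S by (rule finite_measure_lebesgue_on)
  have "(\<lambda>k. \<integral>x. norm (F k x) powr p \<partial>lebesgue_on S) \<longlonglongrightarrow> (\<integral>x. 0 \<partial>lebesgue_on S)"
  proof (rule integral_dominated_convergence[where w="\<lambda>_. M powr p"])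
    show "(\<lambda>x. norm (F k x) powr p) \<in> borel_measurable (lebesgue_on S)" for k
      using m[of k] by measurable
    show "AE x in lebesgue_on S. norm (norm (F k x) powr p) \<le> M powr p" for k
      by (rule eventually_mono[OF b[of k]]) (use p in \<open>auto intro!: powr_mono2\<close>)
    show "AE x in lebesgue_on S. (\<lambda>k. norm (F k x) powr p) \<longlonglongrightarrow> 0"
      using lim
    proof eventually_elim
      case (elim x)
      show ?case by (rule tendsto_zero_powrI[OF tendsto_norm_zero[OF elim] tendsto_const _ p]) auto
    qed
  qed auto
  then show ?thesis by simp
qed

section \<open>The solution as a Sobolev function and its weak equation\<close>

context annulus_solution
begin

lemma closure_Omega: "x \<in> \<Omega> \<Longrightarrow> x \<in> closure \<Omega>"
  using closure_subset by blast

lemma u_bounded: "\<exists>C. \<forall>x\<in>\<Omega>. norm (u x) \<le> C"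
proof -
  have "bounded (u ` closure \<Omega>)"
    by (intro compact_imp_bounded compact_continuous_image continuous_on_u compact_closed_annulus R)
  then obtain C where "\<forall>x\<in>closure \<Omega>. norm (u x) \<le> C" by (auto simp: bounded_iff)
  then show ?thesis using closure_Omega by blast
qed

text \<open>The sum of the two integrands is the gradient of the compactly supported function
  \<open>u x * \<phi> x\<close>, hence has integral zero.\<close>

lemma has_weak_grad_u: "has_weak_grad \<Omega> u H"
  unfolding has_weak_grad_def
proof (intro conjI ballI)
  obtain C where C: "\<And>x. x \<in> \<Omega> \<Longrightarrow> norm (u x) \<le> C" using u_bounded by blast
  show "locally_integrable \<Omega> u"
    by (rule locally_integrable_bounded[OF continuous_borel_measurable_lebesgue_on[OF continuous_on_u] C])
  show "locally_integrable \<Omega> H"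
    by (rule locally_integrable_bounded[OF lebesgue_on_measurable[OF H_measurable] norm_H_le])
  fix \<phi> assume \<phi>: "\<phi> \<in> test_functions \<Omega>"
  obtain K where K: "compact K" "K \<subseteq> \<Omega>" "\<And>x. x \<notin> K \<Longrightarrow> \<phi> x = 0" "\<And>x. x \<notin> K \<Longrightarrow> grad UNIV \<phi> x = 0"
    using test_function_support[OF \<phi>] by auto
  have cK: "closed K" using K(1) by (rule compact_imp_closed)
  have nK: "x \<notin> K" if "x \<notin> \<Omega>" for x using that K(2) by blast
  have K0: "x \<noteq> 0" if "x \<in> K" for x using that K(2) annulus_nonzero[OF R(1)] by blast
  have c1: "continuous_on UNIV (\<lambda>x. u x *\<^sub>R grad UNIV \<phi> x)"
    by (intro continuous_intros continuous_on_u continuous_on_test_gradient[OF \<phi>])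
  have "continuous_on \<Omega> (\<lambda>x. \<phi> x *\<^sub>R H x)"
    by (intro continuous_intros continuous_on_H continuous_on_subset[OF continuous_on_test_function[OF \<phi>]])
       (use annulus_nonzero[OF R(1)] in blast)+
  then have c2: "continuous_on UNIV (\<lambda>x. \<phi> x *\<^sub>R H x)"
    by (rule continuous_on_extend_support[OF _ open_annulus cK K(2)]) (simp add: K(3))
  have i: "integrable lborel (\<lambda>x. u x *\<^sub>R grad UNIV \<phi> x)" "integrable lborel (\<lambda>x. \<phi> x *\<^sub>R H x)"
    by (rule integrable_continuous_compact_support[OF c1 K(1)], simp add: K(4))
       (rule integrable_continuous_compact_support[OF c2 K(1)], simp add: K(3))
  have "(\<integral>x. u x *\<^sub>R grad UNIV \<phi> x + \<phi> x *\<^sub>R H x \<partial>lborel) = 0"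
  proof (rule integral_gradient_eq_0[where \<psi>="\<lambda>x. u x * \<phi> x"])
    show "((\<lambda>x. u x * \<phi> x) has_derivative (\<lambda>h. (u x *\<^sub>R grad UNIV \<phi> x + \<phi> x *\<^sub>R H x) \<bullet> h)) (at x)" for x
    proof (cases "x \<in> K")
      case True
      show ?thesis
        using has_derivative_mult[OF u_deriv[OF K0[OF True]] test_function_gradient[OF \<phi>, of x]]
        by (simp add: inner_add_left mult.commute)
    next
      case False
      have "((\<lambda>x. u x * \<phi> x) has_derivative (\<lambda>h. 0)) (at x)"
        by (rule has_derivative_transform_within_open[of "\<lambda>_. 0" _ _ _ "- K"])
           (use False cK K(3) in auto)
      then show ?thesis using False by (simp add: K)
    qed
  qed (use K c1 c2 in \<open>auto intro: continuous_on_add\<close>)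
  then have "(\<integral>x. u x *\<^sub>R grad UNIV \<phi> x \<partial>lborel) = - (\<integral>x. \<phi> x *\<^sub>R H x \<partial>lborel)"
    using i by (simp add: eq_neg_iff_add_eq_0)
  moreover have "(\<integral>x. u x *\<^sub>R grad UNIV \<phi> x \<partial>lebesgue_on \<Omega>) = (\<integral>x. u x *\<^sub>R grad UNIV \<phi> x \<partial>lborel)"
    by (rule integral_lebesgue_on_support[OF annulus_sets_lebesgue borel_measurable_continuous_onI[OF c1]])
       (simp add: K nK)
  moreover have "(\<integral>x. \<phi> x *\<^sub>R H x \<partial>lebesgue_on \<Omega>) = (\<integral>x. \<phi> x *\<^sub>R H x \<partial>lborel)"
    by (rule integral_lebesgue_on_support[OF annulus_sets_lebesgue borel_measurable_continuous_onI[OF c2]])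
       (simp add: K nK)
  ultimately show "(\<integral>x. u x *\<^sub>R grad UNIV \<phi> x \<partial>lebesgue_on \<Omega>) = - (\<integral>x. \<phi> x *\<^sub>R H x \<partial>lebesgue_on \<Omega>)"
    by simp
qed

lemma weak_grad_u: "AE x in lebesgue_on \<Omega>. weak_grad \<Omega> u x = H x"
proof -
  have "has_weak_grad \<Omega> u (weak_grad \<Omega> u)"
    unfolding weak_grad_def by (rule someI[of "has_weak_grad \<Omega> u", OF has_weak_grad_u])
  then show ?thesis by (rule has_weak_grad_unique[OF open_annulus _ has_weak_grad_u])
qed

lemma u_W1p: "u \<in> W1p p \<Omega>"
proof -
  obtain C where C: "\<And>x. x \<in> \<Omega> \<Longrightarrow> norm (u x) \<le> C" using u_bounded by blast
  have "in_Lp p \<Omega> u"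
    by (rule in_Lp_bounded[OF annulus_lmeasurable[OF R(1)] continuous_borel_measurable_lebesgue_on[OF continuous_on_u] C])
       (use p in auto)
  moreover have "in_Lp p \<Omega> H"
    by (rule in_Lp_bounded[OF annulus_lmeasurable[OF R(1)] lebesgue_on_measurable[OF H_measurable] norm_H_le])
       (use p in auto)
  ultimately show ?thesis using has_weak_grad_u by (auto simp: W1p_def)
qed

text \<open>Apply \<open>integral_gradient_eq_0\<close> to \<open>\<phi> x * T x $ i\<close>, take
  the i-th component and sum: the derivatives of \<open>T\<close> add up to its divergence. This
  needs a continuous derivative of \<open>T\<close>, which the equation for \<open>m\<close> grants
  even where \<open>H\<close> has none.\<close>

lemma weak_equation_test:
  assumes \<phi>: "\<phi> \<in> test_functions \<Omega>"
  shows "(\<integral>x. T x \<bullet> grad UNIV \<phi> x \<partial>lebesgue_on \<Omega>) = (\<integral>x. f x * \<phi> x \<partial>lebesgue_on \<Omega>)"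
proof -
  obtain K where K: "compact K" "K \<subseteq> \<Omega>" "\<And>x. x \<notin> K \<Longrightarrow> \<phi> x = 0" "\<And>x. x \<notin> K \<Longrightarrow> grad UNIV \<phi> x = 0"
    using test_function_support[OF \<phi>] by auto
  have cK: "closed K" using K(1) by (rule compact_imp_closed)
  have nK: "x \<notin> K" if "x \<notin> \<Omega>" for x using that K(2) by blast
  have K0: "x \<noteq> 0" if "x \<in> \<Omega>" for x using that annulus_nonzero[OF R(1)] by blast
  note c\<phi> = continuous_on_test_function[OF \<phi>] and cg = continuous_on_test_gradient[OF \<phi>]
  define b where "b x = m (norm x) / norm x" for x :: "real^'n"
  \<comment> \<open>The derivative of \<open>m\<close> at \<open>norm x\<close>, read off the
    equation and therefore continuous in \<open>x\<close>; \<open>b\<close> and \<open>c\<close> are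
    the two coefficients in the derivative of \<open>T\<close>.\<close>
  define m' where "m' x = - f x - real (CARD('n) - 1) * b x" for x
  define c where "c x = (m' x - b x) / (norm x)\<^sup>2" for x
  define G where "G i x = \<phi> x *\<^sub>R ((c x * x $ i) *\<^sub>R x + b x *\<^sub>R axis i 1) + T x $ i *\<^sub>R grad UNIV \<phi> x" for i x
  have dT: "(T has_derivative (\<lambda>h. (c x * (x \<bullet> h)) *\<^sub>R x + b x *\<^sub>R h)) (at x)" if x: "x \<in> \<Omega>" for x
  proof -
    have xn: "R1 < norm x" "norm x < R2" using x by (auto simp: mem_annulus[OF R(1)])
    have "f x = h (norm x)" using f_h closure_Omega[OF x] by blast
    then show ?thesis using has_derivative_radial_field[OF m[OF xn] K0[OF x]]
      by (simp add: c_def m'_def b_def)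
  qed
  have cb: "continuous_on \<Omega> b" unfolding b_def
    by (intro continuous_intros continuous_on_compose2[OF m_cont]) (use K0 in auto)
  have cf: "continuous_on \<Omega> f" by (rule continuous_on_subset[OF f_cont closure_subset])
  have cc: "continuous_on \<Omega> c" unfolding c_def m'_def
    by (intro continuous_intros cb cf) (use K0 in auto)
  have cT: "continuous_on \<Omega> T" by (rule continuous_on_T) (use K0 in auto)
  have G0: "G i x = 0" if "x \<notin> K" for i x using that by (simp add: G_def K)
  have "continuous_on \<Omega> (G i)" for i unfolding G_def
    by (intro continuous_intros cb cc cT continuous_on_subset[OF c\<phi>] continuous_on_subset[OF cg]) auto
  then have cG: "continuous_on UNIV (G i)" for i
    by (rule continuous_on_extend_support[OF _ open_annulus cK K(2) G0])
  have iG: "integrable lborel (G i)" for i by (rule integrable_continuous_compact_support[OF cG K(1) G0])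
  have IG: "(\<integral>x. G i x \<partial>lborel) = 0" for i
  proof (rule integral_gradient_eq_0[where \<psi>="\<lambda>x. \<phi> x * T x $ i"])
    show "((\<lambda>x. \<phi> x * T x $ i) has_derivative (\<lambda>h. G i x \<bullet> h)) (at x)" for x
    proof (cases "x \<in> K")
      case True
      then have x: "x \<in> \<Omega>" using K(2) by blast
      have "((\<lambda>x. T x $ i) has_derivative (\<lambda>h. ((c x * (x \<bullet> h)) *\<^sub>R x + b x *\<^sub>R h) $ i)) (at x)"
        by (rule bounded_linear.has_derivative[OF bounded_linear_vec_nth dT[OF x]])
      from has_derivative_mult[OF test_function_gradient[OF \<phi>] this]
      show ?thesis
        by (simp add: G_def inner_add_left inner_add_right inner_axis' algebra_simps)
    next
      case False
      have "((\<lambda>x. \<phi> x * T x $ i) has_derivative (\<lambda>h. 0)) (at x)"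
        by (rule has_derivative_transform_within_open[of "\<lambda>_. 0" _ _ _ "- K"])
           (use False cK K(3) in auto)
      then show ?thesis by (simp add: G0[OF False])
    qed
  qed (use K cG in auto)
  have sumG: "(\<Sum>i\<in>UNIV. G i x \<bullet> axis i 1) = T x \<bullet> grad UNIV \<phi> x - f x * \<phi> x" for x
  proof (cases "x \<in> K")
    case True
    then have x0: "x \<noteq> 0" using K(2) K0 by blast
    have ax: "axis i (1::real) $ i = 1" for i :: 'n by (simp add: axis_def)
    have "(\<Sum>i\<in>UNIV. G i x \<bullet> axis i 1) = (\<Sum>i\<in>UNIV. \<phi> x * (c x * x $ i * x $ i + b x) + T x $ i * grad UNIV \<phi> x $ i)"
      by (simp add: G_def inner_axis ax)
    also have "\<dots> = \<phi> x * (\<Sum>i\<in>UNIV. c x * x $ i * x $ i + b x) + T x \<bullet> grad UNIV \<phi> x"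
      by (subst sum.distrib, subst sum_distrib_left[symmetric]) (simp add: inner_vec_def)
    also have "(\<Sum>i\<in>UNIV. c x * x $ i * x $ i + b x)
        = (\<Sum>i\<in>UNIV. (((m' x - m (norm x) / norm x) / (norm x)\<^sup>2 * (x \<bullet> axis i 1)) *\<^sub>R x + (m (norm x) / norm x) *\<^sub>R axis i 1) $ i)"
      by (simp add: c_def b_def inner_axis ax)
    also have "\<dots> = - f x"
      unfolding trace_radial_derivative[OF x0] by (simp add: m'_def b_def N)
    finally show ?thesis by simp
  next
    case False
    then show ?thesis by (simp add: G0 K)
  qed
  have "continuous_on \<Omega> (\<lambda>x. f x * \<phi> x)"
    by (intro continuous_intros cf continuous_on_subset[OF c\<phi>]) auto
  then have cf\<phi>: "continuous_on UNIV (\<lambda>x. f x * \<phi> x)"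
    by (rule continuous_on_extend_support[OF _ open_annulus cK K(2)]) (simp add: K(3))
  have "continuous_on \<Omega> (\<lambda>x. T x \<bullet> grad UNIV \<phi> x)"
    by (intro continuous_intros cT continuous_on_subset[OF cg]) auto
  then have cTg: "continuous_on UNIV (\<lambda>x. T x \<bullet> grad UNIV \<phi> x)"
    by (rule continuous_on_extend_support[OF _ open_annulus cK K(2)]) (simp add: K(4))
  have i: "integrable lborel (\<lambda>x. T x \<bullet> grad UNIV \<phi> x)" "integrable lborel (\<lambda>x. f x * \<phi> x)"
    by (rule integrable_continuous_compact_support[OF cTg K(1)], simp add: K(4))
       (rule integrable_continuous_compact_support[OF cf\<phi> K(1)], simp add: K(3))
  have "(\<integral>x. T x \<bullet> grad UNIV \<phi> x \<partial>lborel) - (\<integral>x. f x * \<phi> x \<partial>lborel) = (\<integral>x. (\<Sum>i\<in>UNIV. G i x \<bullet> axis i 1) \<partial>lborel)"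
    using i by (simp add: sumG)
  also have "\<dots> = (\<Sum>i\<in>UNIV. (\<integral>x. G i x \<partial>lborel) \<bullet> axis i 1)"
    using iG by (simp add: Bochner_Integration.integral_sum)
  also have "\<dots> = 0" by (simp add: IG)
  finally have "(\<integral>x. T x \<bullet> grad UNIV \<phi> x \<partial>lborel) = (\<integral>x. f x * \<phi> x \<partial>lborel)" by simp
  moreover have "(\<integral>x. T x \<bullet> grad UNIV \<phi> x \<partial>lebesgue_on \<Omega>) = (\<integral>x. T x \<bullet> grad UNIV \<phi> x \<partial>lborel)"
    by (rule integral_lebesgue_on_support[OF annulus_sets_lebesgue borel_measurable_continuous_onI[OF cTg]])
       (simp add: K nK)
  moreover have "(\<integral>x. f x * \<phi> x \<partial>lebesgue_on \<Omega>) = (\<integral>x. f x * \<phi> x \<partial>lborel)"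
    by (rule integral_lebesgue_on_support[OF annulus_sets_lebesgue borel_measurable_continuous_onI[OF cf\<phi>]])
       (simp add: K nK)
  ultimately show ?thesis by simp
qed

text \<open>In the variable \<open>s = \<bar>x\<bar>\<^sup>2\<close> a radial function is a smooth function of a polynomial.\<close>

lemma u_W01p: "u \<in> W01p p \<Omega>"
proof -
  \<comment> \<open>The derivative of \<open>U (sqrt s)\<close>. Its total integral vanishes by the
    boundary values of \<open>U\<close>, as \<open>smooth_approximation_1d\<close> demands.\<close>
  define g where "g s = w (sqrt s) / (2 * sqrt s)" for s
  have R12: "R1\<^sup>2 < R2\<^sup>2" "0 < R1\<^sup>2" using R by (auto intro: power_strict_mono)
  have pos: "s > 0" if "s \<in> {R1\<^sup>2..R2\<^sup>2}" for s
    using that less_le_trans[OF R12(2), of s] by simp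
  have cg: "continuous_on {R1\<^sup>2..R2\<^sup>2} g" unfolding g_def
    by (intro continuous_intros continuous_on_compose2[OF w_cont]) (use pos in force)+
  have dU: "((\<lambda>s. U (sqrt s)) has_real_derivative g s) (at s)" if "s > 0" for s
  proof -
    have "((\<lambda>s. U (sqrt s)) has_real_derivative w (sqrt s) * (inverse (sqrt s) / 2)) (at s)"
      by (rule DERIV_chain2[OF U DERIV_real_sqrt[OF that]])
    then show ?thesis by (simp add: g_def field_simps)
  qed
  have intg: "integral {R1\<^sup>2..s} g = U (sqrt s)" if s: "s \<in> {R1\<^sup>2..R2\<^sup>2}" for s
  proof -
    have "(g has_integral (U (sqrt s) - U (sqrt (R1\<^sup>2)))) {R1\<^sup>2..s}"
    proof (rule fundamental_theorem_of_calculus)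
      fix t assume "t \<in> {R1\<^sup>2..s}"
      then have "t > 0" using less_le_trans[OF R12(2), of t] by simp
      from dU[OF this] show "((\<lambda>s. U (sqrt s)) has_vector_derivative g t) (at t within {R1\<^sup>2..s})"
        by (simp add: has_field_derivative_at_within flip: has_real_derivative_iff_has_vector_derivative)
    qed (use s in auto)
    then show ?thesis using R U0 by (simp add: integral_unique)
  qed
  have g0: "integral {R1\<^sup>2..R2\<^sup>2} g = 0" using intg[of "R2\<^sup>2"] R12 R U0 by simp
  show ?thesis
  proof (rule smooth_approximation_1d[OF R12(1) cg g0])
    fix V v :: "nat \<Rightarrow> real \<Rightarrow> real" and M
    assume CRV: "\<And>k j. C_k_real j (V k)" and dV: "\<And>k s. (V k has_real_derivative v k s) (at s)"
      and supp: "\<And>k. \<exists>a b. R1\<^sup>2 < a \<and> b < R2\<^sup>2 \<and> (\<forall>s. s \<notin> {a..b} \<longrightarrow> V k s = 0)"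
      and vM: "\<And>k s. s \<in> {R1\<^sup>2..R2\<^sup>2} \<Longrightarrow> \<bar>v k s\<bar> \<le> M"
      and VM: "\<And>k s. s \<in> {R1\<^sup>2..R2\<^sup>2} \<Longrightarrow> \<bar>V k s\<bar> \<le> M"
      and vlim: "\<And>s. R1\<^sup>2 < s \<Longrightarrow> s < R2\<^sup>2 \<Longrightarrow> (\<lambda>k. v k s) \<longlonglongrightarrow> g s"
      and Vlim: "\<And>s. s \<in> {R1\<^sup>2..R2\<^sup>2} \<Longrightarrow> (\<lambda>k. V k s) \<longlonglongrightarrow> integral {R1\<^sup>2..s} g"
    define \<phi> where "\<phi> k x = V k (\<Sum>i\<in>UNIV. x $ i * x $ i)" for k and x :: "real^'n"
    have \<phi>_eq: "\<phi> k x = V k ((norm x)\<^sup>2)" for k x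
      by (simp add: \<phi>_def power2_norm_eq_inner inner_vec_def)
    have d\<phi>: "(\<phi> k has_derivative (\<lambda>h. ((2 * v k ((norm x)\<^sup>2)) *\<^sub>R x) \<bullet> h)) (at x)" for k x
    proof -
      have "((\<lambda>y. y \<bullet> y) has_derivative (\<lambda>h. x \<bullet> h + h \<bullet> x)) (at x)"
        by (rule has_derivative_inner[OF has_derivative_ident has_derivative_ident])
      from has_derivative_compose[OF this dV[unfolded has_field_derivative_def, of k "x \<bullet> x"]]
      show ?thesis by (simp add: \<phi>_eq[abs_def] power2_norm_eq_inner inner_commute algebra_simps)
    qed
    note grad\<phi> = grad_UNIV_eq[OF d\<phi>]
    have \<phi>_test: "\<phi> k \<in> test_functions \<Omega>" for k
    proof -
      obtain a b where ab: "R1\<^sup>2 < a" "b < R2\<^sup>2" "\<And>s. s \<notin> {a..b} \<Longrightarrow> V k s = 0" using supp[of k] by blast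
      have "C_k j (\<lambda>x::real^'n. \<Sum>i\<in>UNIV. x $ i * x $ i)" for j
        by (rule C_k_sum[OF finite], rule C_k_mult[OF C_k_component C_k_component])
      then have "C_k j (\<phi> k)" for j unfolding \<phi>_def[abs_def] by (rule C_k_compose[OF CRV])
      moreover have "closed {x::real^'n. a \<le> (norm x)\<^sup>2 \<and> (norm x)\<^sup>2 \<le> b}"
        by (intro closed_Collect_conj closed_Collect_le continuous_intros)
      then have cl: "closure {x. \<phi> k x \<noteq> 0} \<subseteq> {x. a \<le> (norm x)\<^sup>2 \<and> (norm x)\<^sup>2 \<le> b}"
        by (intro closure_minimal) (use ab(3) in \<open>auto simp: \<phi>_eq\<close>)
      have sub: "{x. a \<le> (norm x)\<^sup>2 \<and> (norm x)\<^sup>2 \<le> b} \<subseteq> \<Omega>"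
      proof safe
        fix x :: "real^'n" assume "a \<le> (norm x)\<^sup>2" "(norm x)\<^sup>2 \<le> b"
        then have "R1\<^sup>2 < (norm x)\<^sup>2" "(norm x)\<^sup>2 < R2\<^sup>2" using ab by auto
        then have "R1 < norm x" "norm x < R2" using R by (auto dest!: power_less_imp_less_base)
        then show "x \<in> \<Omega>" by (simp add: mem_annulus[OF R(1)])
      qed
      have "bounded \<Omega>" by (rule bounded_subset[OF bounded_ball[of 0 R2]]) (auto simp: mem_annulus[OF R(1)])
      then have "compact (closure {x. \<phi> k x \<noteq> 0})"
        by (simp add: compact_eq_bounded_closed) (rule bounded_subset[OF _ order_trans[OF cl sub]])
      ultimately show ?thesis using cl sub by (auto simp: test_functions_def)
    qed
    have norm_sq: "(norm x)\<^sup>2 \<in> {R1\<^sup>2..R2\<^sup>2}" "R1\<^sup>2 < (norm x)\<^sup>2" "(norm x)\<^sup>2 < R2\<^sup>2" if "x \<in> \<Omega>" for x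
      using that R by (auto simp: mem_annulus[OF R(1)] intro!: power_strict_mono power_mono)
    have uU: "u x = integral {R1\<^sup>2..(norm x)\<^sup>2} g" if "x \<in> \<Omega>" for x
      using intg[OF norm_sq(1)[OF that]] by (simp add: u_def)
    \<comment> \<open>\<open>H\<close> depends on \<open>g\<close> exactly as the gradient of
      \<open>\<phi> k\<close> depends on \<open>v k\<close>, so convergence of \<open>v k\<close>
      carries over to the gradients.\<close>
    have Hg: "H x = (2 * g ((norm x)\<^sup>2)) *\<^sub>R x" for x
      by (simp add: radial_field_def g_def)
    have M0: "M \<ge> 0" using vM[of "R1\<^sup>2"] R12 by fastforce
    have lim1: "(\<lambda>k. \<integral>x. norm (u x - \<phi> k x) powr p \<partial>lebesgue_on \<Omega>) \<longlonglongrightarrow> 0"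
    proof (rule integral_powr_tendsto_0[OF annulus_lmeasurable[OF R(1)]])
      show "(\<lambda>x. u x - \<phi> k x) \<in> borel_measurable (lebesgue_on \<Omega>)" for k
        by (intro borel_measurable_diff continuous_borel_measurable_lebesgue_on continuous_on_u
            continuous_on_test_function[OF \<phi>_test])
      show "AE x in lebesgue_on \<Omega>. norm (u x - \<phi> k x) \<le> B * (R2 - R1) + M" for k
      proof (rule AE_I2)
        fix x assume "x \<in> space (lebesgue_on \<Omega>)"
        then have x: "x \<in> \<Omega>" by simp
        then have "R1 < norm x" "norm x < R2" by (auto simp: mem_annulus[OF R(1)])
        then have "B * \<bar>norm x - R1\<bar> \<le> B * (R2 - R1)"
          using w_bound[of 0] by (intro mult_left_mono) auto
        then have "\<bar>u x\<bar> \<le> B * (R2 - R1)" using U_Lipschitz[of "norm x" R1] U0 by (simp add: u_def)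
        moreover have "\<bar>\<phi> k x\<bar> \<le> M" using VM[OF norm_sq(1)[OF x]] by (simp add: \<phi>_eq)
        ultimately show "norm (u x - \<phi> k x) \<le> B * (R2 - R1) + M" by simp
      qed
      show "AE x in lebesgue_on \<Omega>. (\<lambda>k. u x - \<phi> k x) \<longlonglongrightarrow> 0"
      proof (rule AE_I2)
        fix x assume "x \<in> space (lebesgue_on \<Omega>)"
        then have x: "x \<in> \<Omega>" by simp
        have "(\<lambda>k. u x - \<phi> k x) \<longlonglongrightarrow> u x - u x"
          unfolding \<phi>_eq using Vlim[OF norm_sq(1)[OF x]] by (intro tendsto_diff tendsto_const) (simp add: uU[OF x])
        then show "(\<lambda>k. u x - \<phi> k x) \<longlonglongrightarrow> 0" by simp
      qed
    qed (use p in auto)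
    have lim2: "(\<lambda>k. \<integral>x. norm (weak_grad \<Omega> u x - grad UNIV (\<phi> k) x) powr p \<partial>lebesgue_on \<Omega>) \<longlonglongrightarrow> 0"
    proof (rule integral_powr_tendsto_0[OF annulus_lmeasurable[OF R(1)]])
      have wm: "weak_grad \<Omega> u \<in> borel_measurable (lebesgue_on \<Omega>)"
        using W1p_weak_grad(2)[OF open_annulus u_W1p] by (simp add: in_Lp_def)
      show "(\<lambda>x. weak_grad \<Omega> u x - grad UNIV (\<phi> k) x) \<in> borel_measurable (lebesgue_on \<Omega>)" for k
        by (intro borel_measurable_diff wm continuous_borel_measurable_lebesgue_on
            continuous_on_test_gradient[OF \<phi>_test])
      have ae: "AE x in lebesgue_on \<Omega>. x \<in> \<Omega> \<and> weak_grad \<Omega> u x = H x"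
        using weak_grad_u AE_space by eventually_elim auto
      show "AE x in lebesgue_on \<Omega>. norm (weak_grad \<Omega> u x - grad UNIV (\<phi> k) x) \<le> B + 2 * M * R2" for k
        using ae
      proof eventually_elim
        case (elim x)
        then have x: "x \<in> \<Omega>" by simp
        have "norm (grad UNIV (\<phi> k) x) = 2 * \<bar>v k ((norm x)\<^sup>2)\<bar> * norm x" by (simp add: grad\<phi> abs_mult)
        also have "\<dots> \<le> 2 * M * R2"
          using vM[OF norm_sq(1)[OF x]] M0 x by (intro mult_mono) (auto simp: mem_annulus[OF R(1)])
        finally show ?case using elim norm_H_le[of x] norm_triangle_ineq4[of "H x" "grad UNIV (\<phi> k) x"] by simp
      qed
      show "AE x in lebesgue_on \<Omega>. (\<lambda>k. weak_grad \<Omega> u x - grad UNIV (\<phi> k) x) \<longlonglongrightarrow> 0"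
        using ae
      proof eventually_elim
        case (elim x)
        then have x: "x \<in> \<Omega>" by simp
        have "(\<lambda>k. H x - (2 * v k ((norm x)\<^sup>2)) *\<^sub>R x) \<longlonglongrightarrow> H x - (2 * g ((norm x)\<^sup>2)) *\<^sub>R x"
          by (intro tendsto_intros vlim norm_sq[OF x])
        then show ?case using elim by (simp add: grad\<phi> Hg[symmetric])
      qed
    qed (use p in auto)
    have "(\<lambda>k. (\<integral>x. norm (u x - \<phi> k x) powr p \<partial>lebesgue_on \<Omega>)
        + (\<integral>x. norm (weak_grad \<Omega> u x - grad UNIV (\<phi> k) x) powr p \<partial>lebesgue_on \<Omega>)) \<longlonglongrightarrow> 0"
      using tendsto_add[OF lim1 lim2] by simp
    then have "\<exists>\<phi>\<in>test_functions \<Omega>. (\<integral>x. \<bar>u x - \<phi> x\<bar> powr p \<partial>lebesgue_on \<Omega>)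
        + (\<integral>x. norm (weak_grad \<Omega> u x - grad UNIV \<phi> x) powr p \<partial>lebesgue_on \<Omega>) < e" if "e > 0" for e
    proof -
      have "\<forall>\<^sub>F k in sequentially. (\<integral>x. norm (u x - \<phi> k x) powr p \<partial>lebesgue_on \<Omega>)
        + (\<integral>x. norm (weak_grad \<Omega> u x - grad UNIV (\<phi> k) x) powr p \<partial>lebesgue_on \<Omega>) < e"
        by (rule order_tendstoD(2)) fact+
      then obtain k where "(\<integral>x. norm (u x - \<phi> k x) powr p \<partial>lebesgue_on \<Omega>)
        + (\<integral>x. norm (weak_grad \<Omega> u x - grad UNIV (\<phi> k) x) powr p \<partial>lebesgue_on \<Omega>) < e"
        by (auto simp: eventually_sequentially)
      then show ?thesis using \<phi>_test by (intro bexI[of _ "\<phi> k"]) auto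
    qed
    then show ?thesis using u_W1p by (simp add: W01p_def)
  qed
qed

lemma u_primal_space: "u \<in> primal_space p \<Omega>"
  using u_W01p continuous_on_u by (simp add: primal_space_def radial_on_def u_def)

end

section \<open>Convex duality\<close>

lemma sq_powr_half: "t \<ge> 0 \<Longrightarrow> (t\<^sup>2) powr (p / 2) = t powr (p::real)"
  using powr_powr[of t 2 "p / 2"] by (cases "t = 0") auto

lemma Phi_nonneg: "Phi p \<epsilon> g \<ge> 0"
  by (simp add: Phi_def chi_def)

lemma powr_shift: "q \<ge> 0 \<Longrightarrow> q powr ((p - 2) / 2) * q = q powr (p / 2)" for q p :: real
  using powr_add[of q "(p - 2) / 2" 1] by (cases "q = 0") (auto simp: diff_divide_distrib)

lemma powr_dual_exponent:
  fixes q p :: real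
  assumes "p \<noteq> 2"
  shows "(q powr ((p - 2) / 2)) powr (p / (p - 2)) = q powr (p / 2)"
proof -
  have "(p - 2) / 2 * (p / (p - 2)) = p / 2" using assms by (simp add: divide_simps)
  then show ?thesis by (simp only: powr_powr)
qed

text \<open>The gradient inequality for a convex function. Cauchy-Schwarz for the vectors (a, sqrt
  k) and (b, sqrt k) bounds the mixed term by sqrt (q * Q), and Young's inequality with weights 1 -
  1 / p and 1 / p separates the two.\<close>

lemma Phi_subgradient:
  assumes p: "p > 1"
  shows "1 / p * Phi p \<epsilon> a powr (p / 2) + (Phi p \<epsilon> a powr ((p - 2) / 2) *\<^sub>R a) \<bullet> (b - a)
    \<le> 1 / p * Phi p \<epsilon> b powr (p / 2)"
proof (cases "Phi p \<epsilon> a = 0")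
  case True
  then show ?thesis using p by simp
next
  case False
  define k where "k = chi p * \<epsilon>\<^sup>2"
  have k: "k \<ge> 0" by (simp add: k_def chi_def)
  define q where "q = Phi p \<epsilon> a"
  define Q where "Q = Phi p \<epsilon> b"
  have q: "q > 0" using False Phi_nonneg[of p \<epsilon> a] by (simp add: q_def)
  have Q: "Q \<ge> 0" by (simp add: Q_def Phi_nonneg)
  have qe: "q = (norm a)\<^sup>2 + k" and Qe: "Q = (norm b)\<^sup>2 + k" by (simp_all add: q_def Q_def Phi_def k_def)
  have "a \<bullet> b + k \<le> norm a * norm b + k" using norm_cauchy_schwarz[of a b] by simp
  also have "\<dots> \<le> sqrt (q * Q)"
  proof (rule real_le_rsqrt)
    \<comment> \<open>This is the difference of the two sides of the inequality below.\<close>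
    have "0 \<le> k * (norm a - norm b)\<^sup>2" using k by simp
    then show "(norm a * norm b + k)\<^sup>2 \<le> q * Q"
      by (simp add: qe Qe power2_eq_square algebra_simps)
  qed
  finally have cs: "a \<bullet> b + k \<le> sqrt q * sqrt Q" by (simp add: real_sqrt_mult)
  have young: "q powr ((p - 2) / 2) * (sqrt q * sqrt Q) \<le> (1 - 1 / p) * q powr (p / 2) + 1 / p * Q powr (p / 2)"
  proof (cases "Q = 0")
    case True
    then show ?thesis using p by simp
  next
    case False
    then have Q: "Q > 0" using Q by simp
    have "(q powr (p / 2)) powr (1 - 1 / p) * (Q powr (p / 2)) powr (1 / p)
        \<le> (1 - 1 / p) * q powr (p / 2) + 1 / p * Q powr (p / 2)"
      using p q Q by (intro Youngs_inequality_0) auto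
    moreover have "(q powr (p / 2)) powr (1 - 1 / p) = q powr ((p - 2) / 2) * sqrt q"
    proof -
      have e: "p / 2 * (1 - 1 / p) = (p - 2) / 2 + 1 / 2" using p by (simp add: field_simps)
      show ?thesis unfolding powr_powr e powr_add using q by (simp add: powr_half_sqrt)
    qed
    moreover have "(Q powr (p / 2)) powr (1 / p) = sqrt Q"
      using p Q by (simp add: powr_powr powr_half_sqrt)
    ultimately show ?thesis by (simp add: mult.assoc)
  qed
  have "(q powr ((p - 2) / 2) *\<^sub>R a) \<bullet> (b - a) = q powr ((p - 2) / 2) * (a \<bullet> b + k) - q powr ((p - 2) / 2) * q"
    by (simp add: qe dot_square_norm inner_diff_right algebra_simps)
  also have "\<dots> \<le> q powr ((p - 2) / 2) * (sqrt q * sqrt Q) - q powr (p / 2)"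
    using cs q powr_shift[of q p] by (simp add: mult_left_mono)
  also have "\<dots> \<le> 1 / p * Q powr (p / 2) - 1 / p * q powr (p / 2)"
    using young by (simp add: algebra_simps)
  finally show ?thesis by (simp add: q_def Q_def)
qed

lemma Phi_measurable [measurable]: "Phi p \<epsilon> \<in> borel_measurable borel"
  unfolding Phi_def[abs_def] by measurable

lemma integrable_Phi_powr:
  fixes g :: "real^'n \<Rightarrow> real^'n"
  assumes S: "S \<in> lmeasurable" and g: "in_Lp p S g" and p: "p \<ge> 0"
  shows "integrable (lebesgue_on S) (\<lambda>x. Phi p \<epsilon> (g x) powr (p / 2))"
proof -
  interpret finite_measure "lebesgue_on S" using S by (rule finite_measure_lebesgue_on)
  define k where "k = chi p * \<epsilon>\<^sup>2"
  have k: "k \<ge> 0" by (simp add: k_def chi_def)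
  have gm [measurable]: "g \<in> borel_measurable (lebesgue_on S)"
    and gi: "integrable (lebesgue_on S) (\<lambda>x. norm (g x) powr p)"
    using g by (auto simp: in_Lp_def)
  show ?thesis
  proof (rule Bochner_Integration.integrable_bound)
    show "integrable (lebesgue_on S) (\<lambda>x. 2 powr (p / 2) * (norm (g x) powr p + k powr (p / 2)))"
      using gi by auto
    show "(\<lambda>x. Phi p \<epsilon> (g x) powr (p / 2)) \<in> borel_measurable (lebesgue_on S)" by measurable
    show "AE x in lebesgue_on S. norm (Phi p \<epsilon> (g x) powr (p / 2)) \<le> norm (2 powr (p / 2) * (norm (g x) powr p + k powr (p / 2)))"
    proof (rule AE_I2)
      fix x
      have "Phi p \<epsilon> (g x) powr (p / 2) \<le> 2 powr (p / 2) * (((norm (g x))\<^sup>2) powr (p / 2) + k powr (p / 2))"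
        unfolding Phi_def k_def[symmetric] using p k by (intro powr_add_le) auto
      then show "norm (Phi p \<epsilon> (g x) powr (p / 2)) \<le> norm (2 powr (p / 2) * (norm (g x) powr p + k powr (p / 2)))"
        by (simp add: sq_powr_half)
    qed
  qed
qed

section \<open>Pointwise optimality in the dual problem\<close>

text \<open>Bernoulli's inequality for real exponents, from weighted arithmetic and geometric means.
  In the second part the weights r / (1 + r) and 1 / (1 + r) make the geometric mean of y and y powr
  (- r) equal to 1.\<close>

lemma powr_ge_tangent:
  fixes y r :: real
  assumes y: "y > 0" and r: "r \<ge> 1"
  shows "y powr r \<ge> 1 + r * (y - 1)" and "y powr (- r) \<ge> 1 - r * (y - 1)"
proof -
  have "(y powr r) powr (1 / r) * 1 powr (1 - 1 / r) \<le> 1 / r * y powr r + (1 - 1 / r) * 1"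
    using y r by (intro Youngs_inequality_0) auto
  then have "y \<le> 1 / r * y powr r + (1 - 1 / r)" using y r by (simp add: powr_powr)
  then have "r * y \<le> r * (1 / r * y powr r + (1 - 1 / r))" using r by (intro mult_left_mono) auto
  also have "\<dots> = y powr r + r - 1" using r by (simp add: field_simps)
  finally show "y powr r \<ge> 1 + r * (y - 1)" by (simp add: algebra_simps)
  have "y powr (r / (1 + r)) * (y powr (- r)) powr (1 / (1 + r)) \<le> r / (1 + r) * y + 1 / (1 + r) * y powr (- r)"
    using y r by (intro Youngs_inequality_0) (auto simp: field_simps)
  moreover have "y powr (r / (1 + r)) * (y powr (- r)) powr (1 / (1 + r)) = 1"
    using y by (simp add: powr_powr powr_add[symmetric])
  ultimately have "(1 + r) * 1 \<le> (1 + r) * (r / (1 + r) * y + 1 / (1 + r) * y powr (- r))"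
    using r by (intro mult_left_mono) auto
  also have "\<dots> = r * y + y powr (- r)" using r by (simp add: distrib_left)
  finally show "y powr (- r) \<ge> 1 - r * (y - 1)" by (simp add: algebra_simps)
qed

text \<open>The factor - 1 / 2 of the dual energy is left out, so minimizing the dual energy means
  maximizing this pointwise, and conversely.\<close>

definition dual_integrand :: "real \<Rightarrow> real \<Rightarrow> real^'n \<Rightarrow> real \<Rightarrow> ereal" where
  "dual_integrand p \<epsilon> t z = ereal ((norm t)\<^sup>2) / ereal (2 * z)
     + ereal (- (2 * chi p * \<epsilon>\<^sup>2 * z) + (p - 2) / p * (2 * z) powr (p / (p - 2)))"

text \<open>The right side is arranged so that, after integration and multiplication by - 1 / 2, the
  weak equation turns it into the primal energy. For q = 0 the quotient is 0 / 0 = 0.\<close>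

lemma dual_integrand_critical:
  fixes g :: "real^'n" and p \<epsilon> :: real
  assumes p: "p > 1" "p \<noteq> 2"
  defines "q \<equiv> Phi p \<epsilon> g"
  shows "dual_integrand p \<epsilon> (q powr ((p - 2) / 2) *\<^sub>R g) (1 / 2 * q powr ((p - 2) / 2))
    = ereal (2 * ((q powr ((p - 2) / 2) *\<^sub>R g) \<bullet> g) - 2 / p * q powr (p / 2))"
proof (cases "q = 0")
  case True
  then show ?thesis using p by (simp add: dual_integrand_def zero_ereal_def[symmetric])
next
  case False
  define l where "l = q powr ((p - 2) / 2)"
  have q: "q > 0" using False Phi_nonneg[of p \<epsilon> g] by (simp add: q_def)
  have l: "l > 0" using q by (simp add: l_def)
  have lq: "l * q = q powr (p / 2)" unfolding l_def by (rule powr_shift) (use q in simp)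
  have lp: "l powr (p / (p - 2)) = q powr (p / 2)"
    using p by (simp add: l_def powr_dual_exponent)
  have qe: "q = (norm g)\<^sup>2 + chi p * \<epsilon>\<^sup>2" by (simp add: q_def Phi_def)
  have "(norm (l *\<^sub>R g))\<^sup>2 / l + (- (chi p * \<epsilon>\<^sup>2 * l) + (p - 2) / p * l powr (p / (p - 2)))
     = l * (norm g)\<^sup>2 - chi p * \<epsilon>\<^sup>2 * l + (1 - 2 / p) * (l * q)"
    using l p by (simp add: lp lq power_mult_distrib power2_eq_square diff_divide_distrib)
  also have "\<dots> = 2 * (l * (norm g)\<^sup>2) - 2 / p * (l * q)"
    by (simp add: qe algebra_simps)
  finally show ?thesis
    using l by (simp add: dual_integrand_def l_def[symmetric] lq dot_square_norm)
qed

text \<open>With x = 2 * z / l and \<beta> = p / (2 - p) the integrand is l times a / x - k * x - q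
  * x powr (- \<beta>) / \<beta>, and x = 1 is critical. It mixes the convex a / x with a concave
  power. Splitting q = a + k gives each of the first two terms its share of the power, and each pair
  obeys a tangent inequality.\<close>

lemma dual_integrand_le:
  fixes g :: "real^'n" and p \<epsilon> :: real
  assumes p: "p > 1" "p < 2" and \<epsilon>: "\<epsilon> > 0" and z: "z > 0"
  defines "q \<equiv> Phi p \<epsilon> g"
  shows "dual_integrand p \<epsilon> (q powr ((p - 2) / 2) *\<^sub>R g) z
    \<le> dual_integrand p \<epsilon> (q powr ((p - 2) / 2) *\<^sub>R g) (1 / 2 * q powr ((p - 2) / 2))"
proof -
  define k where "k = chi p * \<epsilon>\<^sup>2"
  have k: "k > 0" using p \<epsilon> by (simp add: k_def chi_def)
  define a where "a = (norm g)\<^sup>2"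
  have a: "a \<ge> 0" by (simp add: a_def)
  have qe: "q = a + k" by (simp add: q_def Phi_def k_def a_def)
  have q: "q > 0" using a k by (simp add: qe)
  define l where "l = q powr ((p - 2) / 2)"
  have l: "l > 0" using q by (simp add: l_def)
  define \<beta> where "\<beta> = p / (2 - p)"
  have \<beta>: "\<beta> > 1" using p by (simp add: \<beta>_def field_simps)
  have \<beta>': "p / (p - 2) = - \<beta>" "(p - 2) / p = - (1 / \<beta>)"
    using p by (simp_all add: \<beta>_def field_simps)
  have lp: "l powr (- \<beta>) = l * q"
    using p q powr_shift[of q p] powr_dual_exponent[of p q] by (simp only: l_def \<beta>'(1)[symmetric])
  define x where "x = 2 * z / l"
  have x: "x > 0" using z l by (simp add: x_def)
  have zx: "2 * z = l * x" using l by (simp add: x_def)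
  have b1: "1 / x - 1 \<le> 1 / \<beta> * (x powr (- \<beta>) - 1)"
  proof -
    have "(1 / x) powr \<beta> = x powr (- \<beta>)" using x by (simp add: powr_divide powr_minus_divide)
    then have "\<beta> * (1 / x - 1) \<le> x powr (- \<beta>) - 1" using powr_ge_tangent(1)[of "1 / x" \<beta>] x \<beta> by simp
    then show ?thesis using \<beta> by (simp add: field_simps)
  qed
  have b2: "1 - x \<le> 1 / \<beta> * (x powr (- \<beta>) - 1)"
  proof -
    have "\<beta> * (1 - x) \<le> x powr (- \<beta>) - 1" using powr_ge_tangent(2)[of x \<beta>] x \<beta> by (simp add: algebra_simps)
    then show ?thesis using \<beta> by (simp add: field_simps)
  qed
  have "l * (a * (1 / x - 1) + k * (1 - x)) \<le> l * (a * (1 / \<beta> * (x powr (- \<beta>) - 1)) + k * (1 / \<beta> * (x powr (- \<beta>) - 1)))"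
    using a k l b1 b2 by (intro mult_left_mono add_mono) auto
  also have "\<dots> = 1 / \<beta> * (l * q * x powr (- \<beta>) - l * q)"
    by (simp add: qe algebra_simps)
  finally have "l * a / x - k * (l * x) - 1 / \<beta> * (l * q * x powr (- \<beta>)) \<le> l * a - k * l - 1 / \<beta> * (l * q)"
    by (simp add: algebra_simps)
  moreover have "(l * x) powr (- \<beta>) = l * q * x powr (- \<beta>)"
    using l x by (simp add: powr_mult lp)
  moreover have "l\<^sup>2 * a / (l * x) = l * a / x" "l\<^sup>2 * a / l = l * a"
    using l x by (simp_all add: power2_eq_square)
  ultimately have "l\<^sup>2 * a / (l * x) - k * (l * x) - 1 / \<beta> * (l * x) powr (- \<beta>)
     \<le> l\<^sup>2 * a / l - k * l - 1 / \<beta> * l powr (- \<beta>)"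
    unfolding lp by simp
  then have "(norm (l *\<^sub>R g))\<^sup>2 / (2 * z) + (- (2 * chi p * \<epsilon>\<^sup>2 * z) + (p - 2) / p * (2 * z) powr (p / (p - 2)))
    \<le> (norm (l *\<^sub>R g))\<^sup>2 / l + (- (chi p * \<epsilon>\<^sup>2 * l) + (p - 2) / p * l powr (p / (p - 2)))"
  proof -
    have e: "2 * chi p * \<epsilon>\<^sup>2 * z = k * (l * x)" unfolding k_def zx[symmetric] by simp
    assume "l\<^sup>2 * a / (l * x) - k * (l * x) - 1 / \<beta> * (l * x) powr (- \<beta>)
     \<le> l\<^sup>2 * a / l - k * l - 1 / \<beta> * l powr (- \<beta>)"
    then show ?thesis unfolding e zx \<beta>' k_def[symmetric] by (simp add: power_mult_distrib a_def)
  qed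
  then show ?thesis
    using l z by (simp add: dual_integrand_def l_def[symmetric])
qed

text \<open>Here chi vanishes, and with x = 2 * z / l the integrand is l * a * (1 / x + x powr
  \<beta> / \<beta>); the bounds 1 / x \<ge> 2 - x and Bernoulli's inequality are sharp at x = 1. At
  z = 0 the value is \<infinity> unless g = 0, and for g = 0 the minimum is 0.\<close>

lemma dual_integrand_ge:
  fixes g :: "real^'n" and p \<epsilon> :: real
  assumes p: "p > 2" and z: "z \<ge> 0"
  defines "q \<equiv> Phi p \<epsilon> g"
  shows "dual_integrand p \<epsilon> (q powr ((p - 2) / 2) *\<^sub>R g) (1 / 2 * q powr ((p - 2) / 2))
    \<le> dual_integrand p \<epsilon> (q powr ((p - 2) / 2) *\<^sub>R g) z"
proof (cases "g = 0")
  case True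
  then have q0: "q = 0" using p by (simp add: q_def Phi_def chi_def)
  have "0 \<le> (p - 2) / p * (2 * z) powr (p / (p - 2))" using p by simp
  then show ?thesis using p True q0 by (simp add: dual_integrand_def chi_def zero_ereal_def[symmetric])
next
  case False
  define a where "a = (norm g)\<^sup>2"
  have qa: "q = a" using p by (simp add: q_def Phi_def chi_def a_def)
  have a: "a > 0" using False by (simp add: a_def)
  define l where "l = q powr ((p - 2) / 2)"
  have l: "l > 0" using a by (simp add: l_def qa)
  show ?thesis
  proof (cases "z = 0")
    case True
    then have "dual_integrand p \<epsilon> (l *\<^sub>R g) z = \<infinity>"
      using l False p by (simp add: dual_integrand_def divide_ereal_def)
    then show ?thesis by (simp add: l_def)
  next
    case zn: False
    define \<beta> where "\<beta> = p / (p - 2)"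
    have \<beta>: "\<beta> > 1" using p by (simp add: \<beta>_def field_simps)
    have \<beta>': "(p - 2) / p = 1 / \<beta>" using p by (simp add: \<beta>_def)
    have lp: "l powr \<beta> = l * a"
      using p a powr_shift[of q p] powr_dual_exponent[of p q] by (simp add: l_def \<beta>_def qa)
    define x where "x = 2 * z / l"
    have x: "x > 0" using z zn l by (simp add: x_def)
    have zx: "2 * z = l * x" using l by (simp add: x_def)
    have "1 / x \<ge> 2 - x"
    proof -
      have "0 \<le> (x - 1)\<^sup>2 / x" using x by simp
      also have "(x - 1)\<^sup>2 / x = 1 / x - (2 - x)" using x by (simp add: power2_eq_square field_simps)
      finally show ?thesis by simp
    qed
    moreover have "x - 1 \<le> 1 / \<beta> * (x powr \<beta> - 1)"
      using powr_ge_tangent(1)[of x \<beta>] x \<beta> by (simp add: field_simps)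
    ultimately have "0 \<le> (1 / x - 1) + 1 / \<beta> * (x powr \<beta> - 1)" by linarith
    then have "0 \<le> l * a * ((1 / x - 1) + 1 / \<beta> * (x powr \<beta> - 1))" using l a by simp
    then have "l * a + 1 / \<beta> * (l * a) \<le> l * a / x + 1 / \<beta> * (l * a * x powr \<beta>)"
      by (simp add: algebra_simps)
    moreover have "(l * x) powr \<beta> = l * a * x powr \<beta>"
      using l x by (simp add: powr_mult lp)
    moreover have "l\<^sup>2 * a / (l * x) = l * a / x" "l\<^sup>2 * a / l = l * a"
      using l x by (simp_all add: power2_eq_square)
    ultimately have "l\<^sup>2 * a / l + 1 / \<beta> * l powr \<beta> \<le> l\<^sup>2 * a / (l * x) + 1 / \<beta> * (l * x) powr \<beta>"
      unfolding lp by simp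
    then have "(norm (l *\<^sub>R g))\<^sup>2 / l + (p - 2) / p * l powr (p / (p - 2))
      \<le> (norm (l *\<^sub>R g))\<^sup>2 / (2 * z) + (p - 2) / p * (2 * z) powr (p / (p - 2))"
      unfolding zx \<beta>' \<beta>_def[symmetric] by (simp add: power_mult_distrib a_def)
    then show ?thesis
      using l z zn p by (simp add: dual_integrand_def l_def[symmetric] chi_def)
  qed
qed

section \<open>Integrals with infinite values\<close>

text \<open>\<open>nn_integral\<close> and subtraction in \<open>ereal\<close> are monotone without
  any finiteness condition, so competitors of infinite dual energy are covered.\<close>

lemma ext_integral_mono:
  assumes "AE x in M. g x \<le> g' x"
  shows "ext_integral M g \<le> ext_integral M g'"
  unfolding ext_integral_def
proof (rule ereal_minus_mono)
  show "enn2ereal (\<integral>\<^sup>+x. e2ennreal (g x) \<partial>M) \<le> enn2ereal (\<integral>\<^sup>+x. e2ennreal (g' x) \<partial>M)"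
    using assms unfolding less_eq_ennreal.rep_eq[symmetric]
    by (intro nn_integral_mono_AE) (auto elim!: eventually_mono intro: e2ennreal_mono)
  show "enn2ereal (\<integral>\<^sup>+x. e2ennreal (- g' x) \<partial>M) \<le> enn2ereal (\<integral>\<^sup>+x. e2ennreal (- g x) \<partial>M)"
    using assms unfolding less_eq_ennreal.rep_eq[symmetric]
    by (intro nn_integral_mono_AE) (auto elim!: eventually_mono intro: e2ennreal_mono)
qed

lemma ext_integral_cong:
  "(\<And>x. x \<in> space M \<Longrightarrow> g x = g' x) \<Longrightarrow> ext_integral M g = ext_integral M g'"
  by (intro antisym ext_integral_mono) (auto intro!: AE_I2)

lemma ext_integral_real:
  assumes r: "integrable M r"
  shows "ext_integral M (\<lambda>x. ereal (r x)) = ereal (\<integral>x. r x \<partial>M)"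
proof -
  have fin: "(\<integral>\<^sup>+x. ennreal (r x) \<partial>M) \<noteq> \<infinity>" "(\<integral>\<^sup>+x. ennreal (- r x) \<partial>M) \<noteq> \<infinity>"
    using r by (auto simp: real_integrable_def)
  have e: "enn2ereal y = ereal (enn2real y)" if "y \<noteq> \<infinity>" for y
    using that by (cases y) (auto simp: enn2ereal_ennreal top_ennreal.rep_eq)
  have "ext_integral M (\<lambda>x. ereal (r x)) = enn2ereal (\<integral>\<^sup>+x. ennreal (r x) \<partial>M) - enn2ereal (\<integral>\<^sup>+x. ennreal (- r x) \<partial>M)"
    by (simp add: ext_integral_def ennreal.abs_eq e2ennreal_def)
  also have "\<dots> = ereal (enn2real (\<integral>\<^sup>+x. ennreal (r x) \<partial>M) - enn2real (\<integral>\<^sup>+x. ennreal (- r x) \<partial>M))"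
    using e[OF fin(1)] e[OF fin(2)] by simp
  also have "\<dots> = ereal (\<integral>x. r x \<partial>M)" using r by (simp add: real_lebesgue_integral_def)
  finally show ?thesis .
qed

lemma dual_energy_eq:
  "dual_energy p \<epsilon> S t z = - (ereal (1 / 2) * ext_integral (lebesgue_on S) (\<lambda>x. dual_integrand p \<epsilon> (t x) (z x)))"
proof -
  have "ereal (- (1 / 2)) = - ereal (1 / 2)" by simp
  then show ?thesis by (simp only: dual_energy_def dual_integrand_def ereal_mult_minus_left)
qed

lemma dual_energy_mono:
  assumes "AE x in lebesgue_on S. dual_integrand p \<epsilon> (t x) (z' x) \<le> dual_integrand p \<epsilon> (t x) (z x)"
  shows "dual_energy p \<epsilon> S t z \<le> dual_energy p \<epsilon> S t z'"
  unfolding dual_energy_eq ereal_minus_le_minus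
  by (rule ereal_mult_left_mono[OF ext_integral_mono[OF assms]]) simp

section \<open>Energies of the solution\<close>

context annulus_solution
begin

lemma T_eq: "x \<in> \<Omega> \<Longrightarrow> T x = (Phi p \<epsilon> (H x) powr ((p - 2) / 2)) *\<^sub>R H x"
  by (simp add: flux_radial_field annulus_nonzero[OF R(1)] flux_w)

lemma f_measurable: "f \<in> borel_measurable (lebesgue_on \<Omega>)"
  by (rule continuous_imp_measurable_on_sets_lebesgue[OF continuous_on_subset[OF f_cont closure_subset] annulus_sets_lebesgue])

lemma T_f_bounded: "\<exists>M. \<forall>x\<in>\<Omega>. norm (T x) \<le> M \<and> \<bar>f x\<bar> \<le> M"
proof -
  have "continuous_on (closure \<Omega>) T"
    by (rule continuous_on_T) (use closure_annulus_nonzero[OF R] in blast)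
  then have "bounded (T ` closure \<Omega>)" "bounded (f ` closure \<Omega>)"
    using f_cont by (auto intro!: compact_imp_bounded compact_continuous_image compact_closed_annulus R)
  then obtain M1 M2 where "\<forall>x\<in>closure \<Omega>. norm (T x) \<le> M1" "\<forall>x\<in>closure \<Omega>. \<bar>f x\<bar> \<le> M2"
    by (auto simp: bounded_iff)
  then have "\<forall>x\<in>\<Omega>. norm (T x) \<le> max M1 M2 \<and> \<bar>f x\<bar> \<le> max M1 M2"
    using closure_Omega by (auto simp: le_max_iff_disj)
  then show ?thesis by blast
qed

lemma
  assumes v: "v \<in> W01p p \<Omega>"
  shows weak_equation: "(\<integral>x. T x \<bullet> weak_grad \<Omega> v x \<partial>lebesgue_on \<Omega>) = (\<integral>x. f x * v x \<partial>lebesgue_on \<Omega>)"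
    and integrable_T_weak_grad: "integrable (lebesgue_on \<Omega>) (\<lambda>x. T x \<bullet> weak_grad \<Omega> v x)"
    and integrable_f_mult: "integrable (lebesgue_on \<Omega>) (\<lambda>x. f x * v x)"
proof -
  obtain M where M: "\<And>x. x \<in> \<Omega> \<Longrightarrow> norm (T x) \<le> M" "\<And>x. x \<in> \<Omega> \<Longrightarrow> \<bar>f x\<bar> \<le> M"
    using T_f_bounded by blast
  note W = weak_equation_W01p[OF open_annulus annulus_lmeasurable[OF R(1)] p(1)
      lebesgue_on_measurable[OF T_measurable] M(1) f_measurable M(2) weak_equation_test v]
  show "(\<integral>x. T x \<bullet> weak_grad \<Omega> v x \<partial>lebesgue_on \<Omega>) = (\<integral>x. f x * v x \<partial>lebesgue_on \<Omega>)"
    "integrable (lebesgue_on \<Omega>) (\<lambda>x. T x \<bullet> weak_grad \<Omega> v x)"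
    "integrable (lebesgue_on \<Omega>) (\<lambda>x. f x * v x)" using W by simp_all
qed

lemma integrable_Phi_weak_grad:
  "v \<in> W1p p \<Omega> \<Longrightarrow> integrable (lebesgue_on \<Omega>) (\<lambda>x. Phi p \<epsilon> (weak_grad \<Omega> v x) powr (p / 2))"
  using p by (intro integrable_Phi_powr annulus_lmeasurable R(1) W1p_weak_grad(2) open_annulus) auto

lemma integrable_Phi_H: "integrable (lebesgue_on \<Omega>) (\<lambda>x. Phi p \<epsilon> (H x) powr (p / 2))"
  by (rule integrable_cong_AE_imp[OF integrable_Phi_weak_grad[OF u_W1p]])
     (use lebesgue_on_measurable[OF H_measurable] weak_grad_u in \<open>auto elim!: eventually_mono\<close>)

text \<open>The common value in the chain of duality identities, written with the explicit gradient
  \<open>H\<close>; every functional is compared with it separately.\<close>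

definition energy :: real where
  "energy = 1 / p * (\<integral>x. Phi p \<epsilon> (H x) powr (p / 2) \<partial>lebesgue_on \<Omega>) - (\<integral>x. f x * u x \<partial>lebesgue_on \<Omega>)"

lemma H_lebesgue_measurable [measurable]: "H \<in> borel_measurable (lebesgue_on \<Omega>)"
  using H_measurable by (rule lebesgue_on_measurable)

lemma weak_grad_u_measurable [measurable]: "weak_grad \<Omega> u \<in> borel_measurable (lebesgue_on \<Omega>)"
  using W1p_weak_grad(2)[OF open_annulus u_W1p] by (simp add: in_Lp_def)

lemma T_lebesgue_measurable [measurable]: "T \<in> borel_measurable (lebesgue_on \<Omega>)"
  using T_measurable by (rule lebesgue_on_measurable)

lemma primal_energy_u: "primal_energy p \<epsilon> \<Omega> f u = energy"
proof -
  have "(\<integral>x. Phi p \<epsilon> (weak_grad \<Omega> u x) powr (p / 2) \<partial>lebesgue_on \<Omega>) = (\<integral>x. Phi p \<epsilon> (H x) powr (p / 2) \<partial>lebesgue_on \<Omega>)"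
    using weak_grad_u by (intro integral_cong_AE) (measurable, auto elim!: eventually_mono)
  then show ?thesis by (simp add: primal_energy_def energy_def)
qed

text \<open>The weak equation tested with \<open>u\<close> itself; it converts the primal form of
  the energy into the dual one.\<close>

lemma integral_T_H: "(\<integral>x. T x \<bullet> H x \<partial>lebesgue_on \<Omega>) = (\<integral>x. f x * u x \<partial>lebesgue_on \<Omega>)"
  and integrable_T_H: "integrable (lebesgue_on \<Omega>) (\<lambda>x. T x \<bullet> H x)"
proof -
  have ae: "AE x in lebesgue_on \<Omega>. T x \<bullet> weak_grad \<Omega> u x = T x \<bullet> H x"
    using weak_grad_u by eventually_elim simp
  have "(\<integral>x. T x \<bullet> weak_grad \<Omega> u x \<partial>lebesgue_on \<Omega>) = (\<integral>x. T x \<bullet> H x \<partial>lebesgue_on \<Omega>)"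
    by (rule integral_cong_AE[OF _ _ ae]) measurable
  then show "(\<integral>x. T x \<bullet> H x \<partial>lebesgue_on \<Omega>) = (\<integral>x. f x * u x \<partial>lebesgue_on \<Omega>)"
    using weak_equation[OF u_W01p] by simp
  show "integrable (lebesgue_on \<Omega>) (\<lambda>x. T x \<bullet> H x)"
    by (rule integrable_cong_AE_imp[OF integrable_T_weak_grad[OF u_W01p] _ ae]) measurable
qed

text \<open>Integrate the gradient inequality at \<open>H\<close> towards the weak gradient of
  \<open>v\<close>. By the weak equation the linear term becomes the difference of the load terms of
  \<open>v\<close> and \<open>u\<close>.\<close>

lemma primal_energy_ge:
  assumes v: "v \<in> primal_space p \<Omega>"
  shows "energy \<le> primal_energy p \<epsilon> \<Omega> f v"
proof -
  have vW: "v \<in> W01p p \<Omega>" "v \<in> W1p p \<Omega>" using v by (auto simp: primal_space_def W01p_def)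
  let ?I = "\<lambda>g. \<integral>x. g x \<partial>lebesgue_on \<Omega>"
  have "?I (\<lambda>x. 1 / p * Phi p \<epsilon> (H x) powr (p / 2) + (T x \<bullet> weak_grad \<Omega> v x - T x \<bullet> H x))
     \<le> ?I (\<lambda>x. 1 / p * Phi p \<epsilon> (weak_grad \<Omega> v x) powr (p / 2))"
  proof (rule integral_mono)
    fix x assume "x \<in> space (lebesgue_on \<Omega>)"
    then have x: "x \<in> \<Omega>" by simp
    show "1 / p * Phi p \<epsilon> (H x) powr (p / 2) + (T x \<bullet> weak_grad \<Omega> v x - T x \<bullet> H x)
        \<le> 1 / p * Phi p \<epsilon> (weak_grad \<Omega> v x) powr (p / 2)"
      using Phi_subgradient[OF p(1), of \<epsilon> "H x" "weak_grad \<Omega> v x"] unfolding T_eq[OF x] inner_diff_right .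
  qed (intro Bochner_Integration.integrable_add Bochner_Integration.integrable_diff integrable_mult_right
        integrable_Phi_H integrable_Phi_weak_grad vW integrable_T_weak_grad integrable_T_H)+
  also have "?I (\<lambda>x. 1 / p * Phi p \<epsilon> (H x) powr (p / 2) + (T x \<bullet> weak_grad \<Omega> v x - T x \<bullet> H x))
     = 1 / p * ?I (\<lambda>x. Phi p \<epsilon> (H x) powr (p / 2)) + (?I (\<lambda>x. f x * v x) - ?I (\<lambda>x. f x * u x))"
    using integrable_Phi_H integrable_T_weak_grad[OF vW(1)] integrable_T_H
    by (simp add: weak_equation[OF vW(1)] integral_T_H)
  finally show ?thesis by (simp add: energy_def primal_energy_def)
qed

lemma zeta_u: "x \<in> closure \<Omega> \<Longrightarrow> zeta_bar p \<epsilon> \<Omega> u x = 1 / 2 * Phi p \<epsilon> (H x) powr ((p - 2) / 2)"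
  by (simp add: zeta_bar_def grad_u)

lemma Phi_H_bounds: "k \<le> Phi p \<epsilon> (H x)" "Phi p \<epsilon> (H x) \<le> B\<^sup>2 + k"
  using norm_H_le[of x] by (simp_all add: Phi_def power_mono)

lemma zeta_measurable [measurable]: "zeta_bar p \<epsilon> \<Omega> u \<in> borel_measurable (lebesgue_on \<Omega>)"
proof -
  have "(\<lambda>x. 1 / 2 * Phi p \<epsilon> (H x) powr ((p - 2) / 2)) \<in> borel_measurable (lebesgue_on \<Omega>)" by measurable
  then show ?thesis
    by (subst measurable_lebesgue_cong[where g="\<lambda>x. 1 / 2 * Phi p \<epsilon> (H x) powr ((p - 2) / 2)"])
       (auto simp: zeta_u closure_Omega)
qed

text \<open>For p < 2 the exponent is negative, so the lower bound \<open>\<epsilon>\<^sup>2\<close>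
  of \<open>Phi\<close> gives the required upper bound. For p > 2 the boundedness of
  \<open>H\<close> gives integrability.\<close>

lemma zeta_dual_space: "zeta_bar p \<epsilon> \<Omega> u \<in> dual_space p \<epsilon> \<Omega>"
proof (cases "p < 2")
  case True
  have "0 < zeta_bar p \<epsilon> \<Omega> u x \<and> zeta_bar p \<epsilon> \<Omega> u x \<le> \<epsilon> powr (p - 2) / 2" if x: "x \<in> \<Omega>" for x
  proof -
    have q: "\<epsilon>\<^sup>2 \<le> Phi p \<epsilon> (H x)" using Phi_H_bounds(1)[of x] True by (simp add: chi_def)
    have "Phi p \<epsilon> (H x) powr ((p - 2) / 2) \<le> (\<epsilon>\<^sup>2) powr ((p - 2) / 2)"
      using q True \<epsilon> by (intro powr_mono2') auto
    also have "\<dots> = \<epsilon> powr (p - 2)" using \<epsilon> by (intro sq_powr_half) simp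
    finally have "Phi p \<epsilon> (H x) powr ((p - 2) / 2) \<le> \<epsilon> powr (p - 2)" .
    moreover have "0 < Phi p \<epsilon> (H x)" using q \<epsilon> less_le_trans[of 0 "\<epsilon>\<^sup>2"] by simp
    ultimately show ?thesis by (simp add: zeta_u[OF closure_Omega[OF x]])
  qed
  then show ?thesis using True zeta_measurable by (simp add: dual_space_def)
next
  case False
  have "in_Lp (p / (p - 2)) \<Omega> (zeta_bar p \<epsilon> \<Omega> u)"
  proof (rule in_Lp_bounded[OF annulus_lmeasurable[OF R(1)] zeta_measurable])
    fix x assume x: "x \<in> \<Omega>"
    have "Phi p \<epsilon> (H x) powr ((p - 2) / 2) \<le> (B\<^sup>2 + k) powr ((p - 2) / 2)"
      using False Phi_H_bounds(2)[of x] Phi_nonneg by (intro powr_mono2) auto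
    then show "norm (zeta_bar p \<epsilon> \<Omega> u x) \<le> 1 / 2 * (B\<^sup>2 + k) powr ((p - 2) / 2)"
      by (simp add: zeta_u[OF closure_Omega[OF x]])
  qed (use False in auto)
  moreover have "AE x in lebesgue_on \<Omega>. 0 \<le> zeta_bar p \<epsilon> \<Omega> u x"
    by (rule AE_I2) (simp add: zeta_u closure_Omega)
  ultimately show ?thesis using False by (simp add: dual_space_def)
qed

text \<open>Pointwise this is equality in the Legendre transform: Phi * zeta minus
  \<open>Psi_star\<close> at zeta is Phi powr (p / 2) / p, because 1 / 2 - (p - 2) / (2 * p) = 1 /
  p.\<close>

lemma Xi_u: "Xi p \<epsilon> \<Omega> f u (zeta_bar p \<epsilon> \<Omega> u) = energy"
proof -
  have pointwise: "Phi p \<epsilon> (weak_grad \<Omega> u x) * zeta_bar p \<epsilon> \<Omega> u x - Psi_star p (zeta_bar p \<epsilon> \<Omega> u x) - f x * u x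
      = 1 / p * Phi p \<epsilon> (H x) powr (p / 2) - f x * u x"
    if x: "x \<in> \<Omega>" and g: "weak_grad \<Omega> u x = H x" for x
  proof -
    define q where "q = Phi p \<epsilon> (H x)"
    have q: "q powr ((p - 2) / 2) * q = q powr (p / 2)" by (rule powr_shift) (simp add: q_def Phi_nonneg)
    have z: "zeta_bar p \<epsilon> \<Omega> u x = 1 / 2 * q powr ((p - 2) / 2)"
      using zeta_u[OF closure_Omega[OF x]] by (simp add: q_def)
    have "Psi_star p (zeta_bar p \<epsilon> \<Omega> u x) = (p - 2) / (2 * p) * q powr (p / 2)"
      unfolding z Psi_star_def using powr_dual_exponent[OF p(2), of q] by simp
    moreover have "q * zeta_bar p \<epsilon> \<Omega> u x = 1 / 2 * q powr (p / 2)"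
      unfolding z q[symmetric] by simp
    moreover have "1 / 2 * q powr (p / 2) - (p - 2) / (2 * p) * q powr (p / 2) = 1 / p * q powr (p / 2)"
      using p by (simp add: field_simps)
    ultimately show ?thesis unfolding g q_def[symmetric] by simp
  qed
  have ae: "AE x in lebesgue_on \<Omega>. Phi p \<epsilon> (weak_grad \<Omega> u x) * zeta_bar p \<epsilon> \<Omega> u x
      - Psi_star p (zeta_bar p \<epsilon> \<Omega> u x) - f x * u x = 1 / p * Phi p \<epsilon> (H x) powr (p / 2) - f x * u x"
    using weak_grad_u AE_space by eventually_elim (rule pointwise; simp)
  have fu: "integrable (lebesgue_on \<Omega>) (\<lambda>x. f x * u x)" by (rule integrable_f_mult[OF u_W01p])
  note [measurable] = f_measurable borel_measurable_integrable[OF fu]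
  have "Xi p \<epsilon> \<Omega> f u (zeta_bar p \<epsilon> \<Omega> u) = (\<integral>x. 1 / p * Phi p \<epsilon> (H x) powr (p / 2) - f x * u x \<partial>lebesgue_on \<Omega>)"
    unfolding Xi_def by (rule integral_cong_AE[OF _ _ ae]) (unfold Psi_star_def, measurable)
  also have "\<dots> = energy" using integrable_Phi_H fu by (simp add: energy_def)
  finally show ?thesis .
qed

lemma dual_energy_theta:
  "dual_energy p \<epsilon> \<Omega> (theta p \<epsilon> \<Omega> u) z = - (ereal (1 / 2) * ext_integral (lebesgue_on \<Omega>)
     (\<lambda>x. dual_integrand p \<epsilon> ((Phi p \<epsilon> (H x) powr ((p - 2) / 2)) *\<^sub>R H x) (z x)))"
  unfolding dual_energy_eq
  by (subst ext_integral_cong[of "lebesgue_on \<Omega>" "\<lambda>x. dual_integrand p \<epsilon> (theta p \<epsilon> \<Omega> u x) (z x)"])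
     (auto simp: theta_u closure_Omega T_eq)

text \<open>By \<open>dual_integrand_critical\<close> the dual energy is the gradient term of the
  primal energy minus the integral of \<open>T x \<bullet> H x\<close>, and
  \<open>integral_T_H\<close> identifies the latter with the load term.\<close>

lemma dual_energy_u: "dual_energy p \<epsilon> \<Omega> (theta p \<epsilon> \<Omega> u) (zeta_bar p \<epsilon> \<Omega> u) = ereal energy"
proof -
  let ?r = "\<lambda>x. 2 * (T x \<bullet> H x) - 2 / p * Phi p \<epsilon> (H x) powr (p / 2)"
  have i: "integrable (lebesgue_on \<Omega>) ?r" using integrable_T_H integrable_Phi_H by simp
  have "ext_integral (lebesgue_on \<Omega>) (\<lambda>x. dual_integrand p \<epsilon> ((Phi p \<epsilon> (H x) powr ((p - 2) / 2)) *\<^sub>R H x) (zeta_bar p \<epsilon> \<Omega> u x))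
     = ext_integral (lebesgue_on \<Omega>) (\<lambda>x. ereal (?r x))"
    by (rule ext_integral_cong) (simp only: space_lebesgue_on zeta_u[OF closure_Omega] dual_integrand_critical[OF p] T_eq)
  also have "\<dots> = ereal (\<integral>x. ?r x \<partial>lebesgue_on \<Omega>)" by (rule ext_integral_real[OF i])
  also have "(\<integral>x. ?r x \<partial>lebesgue_on \<Omega>) = - 2 * energy"
    using integrable_T_H integrable_Phi_H by (simp add: integral_T_H energy_def)
  finally show ?thesis by (simp add: dual_energy_theta)
qed

lemma dual_energy_u_le:
  assumes "p < 2" "z \<in> dual_space p \<epsilon> \<Omega>"
  shows "dual_energy p \<epsilon> \<Omega> (theta p \<epsilon> \<Omega> u) (zeta_bar p \<epsilon> \<Omega> u) \<le> dual_energy p \<epsilon> \<Omega> (theta p \<epsilon> \<Omega> u) z"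
proof (rule dual_energy_mono, rule AE_I2)
  fix x assume "x \<in> space (lebesgue_on \<Omega>)"
  then have x: "x \<in> \<Omega>" by simp
  then have "z x > 0" using assms by (auto simp: dual_space_def)
  from dual_integrand_le[OF p(1) assms(1) \<epsilon> this]
  show "dual_integrand p \<epsilon> (theta p \<epsilon> \<Omega> u x) (z x) \<le> dual_integrand p \<epsilon> (theta p \<epsilon> \<Omega> u x) (zeta_bar p \<epsilon> \<Omega> u x)"
    unfolding theta_u[OF closure_Omega[OF x]] T_eq[OF x] zeta_u[OF closure_Omega[OF x]] .
qed

lemma dual_energy_u_ge:
  assumes "p > 2" "z \<in> dual_space p \<epsilon> \<Omega>"
  shows "dual_energy p \<epsilon> \<Omega> (theta p \<epsilon> \<Omega> u) z \<le> dual_energy p \<epsilon> \<Omega> (theta p \<epsilon> \<Omega> u) (zeta_bar p \<epsilon> \<Omega> u)"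
proof (rule dual_energy_mono)
  have "AE x in lebesgue_on \<Omega>. 0 \<le> z x" using assms by (auto simp: dual_space_def)
  then show "AE x in lebesgue_on \<Omega>. dual_integrand p \<epsilon> (theta p \<epsilon> \<Omega> u x) (zeta_bar p \<epsilon> \<Omega> u x)
      \<le> dual_integrand p \<epsilon> (theta p \<epsilon> \<Omega> u x) (z x)"
    using AE_space
  proof eventually_elim
    case (elim x)
    then have x: "x \<in> \<Omega>" by simp
    from dual_integrand_ge[OF assms(1) elim(1)]
    show ?case unfolding theta_u[OF closure_Omega[OF x]] T_eq[OF x] zeta_u[OF closure_Omega[OF x]] .
  qed
qed

lemma INF_primal: "(INF v\<in>primal_space p \<Omega>. ereal (primal_energy p \<epsilon> \<Omega> f v)) = ereal energy"
proof (rule antisym)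
  show "(INF v\<in>primal_space p \<Omega>. ereal (primal_energy p \<epsilon> \<Omega> f v)) \<le> ereal energy"
    by (rule INF_lower2[OF u_primal_space]) (simp add: primal_energy_u)
qed (auto intro!: INF_greatest primal_energy_ge)

lemma dual_optimum:
  "(if p < 2 then INF z\<in>dual_space p \<epsilon> \<Omega>. dual_energy p \<epsilon> \<Omega> (theta p \<epsilon> \<Omega> u) z
    else SUP z\<in>dual_space p \<epsilon> \<Omega>. dual_energy p \<epsilon> \<Omega> (theta p \<epsilon> \<Omega> u) z)
   = dual_energy p \<epsilon> \<Omega> (theta p \<epsilon> \<Omega> u) (zeta_bar p \<epsilon> \<Omega> u)"
proof (cases "p < 2")
  case True
  then have "(INF z\<in>dual_space p \<epsilon> \<Omega>. dual_energy p \<epsilon> \<Omega> (theta p \<epsilon> \<Omega> u) z)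
      = dual_energy p \<epsilon> \<Omega> (theta p \<epsilon> \<Omega> u) (zeta_bar p \<epsilon> \<Omega> u)"
    by (intro antisym INF_lower[OF zeta_dual_space] INF_greatest dual_energy_u_le)
  then show ?thesis using True by simp
next
  case False
  then have "p > 2" using p by simp
  then have "(SUP z\<in>dual_space p \<epsilon> \<Omega>. dual_energy p \<epsilon> \<Omega> (theta p \<epsilon> \<Omega> u) z)
      = dual_energy p \<epsilon> \<Omega> (theta p \<epsilon> \<Omega> u) (zeta_bar p \<epsilon> \<Omega> u)"
    by (intro antisym SUP_upper[OF zeta_dual_space] SUP_least dual_energy_u_ge)
  then show ?thesis using False by simp
qed

end

theorem lemma2p7:
  fixes f :: "real ^ 'n \<Rightarrow> real" and p R1 R2 :: real and \<Omega> :: "(real ^ 'n) set"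
  assumes "CARD('n) \<ge> 2"
    and "p \<in> {1<..<2} \<union> {2<..}"
    and "0 < R1" and "R1 < R2"
    and "\<Omega> = annulus R1 R2"
    and "continuous_on (closure \<Omega>) f" and "radial_on (closure \<Omega>) f"
    and "(\<forall>x\<in>closure \<Omega>. f x > 0) \<or> (\<forall>x\<in>closure \<Omega>. f x < 0)"
  shows "\<exists>u :: real \<Rightarrow> real ^ 'n \<Rightarrow> real. \<forall>\<epsilon>>0.
    radial_solution p \<epsilon> \<Omega> f (u \<epsilon>) \<and>
    (\<forall>v. radial_solution p \<epsilon> \<Omega> f v \<longrightarrow> (\<forall>x\<in>closure \<Omega>. v x = u \<epsilon> x)) \<and>
    u \<epsilon> differentiable_on closure \<Omega> \<and>
    (\<forall>x0\<in>frontier \<Omega>. \<forall>x\<in>closure \<Omega>. \<forall>\<gamma>.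
       valid_path \<gamma> \<and> path_image \<gamma> \<subseteq> closure \<Omega> \<and> pathstart \<gamma> = x0 \<and> pathfinish \<gamma> = x \<longrightarrow>
       has_line_integral (eta p \<epsilon> \<Omega> (u \<epsilon>)) (u \<epsilon> x) \<gamma>) \<and>
    path_independence \<Omega> {x. lam p \<epsilon> \<Omega> (u \<epsilon>) x \<noteq> 0} (eta p \<epsilon> \<Omega> (u \<epsilon>)) \<and>
    u \<epsilon> \<in> primal_space p \<Omega> \<and>
    (\<forall>v\<in>primal_space p \<Omega>. primal_energy p \<epsilon> \<Omega> f (u \<epsilon>) \<le> primal_energy p \<epsilon> \<Omega> f v) \<and>
    zeta_bar p \<epsilon> \<Omega> (u \<epsilon>) \<in> dual_space p \<epsilon> \<Omega> \<and>
    (p < 2 \<longrightarrow>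
       (\<forall>z\<in>dual_space p \<epsilon> \<Omega>.
          dual_energy p \<epsilon> \<Omega> (theta p \<epsilon> \<Omega> (u \<epsilon>)) (zeta_bar p \<epsilon> \<Omega> (u \<epsilon>))
          \<le> dual_energy p \<epsilon> \<Omega> (theta p \<epsilon> \<Omega> (u \<epsilon>)) z)) \<and>
    (p > 2 \<longrightarrow>
       (\<forall>z\<in>dual_space p \<epsilon> \<Omega>.
          dual_energy p \<epsilon> \<Omega> (theta p \<epsilon> \<Omega> (u \<epsilon>)) z
          \<le> dual_energy p \<epsilon> \<Omega> (theta p \<epsilon> \<Omega> (u \<epsilon>)) (zeta_bar p \<epsilon> \<Omega> (u \<epsilon>)))) \<and>
    ereal (primal_energy p \<epsilon> \<Omega> f (u \<epsilon>)) = (INF v\<in>primal_space p \<Omega>. ereal (primal_energy p \<epsilon> \<Omega> f v)) \<and>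
    (INF v\<in>primal_space p \<Omega>. ereal (primal_energy p \<epsilon> \<Omega> f v)) = ereal (Xi p \<epsilon> \<Omega> f (u \<epsilon>) (zeta_bar p \<epsilon> \<Omega> (u \<epsilon>))) \<and>
    ereal (Xi p \<epsilon> \<Omega> f (u \<epsilon>) (zeta_bar p \<epsilon> \<Omega> (u \<epsilon>))) =
      (if p < 2 then INF z\<in>dual_space p \<epsilon> \<Omega>. dual_energy p \<epsilon> \<Omega> (theta p \<epsilon> \<Omega> (u \<epsilon>)) z
       else SUP z\<in>dual_space p \<epsilon> \<Omega>. dual_energy p \<epsilon> \<Omega> (theta p \<epsilon> \<Omega> (u \<epsilon>)) z) \<and>
    (if p < 2 then INF z\<in>dual_space p \<epsilon> \<Omega>. dual_energy p \<epsilon> \<Omega> (theta p \<epsilon> \<Omega> (u \<epsilon>)) z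
     else SUP z\<in>dual_space p \<epsilon> \<Omega>. dual_energy p \<epsilon> \<Omega> (theta p \<epsilon> \<Omega> (u \<epsilon>)) z) =
      dual_energy p \<epsilon> \<Omega> (theta p \<epsilon> \<Omega> (u \<epsilon>)) (zeta_bar p \<epsilon> \<Omega> (u \<epsilon>))"
proof -
  \<comment> \<open>\<open>undefined\<close> names an arbitrary coordinate.\<close>
  define h where "h r = f (r *\<^sub>R axis undefined 1)" for r
  have R: "0 < R1" "R1 < R2" by fact+
  have f_h: "f x = h (norm x)" if x: "x \<in> closure (annulus R1 R2)" for x
  proof -
    let ?y = "norm x *\<^sub>R axis undefined 1 :: real^'n"
    have "norm x = norm ?y" by simp
    moreover from this have "?y \<in> closure (annulus R1 R2)"
      using x by (simp add: mem_closure_annulus[OF R])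
    ultimately show ?thesis
      using \<open>radial_on (closure \<Omega>) f\<close> x unfolding h_def radial_on_def \<open>\<Omega> = annulus R1 R2\<close> by blast
  qed
  have problem: "annulus_problem p \<epsilon> R1 R2 f h" if "\<epsilon> > 0" for \<epsilon>
    by unfold_locales (use assms that f_h in auto)
  \<comment> \<open>The implication sits inside the quantifier so that one function \<open>U\<close>
    can be chosen for all \<epsilon>; the remaining data are recovered for each \<epsilon>
    separately.\<close>
  have "\<exists>U. \<epsilon> > 0 \<longrightarrow> (\<exists>w m B. annulus_solution p \<epsilon> R1 R2 f h U w m B)" for \<epsilon>
    using annulus_problem.solution_exists[OF problem] by blast
  then obtain U where U: "\<And>\<epsilon>. \<epsilon> > 0 \<Longrightarrow> \<exists>w m B. annulus_solution p \<epsilon> R1 R2 f h (U \<epsilon>) w m B" by metis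
  define V where "V \<epsilon> x = U \<epsilon> (norm x)" for \<epsilon> and x :: "real^'n"
  show ?thesis
  proof (rule exI[of _ V], intro allI impI, goal_cases)
    case (1 \<epsilon>)
    then obtain w m B where "annulus_solution p \<epsilon> R1 R2 f h (U \<epsilon>) w m B" using U by blast
    then interpret A: annulus_solution p \<epsilon> R1 R2 f h "U \<epsilon>" w m B .
    have V: "V \<epsilon> = A.u" by (simp add: fun_eq_iff V_def A.u_def)
    show ?case
      unfolding V \<open>\<Omega> = annulus R1 R2\<close>
      by (intro conjI ballI allI impI A.radial_solution_u A.radial_solution_unique A.differentiable_on_u
          A.path_independence_eta A.u_primal_space A.zeta_dual_space A.dual_energy_u_le A.dual_energy_u_ge
          A.dual_optimum)
         (auto simp: A.primal_energy_u A.primal_energy_ge A.INF_primal A.Xi_u A.dual_optimum A.dual_energy_u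
           dest: A.line_integral_u)
  qed
qed

end
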